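(* Let $(R,\mathfrak m)$ be a Cohen-Macaulay local ring of dimension $d\ge 1$ with infinite residue field and with a canonical module $\omega$, let $I$ be an $\mathfrak m$-primary ideal, and let $M$ be a maximal Cohen-Macaulay $R$-module. Let $x\in I\setminus I^2$ be an element such that (1) $x$ is superficial with respect to $I$ for the module $R\oplus\omega$, and (2) $xt\in\mathcal R(I)_1$ is $D^1_I(M)\oplus D^2_I(M)$-filter regular. Set $S=R/xR$, $J=I/(x)$ and $N=M/xM$. Then $$c_i^J(N)=c_i^I(M)\quad\text{for } i=0,1,\dots,d-1.$$
   Context: $\mathcal R(I)=\bigoplus_{n\ge0}I^n$ is the Rees algebra (with $xt$ denoting $x\in I$ placed in degree $1$). For $i\ge1$, $D^i_I(M)=\bigoplus_{n\ge0}\operatorname{Ext}^i_R(M,\omega/I^n\omega)$, a finitely generated graded $\mathcal R(I)$-module, where $at$ (with $a\in I$) acts by the maps induced by multiplication by $a$, $\omega/I^n\omega\to\omega/I^{n+1}\omega$. An element $x\in I$ is superficial with respect to $I$ for a finitely generated module $E$ if there is $c\ge0$ with $(I^{n+1}E:_E x)\cap I^cE=I^nE$ for all $n\ge c$. For a finitely generated graded $\mathcal R(I)$-module $E=\bigoplus_n E_n$, $xt$ is $E$-filter regular if multiplication by $xt$, $E_n\to E_{n+1}$, is injective for all $n\gg0$. The dual Hilbert coefficients $c_i^I(M)$ are the integers with $\ell(\operatorname{Hom}_R(M,\omega/I^{n+1}\omega))=\sum_{i=0}^d(-1)^ic_i^I(M)\binom{n+d-i}{d-i}$ for $n\gg0$.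 The element $x$ is regular on $R$, $\omega$, $M$; $S$ is Cohen-Macaulay of dimension $d-1$ with canonical module $\omega_S=\omega/x\omega$, and $c_i^J(N)$ is defined in the same way over $S$ (with $d-1$, $\omega_S$, $J$, $N$ in place of $d$, $\omega$, $I$, $M$). *)

theory Defs
  imports "HOL-Algebra.Ring_Divisibility" "HOL-Algebra.UnivPoly" "HOL-Algebra.Ideal_Product"
    "HOL-Library.Extended_Nat"
begin

text \<open>
  Modules are records over the commutative ring \<open>R\<close> in the sense of \<^locale>\<open>module\<close>.  This record
  type extends the ring record, so it also has the fields \<^const>\<open>monoid.mult\<close> and \<^const>\<open>one\<close>;
  they carry no meaning for modules and are left \<^const>\<open>undefined\<close> below.
\<close>

section \<open>Modules\<close>

definition regular_module :: "('a, 'r) ring_scheme \<Rightarrow> ('a, 'a) module"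
  where "regular_module R = \<lparr>carrier = carrier R, monoid.mult = undefined, one = undefined,
    ring.zero = \<zero>\<^bsub>R\<^esub>, ring.add = ring.add R, smult = monoid.mult R\<rparr>"

definition direct_sum ::
    "('a, 'b, 'm) module_scheme \<Rightarrow> ('a, 'c, 'n) module_scheme \<Rightarrow> ('a, 'b \<times> 'c) module"
  where "direct_sum M N = \<lparr>carrier = carrier M \<times> carrier N, monoid.mult = undefined, one = undefined,
    ring.zero = (\<zero>\<^bsub>M\<^esub>, \<zero>\<^bsub>N\<^esub>),
    ring.add = (\<lambda>u v. (fst u \<oplus>\<^bsub>M\<^esub> fst v, snd u \<oplus>\<^bsub>N\<^esub> snd v)),
    smult = (\<lambda>a u. (a \<odot>\<^bsub>M\<^esub> fst u, a \<odot>\<^bsub>N\<^esub> snd u))\<rparr>"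

definition free_module :: "('a, 'r) ring_scheme \<Rightarrow> nat \<Rightarrow> ('a, nat \<Rightarrow> 'a) module"
  where "free_module R n = \<lparr>carrier = {..<n} \<rightarrow>\<^sub>E carrier R, monoid.mult = undefined, one = undefined,
    ring.zero = (\<lambda>i\<in>{..<n}. \<zero>\<^bsub>R\<^esub>),
    ring.add = (\<lambda>f g. \<lambda>i\<in>{..<n}. f i \<oplus>\<^bsub>R\<^esub> g i),
    smult = (\<lambda>a f. \<lambda>i\<in>{..<n}. a \<otimes>\<^bsub>R\<^esub> f i)\<rparr>"

definition quot_module :: "('a, 'b, 'm) module_scheme \<Rightarrow> 'b set \<Rightarrow> ('a, 'b set) module"
  where "quot_module M H = \<lparr>carrier = a_rcosets\<^bsub>M\<^esub> H, monoid.mult = undefined, one = undefined,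
    ring.zero = H, ring.add = set_add M,
    smult = (\<lambda>a X. \<Union>v\<in>X. H +>\<^bsub>M\<^esub> (a \<odot>\<^bsub>M\<^esub> v))\<rparr>"

definition span_submodule ::
    "('a, 'r) ring_scheme \<Rightarrow> ('a, 'b, 'm) module_scheme \<Rightarrow> 'b set \<Rightarrow> 'b set"
  where "span_submodule R M A = \<Inter> {H. submodule H R M \<and> A \<subseteq> H}"

definition finitely_generated ::
    "('a, 'r) ring_scheme \<Rightarrow> ('a, 'b, 'm) module_scheme \<Rightarrow> bool"
  where "finitely_generated R M \<longleftrightarrow>
    (\<exists>A. finite A \<and> A \<subseteq> carrier M \<and> span_submodule R M A = carrier M)"

definition ideal_smult ::
    "('a, 'r) ring_scheme \<Rightarrow> 'a set \<Rightarrow> ('a, 'b, 'm) module_scheme \<Rightarrow> 'b set"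
  where "ideal_smult R I M = span_submodule R M {a \<odot>\<^bsub>M\<^esub> v | a v. a \<in> I \<and> v \<in> carrier M}"

text \<open>\<open>M/KM\<close> as a module over the quotient ring \<^term>\<open>R Quot K\<close>, whose elements are cosets of \<open>K\<close>.\<close>

definition reduction ::
    "('a, 'r) ring_scheme \<Rightarrow> 'a set \<Rightarrow> ('a, 'b, 'm) module_scheme \<Rightarrow> ('a set, 'b set) module"
  where "reduction R K M = \<lparr>carrier = a_rcosets\<^bsub>M\<^esub> (ideal_smult R K M),
    monoid.mult = undefined, one = undefined,
    ring.zero = ideal_smult R K M, ring.add = set_add M,
    smult = (\<lambda>A X. \<Union>a\<in>A. \<Union>v\<in>X. ideal_smult R K M +>\<^bsub>M\<^esub> (a \<odot>\<^bsub>M\<^esub> v))\<rparr>"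

definition module_hom ::
    "('a, 'r) ring_scheme \<Rightarrow> ('a, 'b, 'm) module_scheme \<Rightarrow> ('a, 'c, 'n) module_scheme
      \<Rightarrow> ('b \<Rightarrow> 'c) set"
  where "module_hom R M N = {f \<in> carrier M \<rightarrow>\<^sub>E carrier N.
    (\<forall>u\<in>carrier M. \<forall>v\<in>carrier M. f (u \<oplus>\<^bsub>M\<^esub> v) = f u \<oplus>\<^bsub>N\<^esub> f v) \<and>
    (\<forall>a\<in>carrier R. \<forall>v\<in>carrier M. f (a \<odot>\<^bsub>M\<^esub> v) = a \<odot>\<^bsub>N\<^esub> f v)}"

definition hom_module ::
    "('a, 'r) ring_scheme \<Rightarrow> ('a, 'b, 'm) module_scheme \<Rightarrow> ('a, 'c, 'n) module_scheme
      \<Rightarrow> ('a, 'b \<Rightarrow> 'c) module"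
  where "hom_module R M N = \<lparr>carrier = module_hom R M N, monoid.mult = undefined, one = undefined,
    ring.zero = (\<lambda>v\<in>carrier M. \<zero>\<^bsub>N\<^esub>),
    ring.add = (\<lambda>f g. \<lambda>v\<in>carrier M. f v \<oplus>\<^bsub>N\<^esub> g v),
    smult = (\<lambda>a f. \<lambda>v\<in>carrier M. a \<odot>\<^bsub>N\<^esub> f v)\<rparr>"

definition module_length :: "('a, 'r) ring_scheme \<Rightarrow> ('a, 'b, 'm) module_scheme \<Rightarrow> enat"
  where "module_length R M = Sup {enat n | n. \<exists>H :: nat \<Rightarrow> 'b set.
    (\<forall>i\<le>n. submodule (H i) R M) \<and> (\<forall>i<n. H i \<subset> H (Suc i))}"

section \<open>Ext\<close>

text \<open>
  \<open>Ext\<close> is computed from a resolution of the first argument by free modules of finite rank.  Such a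
  resolution exists for every finitely generated module over a Noetherian ring; for other first
  arguments the definition is meaningless.
\<close>

definition free_resolution ::
    "('a, 'r) ring_scheme \<Rightarrow> ('a, 'b, 'm) module_scheme \<Rightarrow> (nat \<Rightarrow> nat)
      \<Rightarrow> (nat \<Rightarrow> (nat \<Rightarrow> 'a) \<Rightarrow> (nat \<Rightarrow> 'a)) \<Rightarrow> ((nat \<Rightarrow> 'a) \<Rightarrow> 'b) \<Rightarrow> bool"
  where "free_resolution R M r \<delta> \<epsilon> \<longleftrightarrow>
    \<epsilon> \<in> module_hom R (free_module R (r 0)) M \<and>
    (\<forall>i. \<delta> i \<in> module_hom R (free_module R (r (Suc i))) (free_module R (r i))) \<and>
    \<epsilon> ` carrier (free_module R (r 0)) = carrier M \<and>
    \<delta> 0 ` carrier (free_module R (r 1)) =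
      {v \<in> carrier (free_module R (r 0)). \<epsilon> v = \<zero>\<^bsub>M\<^esub>} \<and>
    (\<forall>i. \<delta> (Suc i) ` carrier (free_module R (r (Suc (Suc i)))) =
      {v \<in> carrier (free_module R (r (Suc i))). \<delta> i v = \<zero>\<^bsub>free_module R (r i)\<^esub>})"

definition chosen_resolution ::
    "('a, 'r) ring_scheme \<Rightarrow> ('a, 'b, 'm) module_scheme
      \<Rightarrow> (nat \<Rightarrow> nat) \<times> (nat \<Rightarrow> (nat \<Rightarrow> 'a) \<Rightarrow> (nat \<Rightarrow> 'a))"
  where "chosen_resolution R M = (SOME (r, \<delta>). \<exists>\<epsilon>. free_resolution R M r \<delta> \<epsilon>)"

definition resolution_module ::
    "('a, 'r) ring_scheme \<Rightarrow> ('a, 'b, 'm) module_scheme \<Rightarrow> nat \<Rightarrow> ('a, nat \<Rightarrow> 'a) module"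
  where "resolution_module R M i = free_module R (fst (chosen_resolution R M) i)"

definition cochains ::
    "('a, 'r) ring_scheme \<Rightarrow> ('a, 'b, 'm) module_scheme \<Rightarrow> ('a, 'c, 'n) module_scheme \<Rightarrow> nat
      \<Rightarrow> ('a, (nat \<Rightarrow> 'a) \<Rightarrow> 'c) module"
  where "cochains R M N i = hom_module R (resolution_module R M i) N"

definition coboundary_map ::
    "('a, 'r) ring_scheme \<Rightarrow> ('a, 'b, 'm) module_scheme \<Rightarrow> nat
      \<Rightarrow> ((nat \<Rightarrow> 'a) \<Rightarrow> 'c) \<Rightarrow> ((nat \<Rightarrow> 'a) \<Rightarrow> 'c)"
  where "coboundary_map R M i f =
    compose (carrier (resolution_module R M (Suc i))) f (snd (chosen_resolution R M) i)"

definition cocycles ::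
    "('a, 'r) ring_scheme \<Rightarrow> ('a, 'b, 'm) module_scheme \<Rightarrow> ('a, 'c, 'n) module_scheme \<Rightarrow> nat
      \<Rightarrow> ((nat \<Rightarrow> 'a) \<Rightarrow> 'c) set"
  where "cocycles R M N i = {f \<in> carrier (cochains R M N i).
    coboundary_map R M i f = \<zero>\<^bsub>cochains R M N (Suc i)\<^esub>}"

primrec coboundaries ::
    "('a, 'r) ring_scheme \<Rightarrow> ('a, 'b, 'm) module_scheme \<Rightarrow> ('a, 'c, 'n) module_scheme \<Rightarrow> nat
      \<Rightarrow> ((nat \<Rightarrow> 'a) \<Rightarrow> 'c) set"
  where
    "coboundaries R M N 0 = {\<zero>\<^bsub>cochains R M N 0\<^esub>}"
  | "coboundaries R M N (Suc i) = coboundary_map R M i ` carrier (cochains R M N i)"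

definition Ext ::
    "('a, 'r) ring_scheme \<Rightarrow> nat \<Rightarrow> ('a, 'b, 'm) module_scheme \<Rightarrow> ('a, 'c, 'n) module_scheme
      \<Rightarrow> ('a, ((nat \<Rightarrow> 'a) \<Rightarrow> 'c) set) module"
  where "Ext R i M N =
    quot_module ((cochains R M N i)\<lparr>carrier := cocycles R M N i\<rparr>) (coboundaries R M N i)"

text \<open>The map \<open>Ext\<^sup>i(M, N) \<rightarrow> Ext\<^sup>i(M, N')\<close> induced by \<open>\<phi> : N \<rightarrow> N'\<close>, on cosets of cocycles.\<close>

definition Ext_map ::
    "('a, 'r) ring_scheme \<Rightarrow> nat \<Rightarrow> ('a, 'b, 'm) module_scheme \<Rightarrow> ('a, 'c, 'n) module_scheme
      \<Rightarrow> ('c \<Rightarrow> 'c) \<Rightarrow> ((nat \<Rightarrow> 'a) \<Rightarrow> 'c) set \<Rightarrow> ((nat \<Rightarrow> 'a) \<Rightarrow> 'c) set"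
  where "Ext_map R i M N' \<phi> X = (\<Union>f\<in>X.
    coboundaries R M N' i +>\<^bsub>cochains R M N' i\<^esub> compose (carrier (resolution_module R M i)) \<phi> f)"

section \<open>Cohen-Macaulay rings and canonical modules\<close>

definition noetherian_local_ring :: "('a, 'r) ring_scheme \<Rightarrow> 'a set \<Rightarrow> bool"
  where "noetherian_local_ring R \<mm> \<longleftrightarrow>
    cring R \<and> noetherian_ring R \<and> {P. maximalideal P R} = {\<mm>}"

definition krull_dim :: "('a, 'r) ring_scheme \<Rightarrow> enat"
  where "krull_dim R = Sup {enat n | n. \<exists>P :: nat \<Rightarrow> 'a set.
    (\<forall>i\<le>n. primeideal (P i) R) \<and> (\<forall>i<n. P i \<subset> P (Suc i))}"

text \<open>
  The regularity of \<open>xs ! i\<close> on \<open>M/(xs ! 0, \<dots>, xs ! (i - 1))M\<close> is expressed by representatives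
  in \<open>M\<close>.
\<close>

definition regular_sequence ::
    "('a, 'r) ring_scheme \<Rightarrow> ('a, 'b, 'm) module_scheme \<Rightarrow> 'a list \<Rightarrow> bool"
  where "regular_sequence R M xs \<longleftrightarrow>
    set xs \<subseteq> carrier R \<and>
    (\<forall>i<length xs. \<forall>v\<in>carrier M.
      xs ! i \<odot>\<^bsub>M\<^esub> v \<in> ideal_smult R (genideal R (set (take i xs))) M \<longrightarrow>
      v \<in> ideal_smult R (genideal R (set (take i xs))) M) \<and>
    ideal_smult R (genideal R (set xs)) M \<noteq> carrier M"

definition depth ::
    "('a, 'r) ring_scheme \<Rightarrow> 'a set \<Rightarrow> ('a, 'b, 'm) module_scheme \<Rightarrow> enat"
  where "depth R \<mm> M = Sup {enat (length xs) | xs. set xs \<subseteq> \<mm> \<and> regular_sequence R M xs}"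

definition cohen_macaulay_local_ring :: "('a, 'r) ring_scheme \<Rightarrow> 'a set \<Rightarrow> bool"
  where "cohen_macaulay_local_ring R \<mm> \<longleftrightarrow>
    noetherian_local_ring R \<mm> \<and> depth R \<mm> (regular_module R) = krull_dim R"

definition maximal_cohen_macaulay ::
    "('a, 'r) ring_scheme \<Rightarrow> 'a set \<Rightarrow> ('a, 'b, 'm) module_scheme \<Rightarrow> bool"
  where "maximal_cohen_macaulay R \<mm> M \<longleftrightarrow>
    module R M \<and> finitely_generated R M \<and> carrier M \<noteq> {\<zero>\<^bsub>M\<^esub>} \<and> depth R \<mm> M = krull_dim R"

text \<open>
  The test modules range over the type of \<open>E\<close>.  This is no restriction when the type has a copy of
  \<open>R\<close> (as \<^typ>\<open>nat \<Rightarrow> 'a\<close> does), since by Baer's criterion the inclusions of ideals into \<open>R\<close> suffice.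
\<close>

definition injective_module :: "('a, 'r) ring_scheme \<Rightarrow> ('a, 'e) module \<Rightarrow> bool"
  where "injective_module R E \<longleftrightarrow> module R E \<and>
    (\<forall>(B :: ('a, 'e) module) A f.
      module R B \<and> submodule A R B \<and> f \<in> module_hom R (B\<lparr>carrier := A\<rparr>) E \<longrightarrow>
      (\<exists>g\<in>module_hom R B E. \<forall>v\<in>A. g v = f v))"

text \<open>
  Finite injective resolutions are sought among modules with elements in \<^typ>\<open>nat \<Rightarrow> 'a\<close>.  For a
  Noetherian \<open>R\<close> this loses nothing: a finitely generated module and all its cosyzygies have
  injective hulls of cardinality at most \<open>max(|R|, \<aleph>\<^sub>0)\<close>.
\<close>

definition finite_injective_dimension ::
    "('a, 'r) ring_scheme \<Rightarrow> ('a, 'b, 'm) module_scheme \<Rightarrow> bool"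
  where "finite_injective_dimension R C \<longleftrightarrow>
    (\<exists>(E :: nat \<Rightarrow> ('a, nat \<Rightarrow> 'a) module) \<eta> \<delta> n.
      (\<forall>i. injective_module R (E i)) \<and>
      \<eta> \<in> module_hom R C (E 0) \<and>
      (\<forall>i. \<delta> i \<in> module_hom R (E i) (E (Suc i))) \<and>
      inj_on \<eta> (carrier C) \<and>
      \<eta> ` carrier C = {v \<in> carrier (E 0). \<delta> 0 v = \<zero>\<^bsub>E 1\<^esub>} \<and>
      (\<forall>i. \<delta> i ` carrier (E i) =
        {v \<in> carrier (E (Suc i)). \<delta> (Suc i) v = \<zero>\<^bsub>E (Suc (Suc i))\<^esub>}) \<and>
      (\<forall>i>n. carrier (E i) = {\<zero>\<^bsub>E i\<^esub>}))"

text \<open>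
  The type of \<open>M\<close> is the dimension of \<open>Ext\<^sup>t(R/\<mm>, M)\<close>, \<open>t\<close> the depth of \<open>M\<close>, over the field \<open>R/\<mm>\<close>.
  As \<open>\<mm>\<close> annihilates this module, the dimension is its length over \<open>R\<close>.
\<close>

definition cm_type ::
    "('a, 'r) ring_scheme \<Rightarrow> 'a set \<Rightarrow> ('a, 'b, 'm) module_scheme \<Rightarrow> enat"
  where "cm_type R \<mm> M = module_length R
    (Ext R (the_enat (depth R \<mm> M)) (quot_module (regular_module R) \<mm>) M)"

definition canonical_module ::
    "('a, 'r) ring_scheme \<Rightarrow> 'a set \<Rightarrow> ('a, 'b, 'm) module_scheme \<Rightarrow> bool"
  where "canonical_module R \<mm> \<omega> \<longleftrightarrow>
    maximal_cohen_macaulay R \<mm> \<omega> \<and> cm_type R \<mm> \<omega> = 1 \<and> finite_injective_dimension R \<omega>"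

section \<open>Ideal powers, superficial elements, the Rees algebra\<close>

definition ideal_radical :: "('a, 'r) ring_scheme \<Rightarrow> 'a set \<Rightarrow> 'a set"
  where "ideal_radical R I = {a \<in> carrier R. \<exists>n :: nat. a [^]\<^bsub>R\<^esub> n \<in> I}"

definition primary_to :: "('a, 'r) ring_scheme \<Rightarrow> 'a set \<Rightarrow> 'a set \<Rightarrow> bool"
  where "primary_to R P I \<longleftrightarrow> ideal I R \<and> I \<noteq> carrier R \<and>
    (\<forall>a\<in>carrier R. \<forall>b\<in>carrier R. a \<otimes>\<^bsub>R\<^esub> b \<in> I \<longrightarrow> a \<in> I \<or> b \<in> ideal_radical R I) \<and>
    ideal_radical R I = P"

primrec ideal_power :: "('a, 'r) ring_scheme \<Rightarrow> 'a set \<Rightarrow> nat \<Rightarrow> 'a set"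
  where
    "ideal_power R I 0 = carrier R"
  | "ideal_power R I (Suc n) = ideal_prod R I (ideal_power R I n)"

definition superficial ::
    "('a, 'r) ring_scheme \<Rightarrow> 'a set \<Rightarrow> ('a, 'b, 'm) module_scheme \<Rightarrow> 'a \<Rightarrow> bool"
  where "superficial R I E x \<longleftrightarrow> (\<exists>c. \<forall>n\<ge>c.
    {e \<in> carrier E. x \<odot>\<^bsub>E\<^esub> e \<in> ideal_smult R (ideal_power R I (Suc n)) E}
      \<inter> ideal_smult R (ideal_power R I c) E
    = ideal_smult R (ideal_power R I n) E)"

text \<open>
  The Rees algebra is the subring \<open>\<Oplus> I\<^sup>n t\<^sup>n\<close> of \<open>R[t]\<close>, so \<open>x t\<close> is \<^term>\<open>up_ring.monom (UP R) x 1\<close>.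
\<close>

definition rees_algebra :: "('a, 'r) ring_scheme \<Rightarrow> 'a set \<Rightarrow> ('a, nat \<Rightarrow> 'a) up_ring"
  where "rees_algebra R I = (UP R)\<lparr>carrier :=
    {p \<in> carrier (UP R). \<forall>n. up_ring.coeff (UP R) p n \<in> ideal_power R I n}\<rparr>"

text \<open>\<open>grade n\<close> is the homogeneous component of \<open>E\<close> in degree \<open>n\<close>.\<close>

definition filter_regular ::
    "('p, 'e, 'm) module_scheme \<Rightarrow> (nat \<Rightarrow> 'e set) \<Rightarrow> 'p \<Rightarrow> bool"
  where "filter_regular E grade y \<longleftrightarrow> (\<exists>n0. \<forall>n\<ge>n0. inj_on (\<lambda>e. y \<odot>\<^bsub>E\<^esub> e) (grade n))"

definition adic_quotient ::
    "('a, 'r) ring_scheme \<Rightarrow> 'a set \<Rightarrow> ('a, 'b, 'm) module_scheme \<Rightarrow> nat \<Rightarrow> ('a, 'b set) module"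
  where "adic_quotient R I W n = quot_module W (ideal_smult R (ideal_power R I n) W)"

text \<open>Multiplication by \<open>b\<close>, as a map \<open>W/I\<^sup>nW \<rightarrow> W/I\<^sup>n\<^sup>+\<^sup>kW\<close> for \<open>b \<in> I\<^sup>k\<close>.\<close>

definition adic_mult ::
    "('a, 'r) ring_scheme \<Rightarrow> 'a set \<Rightarrow> ('a, 'b, 'm) module_scheme \<Rightarrow> nat \<Rightarrow> nat \<Rightarrow> 'a
      \<Rightarrow> 'b set \<Rightarrow> 'b set"
  where "adic_mult R I W n k b = (\<lambda>X\<in>carrier (adic_quotient R I W n).
    \<Union>w\<in>X. ideal_smult R (ideal_power R I (n + k)) W +>\<^bsub>W\<^esub> (b \<odot>\<^bsub>W\<^esub> w))"

definition dual_Ext_piece ::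
    "('a, 'r) ring_scheme \<Rightarrow> 'a set \<Rightarrow> ('a, 'b, 'm) module_scheme \<Rightarrow> ('a, 'c, 'n) module_scheme
      \<Rightarrow> nat \<Rightarrow> nat \<Rightarrow> ('a, ((nat \<Rightarrow> 'a) \<Rightarrow> 'b set) set) module"
  where "dual_Ext_piece R I \<omega> M i n = Ext R i M (adic_quotient R I \<omega> n)"

text \<open>
  \<open>D\<^sup>i\<^sub>I(M) = \<Oplus> Ext\<^sup>i(M, \<omega>/I\<^sup>n\<omega>)\<close> as a module over \<^term>\<open>rees_algebra R I\<close>; its elements are the
  finitely supported families.  The summand \<open>b t\<^sup>k\<close> of a scalar maps degree \<open>n - k\<close> to degree \<open>n\<close>.
\<close>

definition dual_Ext ::
    "('a, 'r) ring_scheme \<Rightarrow> 'a set \<Rightarrow> ('a, 'b, 'm) module_scheme \<Rightarrow> ('a, 'c, 'n) module_scheme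
      \<Rightarrow> nat \<Rightarrow> (nat \<Rightarrow> 'a, nat \<Rightarrow> ((nat \<Rightarrow> 'a) \<Rightarrow> 'b set) set) module"
  where "dual_Ext R I \<omega> M i = \<lparr>
    carrier = {u. (\<forall>n. u n \<in> carrier (dual_Ext_piece R I \<omega> M i n)) \<and>
                  finite {n. u n \<noteq> \<zero>\<^bsub>dual_Ext_piece R I \<omega> M i n\<^esub>}},
    monoid.mult = undefined, one = undefined,
    ring.zero = (\<lambda>n. \<zero>\<^bsub>dual_Ext_piece R I \<omega> M i n\<^esub>),
    ring.add = (\<lambda>u v n. u n \<oplus>\<^bsub>dual_Ext_piece R I \<omega> M i n\<^esub> v n),
    smult = (\<lambda>p u n. \<Oplus>\<^bsub>dual_Ext_piece R I \<omega> M i n\<^esub>k\<in>{..n}.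
      Ext_map R i M (adic_quotient R I \<omega> n)
        (adic_mult R I \<omega> (n - k) k (up_ring.coeff (UP R) p k)) (u (n - k)))\<rparr>"

definition dual_Ext_grade ::
    "('a, 'r) ring_scheme \<Rightarrow> 'a set \<Rightarrow> ('a, 'b, 'm) module_scheme \<Rightarrow> ('a, 'c, 'n) module_scheme
      \<Rightarrow> nat \<Rightarrow> nat \<Rightarrow> (nat \<Rightarrow> ((nat \<Rightarrow> 'a) \<Rightarrow> 'b set) set) set"
  where "dual_Ext_grade R I \<omega> M i n = {u \<in> carrier (dual_Ext R I \<omega> M i).
    \<forall>m. m \<noteq> n \<longrightarrow> u m = \<zero>\<^bsub>dual_Ext_piece R I \<omega> M i m\<^esub>}"

section \<open>Dual Hilbert coefficients\<close>

text \<open>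
  The Hilbert polynomial has degree at most \<open>d\<close> and determines \<open>c 0, \<dots>, c d\<close>; the values
  beyond \<open>d\<close> are fixed to make \<open>c\<close> unique.
\<close>

definition is_dual_hilbert_coeffs ::
    "('a, 'r) ring_scheme \<Rightarrow> nat \<Rightarrow> ('a, 'b, 'm) module_scheme \<Rightarrow> 'a set
      \<Rightarrow> ('a, 'c, 'n) module_scheme \<Rightarrow> (nat \<Rightarrow> int) \<Rightarrow> bool"
  where "is_dual_hilbert_coeffs R d \<omega> I M c \<longleftrightarrow> (\<forall>i>d. c i = 0) \<and>
    (\<exists>n0. \<forall>n\<ge>n0. \<exists>l.
      module_length R (hom_module R M (adic_quotient R I \<omega> (n + 1))) = enat l \<and>
      int l = (\<Sum>i=0..d. (- 1) ^ i * c i * int ((n + d - i) choose (d - i))))"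

definition dual_hilbert_coeff ::
    "('a, 'r) ring_scheme \<Rightarrow> nat \<Rightarrow> ('a, 'b, 'm) module_scheme \<Rightarrow> 'a set
      \<Rightarrow> ('a, 'c, 'n) module_scheme \<Rightarrow> nat \<Rightarrow> int"
  where "dual_hilbert_coeff R d \<omega> I M = (THE c. is_dual_hilbert_coeffs R d \<omega> I M c)"

end

(*
  Multiplication by x gives W_n = w/I^n w --> W_{n+1} with cokernel V = w_S/J^{n+1} w_S, where w is the
  canonical module.  It is injective for large n: depth w > 0 and superficiality make x regular on w
  (Krull intersection), and then (I^{n+1} w : x) = I^n w by the Artin-Rees lemma.  Filter regularity on
  Ext^1 kills the connecting map in
    0 -> Hom_R(M, W_n) -> Hom_R(M, W_{n+1}) -> Hom_S(N, V) -> Ext^1(M, W_n) -> Ext^1(M, W_{n+1}),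
  so the Hilbert function over S is the difference of the one over R, and the polynomials follow.
  The Hilbert-Serre theorem is not needed, because the one function is eventually polynomial exactly
  when the other one is.
*)
theory Submission
  imports Defs
begin

text \<open>\<open>Hom\<close> over \<open>R\<close> and \<open>Hom\<close> over
  \<open>S = R/(x)\<close> live in different types over different rings. Instead of restricting
  scalars, reduction maps are treated as maps semilinear along \<open>R \<rightarrow> S\<close>, and
  length is additive for short exact sequences whose right end is an \<open>S\<close>-module.
  \<open>Ext\<close> comes with one chosen free resolution. What is extracted from it is a lifting
  statement: a homomorphism \<open>M \<rightarrow> V\<close> is lifted on the degree
  \<open>0\<close> free module, and the obstruction, a cocycle with values in \<open>W_n\<close>, is
  removed by a cochain. One weak Artin-Rees statement (\<open>I^n M \<inter> K \<subseteq> L\<close>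
  for some \<open>n\<close>) serves twice: with Nakayama it gives the Krull intersection argument,
  and applied to \<open>x I^c \<omega>\<close> inside \<open>x \<omega>\<close> it gives the colon
  equality. Lengths are extended naturals, so the Hilbert function over \<open>R\<close> has to be
  shown finite before a difference makes sense; this uses that \<open>I\<close> is primary to the
  maximal ideal. Differencing the binomial basis keeps the coefficients and lowers the degree, while
  \<open>c_d\<close>, the coefficient of the constant term, cancels. This is why the equality is for
  \<open>i \<le> d - 1\<close>.\<close>

section \<open>Submodules and semilinear maps\<close>

text \<open>Multiplication by \<open>\<ominus> \<one>\<close> supplies the negatives, so later
  checks that a set is a submodule reduce to zero, sums and scalar multiples.\<close>

lemma (in module) submodule_iff:
  "submodule H R M \<longleftrightarrow> H \<subseteq> carrier M \<and> \<zero>\<^bsub>M\<^esub> \<in> H \<and> (\<forall>u\<in>H. \<forall>v\<in>H. u \<oplus>\<^bsub>M\<^esub> v \<in> H) \<and>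
    (\<forall>a\<in>carrier R. \<forall>v\<in>H. a \<odot>\<^bsub>M\<^esub> v \<in> H)" (is "_ \<longleftrightarrow> ?rhs")
proof
  assume H: "submodule H R M"
  obtain v where v: "v \<in> H" using submoduleE(2)[OF H] by blast
  then have "v \<in> carrier M" using submoduleE(1)[OF H] by blast
  then have "\<zero>\<^bsub>M\<^esub> \<in> H"
    using submoduleE(4)[OF H, of "\<zero>" v] v by simp
  then show ?rhs using submoduleE(1,4,5)[OF H] by blast
next
  assume r: ?rhs
  show "submodule H R M"
  proof (rule submoduleI)
    fix v assume v: "v \<in> H"
    then have "v \<in> carrier M" using r by blast
    then have "\<ominus>\<^bsub>M\<^esub> v = (\<ominus> \<one>) \<odot>\<^bsub>M\<^esub> v" by (simp add: smult_l_minus)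
    then show "\<ominus>\<^bsub>M\<^esub> v \<in> H" using r v by simp
  qed (use r in auto)
qed

lemma (in module) submodule_minus:
  assumes "submodule H R M" "u \<in> H" "v \<in> H"
  shows "u \<ominus>\<^bsub>M\<^esub> v \<in> H"
  using submoduleE(3,5)[OF assms(1)] assms(2,3) by (simp add: M.minus_eq)

lemma (in module) submodule_Int:
  assumes "submodule H R M" "submodule K R M"
  shows "submodule (H \<inter> K) R M"
  using assms by (auto simp: submodule_iff)

lemma (in module) minus_add_cancel:
  assumes "u \<in> carrier M" "v \<in> carrier M"
  shows "(u \<ominus>\<^bsub>M\<^esub> v) \<oplus>\<^bsub>M\<^esub> v = u" "v \<oplus>\<^bsub>M\<^esub> (u \<ominus>\<^bsub>M\<^esub> v) = u"
  using assms by (simp_all add: M.minus_eq M.a_ac M.r_neg)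

lemma (in module) add_minus_cancel:
  assumes "u \<in> carrier M" "v \<in> carrier M"
  shows "(u \<oplus>\<^bsub>M\<^esub> v) \<ominus>\<^bsub>M\<^esub> v = u"
  using assms by (simp add: M.minus_eq M.a_assoc M.r_neg)

lemma (in module) minus_eq_zeroD:
  assumes "u \<in> carrier M" "v \<in> carrier M" "u \<ominus>\<^bsub>M\<^esub> v = \<zero>\<^bsub>M\<^esub>"
  shows "u = v"
  using minus_add_cancel(1)[OF assms(1,2)] assms by simp

lemma (in module) smult_commute:
  assumes "a \<in> carrier R" "b \<in> carrier R" "v \<in> carrier M"
  shows "a \<odot>\<^bsub>M\<^esub> (b \<odot>\<^bsub>M\<^esub> v) = b \<odot>\<^bsub>M\<^esub> (a \<odot>\<^bsub>M\<^esub> v)"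
  using assms by (simp add: smult_assoc1[symmetric] R.m_comm)

section \<open>Sums, spans, products with ideals, and colons\<close>

definition submodule_add :: "('a, 'b, 'm) module_scheme \<Rightarrow> 'b set \<Rightarrow> 'b set \<Rightarrow> 'b set"
  where "submodule_add M H K = {u \<oplus>\<^bsub>M\<^esub> v | u v. u \<in> H \<and> v \<in> K}"

lemma (in module) submodule_add:
  assumes H: "submodule H R M" and K: "submodule K R M"
  shows "submodule (submodule_add M H K) R M"
    and "H \<subseteq> submodule_add M H K" and "K \<subseteq> submodule_add M H K"
proof -
  have hk: "H \<subseteq> carrier M" "K \<subseteq> carrier M" "\<zero>\<^bsub>M\<^esub> \<in> H" "\<zero>\<^bsub>M\<^esub> \<in> K"
    using H K by (simp_all add: submodule_iff)
  show "submodule (submodule_add M H K) R M"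
    unfolding submodule_iff
  proof (intro conjI ballI)
    show "submodule_add M H K \<subseteq> carrier M" using hk by (auto simp: submodule_add_def)
    show "\<zero>\<^bsub>M\<^esub> \<in> submodule_add M H K"
      unfolding submodule_add_def mem_Collect_eq using hk
      by (intro exI[of _ "\<zero>\<^bsub>M\<^esub>"]) simp
  next
    fix u v assume "u \<in> submodule_add M H K" "v \<in> submodule_add M H K"
    then obtain a b a' b' where e: "u = a \<oplus>\<^bsub>M\<^esub> b" "v = a' \<oplus>\<^bsub>M\<^esub> b'" "a \<in> H" "b \<in> K" "a' \<in> H" "b' \<in> K"
      unfolding submodule_add_def by blast
    then have "u \<oplus>\<^bsub>M\<^esub> v = (a \<oplus>\<^bsub>M\<^esub> a') \<oplus>\<^bsub>M\<^esub> (b \<oplus>\<^bsub>M\<^esub> b')"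
      using hk subsetD[OF hk(1)] subsetD[OF hk(2)] by (simp add: M.a_ac)
    then show "u \<oplus>\<^bsub>M\<^esub> v \<in> submodule_add M H K"
      using e submoduleE(5)[OF H] submoduleE(5)[OF K] unfolding submodule_add_def by blast
  next
    fix r u assume r: "r \<in> carrier R" and "u \<in> submodule_add M H K"
    then obtain a b where e: "u = a \<oplus>\<^bsub>M\<^esub> b" "a \<in> H" "b \<in> K"
      unfolding submodule_add_def by blast
    then have "r \<odot>\<^bsub>M\<^esub> u = (r \<odot>\<^bsub>M\<^esub> a) \<oplus>\<^bsub>M\<^esub> (r \<odot>\<^bsub>M\<^esub> b)"
      using hk r by (auto simp: smult_r_distr subset_iff)
    then show "r \<odot>\<^bsub>M\<^esub> u \<in> submodule_add M H K"
      using e r submoduleE(4)[OF H] submoduleE(4)[OF K] unfolding submodule_add_def by blast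
  qed
  show "H \<subseteq> submodule_add M H K"
  proof
    fix u assume "u \<in> H"
    then show "u \<in> submodule_add M H K" unfolding submodule_add_def mem_Collect_eq
      using hk by (intro exI[of _ u] exI[of _ "\<zero>\<^bsub>M\<^esub>"]) (simp add: subset_iff)
  qed
  show "K \<subseteq> submodule_add M H K"
  proof
    fix u assume "u \<in> K"
    then show "u \<in> submodule_add M H K" unfolding submodule_add_def mem_Collect_eq
      using hk by (intro exI[of _ u] exI[of _ "\<zero>\<^bsub>M\<^esub>"]) (simp add: subset_iff)
  qed
qed

lemma (in module) span_submodule:
  assumes "A \<subseteq> carrier M"
  shows "submodule (span_submodule R M A) R M"
  unfolding submodule_iff
proof (intro conjI ballI)
  show "span_submodule R M A \<subseteq> carrier M"
    unfolding span_submodule_def using carrier_is_submodule assms by blast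
qed (auto simp: span_submodule_def submodule_iff)

lemma span_submodule_incl: "A \<subseteq> span_submodule R M A"
  by (auto simp: span_submodule_def)

lemma span_submodule_least:
  assumes "submodule H R M" "A \<subseteq> H"
  shows "span_submodule R M A \<subseteq> H"
  using assms by (auto simp: span_submodule_def)

lemma span_submodule_mono:
  assumes "A \<subseteq> B"
  shows "span_submodule R M A \<subseteq> span_submodule R M B"
  using assms by (auto simp: span_submodule_def)

lemma (in module) span_submodule_empty: "span_submodule R M {} = {\<zero>\<^bsub>M\<^esub>}"
proof
  have "submodule {\<zero>\<^bsub>M\<^esub>} R M" by (auto simp: submodule_iff)
  then show "span_submodule R M {} \<subseteq> {\<zero>\<^bsub>M\<^esub>}" by (rule span_submodule_least) simp
  show "{\<zero>\<^bsub>M\<^esub>} \<subseteq> span_submodule R M {}" using span_submodule[of "{}"] by (simp add: submodule_iff)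
qed

lemma (in module) ideal_smult_submodule:
  assumes "K \<subseteq> carrier R"
  shows "submodule (ideal_smult R K M) R M"
  unfolding ideal_smult_def by (rule span_submodule) (use assms in auto)

lemma ideal_smult_incl:
  assumes "a \<in> K" "v \<in> carrier M"
  shows "a \<odot>\<^bsub>M\<^esub> v \<in> ideal_smult R K M"
  unfolding ideal_smult_def by (rule subsetD[OF span_submodule_incl]) (use assms in auto)

lemma ideal_smult_least:
  assumes "submodule H R M" "\<And>a v. a \<in> K \<Longrightarrow> v \<in> carrier M \<Longrightarrow> a \<odot>\<^bsub>M\<^esub> v \<in> H"
  shows "ideal_smult R K M \<subseteq> H"
  unfolding ideal_smult_def by (rule span_submodule_least) (use assms in auto)

lemma ideal_smult_mono:
  assumes "K \<subseteq> L"
  shows "ideal_smult R K M \<subseteq> ideal_smult R L M"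
  unfolding ideal_smult_def by (rule span_submodule_mono) (use assms in auto)

text \<open>The colon ideal \<open>(H : V)\<close>, used at a single vector to compare a cyclic
  submodule with \<open>H\<close>, and at \<open>V = carrier M\<close> as the annihilator of
  \<open>M/H\<close>.\<close>

lemma (in module) ideal_colon:
  assumes H: "submodule H R M" and V: "V \<subseteq> carrier M"
  shows "ideal {r \<in> carrier R. \<forall>v\<in>V. r \<odot>\<^bsub>M\<^esub> v \<in> H} R"
proof (rule idealI)
  show "ring R" by (rule R.ring_axioms)
  show "subgroup {r \<in> carrier R. \<forall>v\<in>V. r \<odot>\<^bsub>M\<^esub> v \<in> H} (add_monoid R)"
  proof (rule R.add.subgroupI)
    show "{r \<in> carrier R. \<forall>v\<in>V. r \<odot>\<^bsub>M\<^esub> v \<in> H} \<noteq> {}"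
      using H V by (auto simp: submodule_iff subset_iff intro!: exI[of _ "\<zero>"])
    fix a assume "a \<in> {r \<in> carrier R. \<forall>v\<in>V. r \<odot>\<^bsub>M\<^esub> v \<in> H}"
    then show "\<ominus> a \<in> {r \<in> carrier R. \<forall>v\<in>V. r \<odot>\<^bsub>M\<^esub> v \<in> H}"
      using V submoduleE(3)[OF H] by (auto simp: smult_l_minus subset_iff)
  next
    fix a b
    assume "a \<in> {r \<in> carrier R. \<forall>v\<in>V. r \<odot>\<^bsub>M\<^esub> v \<in> H}" "b \<in> {r \<in> carrier R. \<forall>v\<in>V. r \<odot>\<^bsub>M\<^esub> v \<in> H}"
    then show "a \<oplus> b \<in> {r \<in> carrier R. \<forall>v\<in>V. r \<odot>\<^bsub>M\<^esub> v \<in> H}"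
      using V submoduleE(5)[OF H] by (auto simp: smult_l_distr subset_iff)
  qed auto
next
  fix a r assume a: "a \<in> {r \<in> carrier R. \<forall>v\<in>V. r \<odot>\<^bsub>M\<^esub> v \<in> H}" and r: "r \<in> carrier R"
  show *: "r \<otimes> a \<in> {r \<in> carrier R. \<forall>v\<in>V. r \<odot>\<^bsub>M\<^esub> v \<in> H}"
    using a r V submoduleE(4)[OF H] by (auto simp: smult_assoc1 subset_iff)
  have "a \<otimes> r = r \<otimes> a" using a r by (simp add: R.m_comm)
  then show "a \<otimes> r \<in> {r \<in> carrier R. \<forall>v\<in>V. r \<odot>\<^bsub>M\<^esub> v \<in> H}" using * by simp
qed

text \<open>Covers \<open>R\<close>-linear maps (\<open>\<pi> = id\<close>) as well as the reduction
  \<open>M \<rightarrow> M/xM\<close>, whose target is a module over another ring and of another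
  type. Modules over \<open>R\<close> and over \<open>R/(x)\<close> can so be compared without
  restriction of scalars.\<close>

locale semilinear_map = dom: module R M + cod: module S N
  for R :: "('a, 'r) ring_scheme" and S :: "('s, 't) ring_scheme"
    and M :: "('a, 'b, 'm) module_scheme" and N :: "('s, 'c, 'n) module_scheme"
    and \<pi> h +
  assumes ring_hom: "\<pi> \<in> ring_hom R S"
    and hom_closed [simp, intro]: "v \<in> carrier M \<Longrightarrow> h v \<in> carrier N"
    and hom_add: "\<lbrakk>u \<in> carrier M; v \<in> carrier M\<rbrakk> \<Longrightarrow> h (u \<oplus>\<^bsub>M\<^esub> v) = h u \<oplus>\<^bsub>N\<^esub> h v"
    and hom_smult: "\<lbrakk>a \<in> carrier R; v \<in> carrier M\<rbrakk> \<Longrightarrow> h (a \<odot>\<^bsub>M\<^esub> v) = \<pi> a \<odot>\<^bsub>N\<^esub> h v"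
begin

lemma scalar_closed [simp]: "a \<in> carrier R \<Longrightarrow> \<pi> a \<in> carrier S"
  using ring_hom by (rule ring_hom_closed)

lemma hom_zero [simp]: "h \<zero>\<^bsub>M\<^esub> = \<zero>\<^bsub>N\<^esub>"
proof -
  have "h \<zero>\<^bsub>M\<^esub> \<oplus>\<^bsub>N\<^esub> h \<zero>\<^bsub>M\<^esub> = h \<zero>\<^bsub>M\<^esub> \<oplus>\<^bsub>N\<^esub> \<zero>\<^bsub>N\<^esub>"
    by (simp add: hom_add[symmetric])
  then show ?thesis by (simp del: cod.M.r_zero)
qed

lemma hom_uminus: 
  assumes v: "v \<in> carrier M"
  shows "h (\<ominus>\<^bsub>M\<^esub> v) = \<ominus>\<^bsub>N\<^esub> h v"
proof -
  have "h (\<ominus>\<^bsub>M\<^esub> v) \<oplus>\<^bsub>N\<^esub> h v = \<zero>\<^bsub>N\<^esub>"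
    using v by (simp add: hom_add[symmetric] dom.M.l_neg)
  then show ?thesis using v by (simp add: cod.M.minus_equality[symmetric])
qed

lemma hom_minus: 
  assumes "u \<in> carrier M" "v \<in> carrier M"
  shows "h (u \<ominus>\<^bsub>M\<^esub> v) = h u \<ominus>\<^bsub>N\<^esub> h v"
  using assms by (simp add: dom.M.minus_eq cod.M.minus_eq hom_add hom_uminus)

lemma vimage_submodule:
  assumes "submodule K S N"
  shows "submodule {v \<in> carrier M. h v \<in> K} R M"
  using assms by (auto simp: dom.submodule_iff cod.submodule_iff hom_add hom_smult)

lemma kernel_submodule: "submodule {v \<in> carrier M. h v = \<zero>\<^bsub>N\<^esub>} R M"
  by (auto simp: dom.submodule_iff hom_add hom_smult)

lemma eq_iff_minus_kernel:
  assumes "u \<in> carrier M" "v \<in> carrier M"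
  shows "h u = h v \<longleftrightarrow> h (u \<ominus>\<^bsub>M\<^esub> v) = \<zero>\<^bsub>N\<^esub>"
  using assms cod.minus_eq_zeroD[of "h u" "h v"] by (auto simp: hom_minus cod.M.minus_eq cod.M.r_neg)

lemma inj_onI_kernel:
  assumes "\<And>v. v \<in> carrier M \<Longrightarrow> h v = \<zero>\<^bsub>N\<^esub> \<Longrightarrow> v = \<zero>\<^bsub>M\<^esub>"
  shows "inj_on h (carrier M)"
proof (rule inj_onI)
  fix u v assume uv: "u \<in> carrier M" "v \<in> carrier M" and "h u = h v"
  then have "h (u \<ominus>\<^bsub>M\<^esub> v) = \<zero>\<^bsub>N\<^esub>" using eq_iff_minus_kernel[OF uv] by blast
  then have "u \<ominus>\<^bsub>M\<^esub> v = \<zero>\<^bsub>M\<^esub>" using assms[OF dom.M.minus_closed[OF uv]] by blast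
  then show "u = v" using dom.minus_eq_zeroD[OF uv] by blast
qed

end

text \<open>The surjectivity is that of the scalars, not of \<open>h\<close>: it makes images of
  \<open>R\<close>-submodules closed under \<open>S\<close>. Since \<open>id\<close> is surjective,
  every linear map over one ring qualifies.\<close>

locale surj_semilinear_map = semilinear_map +
  assumes scalar_surj: "\<pi> ` carrier R = carrier S"
begin

lemma image_submodule:
  assumes H: "submodule H R M"
  shows "submodule (h ` H) S N"
  unfolding cod.submodule_iff
proof (intro conjI ballI)
  have HM: "H \<subseteq> carrier M" using H by (simp add: dom.submodule_iff)
  then show "h ` H \<subseteq> carrier N" by auto
  show "\<zero>\<^bsub>N\<^esub> \<in> h ` H" using H hom_zero by (metis dom.submodule_iff imageI)
next
  fix u v assume "u \<in> h ` H" "v \<in> h ` H"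
  then obtain u' v' where uv: "u' \<in> H" "u = h u'" "v' \<in> H" "v = h v'" by blast
  then have "u \<oplus>\<^bsub>N\<^esub> v = h (u' \<oplus>\<^bsub>M\<^esub> v')" using dom.submoduleE(1)[OF H] hom_add by (simp add: subset_iff)
  then show "u \<oplus>\<^bsub>N\<^esub> v \<in> h ` H" using dom.submoduleE(5)[OF H uv(1,3)] by blast
next
  fix s u assume "s \<in> carrier S" "u \<in> h ` H"
  then obtain r u' where ru: "r \<in> carrier R" "s = \<pi> r" "u' \<in> H" "u = h u'"
    unfolding scalar_surj[symmetric] by blast
  then have "s \<odot>\<^bsub>N\<^esub> u = h (r \<odot>\<^bsub>M\<^esub> u')" using dom.submoduleE(1)[OF H] hom_smult by (simp add: subset_iff)
  then show "s \<odot>\<^bsub>N\<^esub> u \<in> h ` H" using dom.submoduleE(4)[OF H ru(1,3)] by blast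
qed

lemma image_span:
  assumes A: "A \<subseteq> carrier M"
  shows "h ` span_submodule R M A = span_submodule S N (h ` A)"
proof
  have "submodule {v \<in> carrier M. h v \<in> span_submodule S N (h ` A)} R M"
    using A by (intro vimage_submodule cod.span_submodule) auto
  then have "span_submodule R M A \<subseteq> {v \<in> carrier M. h v \<in> span_submodule S N (h ` A)}"
    using A span_submodule_incl[of "h ` A" S N] by (intro span_submodule_least) auto
  then show "h ` span_submodule R M A \<subseteq> span_submodule S N (h ` A)" by auto
  show "span_submodule S N (h ` A) \<subseteq> h ` span_submodule R M A"
    using A image_submodule[OF dom.span_submodule] span_submodule_incl[of A R M]
    by (intro span_submodule_least) auto
qed

lemma image_ideal_smult_subset:
  assumes "K \<subseteq> carrier R"
  shows "h ` ideal_smult R K M \<subseteq> ideal_smult S (\<pi> ` K) N"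
proof -
  have "h ` {a \<odot>\<^bsub>M\<^esub> v | a v. a \<in> K \<and> v \<in> carrier M}
      \<subseteq> {a \<odot>\<^bsub>N\<^esub> v | a v. a \<in> \<pi> ` K \<and> v \<in> carrier N}"
    using assms by (auto simp: hom_smult subset_iff) blast
  then show ?thesis
    unfolding ideal_smult_def using assms by (subst image_span) (auto intro!: span_submodule_mono)
qed

text \<open>Applied to reduction modulo \<open>x\<close>, this identifies
  \<open>J^n \<omega>_S\<close> with the image of \<open>I^n \<omega>\<close>.\<close>

lemma image_ideal_smult:
  assumes K: "K \<subseteq> carrier R" and surj: "h ` carrier M = carrier N"
  shows "h ` ideal_smult R K M = ideal_smult S (\<pi> ` K) N"
proof -
  have "h ` {a \<odot>\<^bsub>M\<^esub> v | a v. a \<in> K \<and> v \<in> carrier M}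
      = {a \<odot>\<^bsub>N\<^esub> v | a v. a \<in> \<pi> ` K \<and> v \<in> carrier N}" (is "?A = ?B")
  proof
    show "?A \<subseteq> ?B" using assms by (auto simp: hom_smult subset_iff) blast
    show "?B \<subseteq> ?A"
    proof
      fix w assume "w \<in> ?B"
      then obtain a v where "a \<in> K" "v \<in> carrier M" "w = \<pi> a \<odot>\<^bsub>N\<^esub> h v"
        unfolding surj[symmetric] by auto
      then show "w \<in> ?A"
        using K by (auto intro!: image_eqI[of _ _ "a \<odot>\<^bsub>M\<^esub> v"] simp: hom_smult subset_iff)
    qed
  qed
  then show ?thesis
    unfolding ideal_smult_def using K by (subst image_span) auto
qed

lemma image_finitely_generated:
  assumes "finitely_generated R M" and surj: "h ` carrier M = carrier N"
  shows "finitely_generated S N"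
proof -
  obtain A where A: "finite A" "A \<subseteq> carrier M" "span_submodule R M A = carrier M"
    using assms by (auto simp: finitely_generated_def)
  then show ?thesis
    unfolding finitely_generated_def using image_span[OF A(2)] surj
    by (intro exI[of _ "h ` A"]) auto
qed

end

text \<open>Each module axiom for the record \<open>N\<close> is inherited from \<open>M\<close>,
  because every element and every scalar of the target has a preimage. This yields the module
  structures of \<open>M/H\<close> over \<open>R\<close> and of \<open>M/KM\<close> over
  \<open>R/K\<close>.\<close>

lemma (in module) module_surj_image:
  assumes S: "cring S" and \<pi>: "\<pi> \<in> ring_hom R S" "\<pi> ` carrier R = carrier S"
    and surj: "h ` carrier M = carrier N"
    and add: "\<And>u v. \<lbrakk>u \<in> carrier M; v \<in> carrier M\<rbrakk> \<Longrightarrow> h (u \<oplus>\<^bsub>M\<^esub> v) = h u \<oplus>\<^bsub>N\<^esub> h v"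
    and smult: "\<And>a v. \<lbrakk>a \<in> carrier R; v \<in> carrier M\<rbrakk> \<Longrightarrow> h (a \<odot>\<^bsub>M\<^esub> v) = \<pi> a \<odot>\<^bsub>N\<^esub> h v"
    and zero: "h \<zero>\<^bsub>M\<^esub> = \<zero>\<^bsub>N\<^esub>"
  shows "surj_semilinear_map R S M N \<pi> h"
proof -
  have cl: "h v \<in> carrier N" if "v \<in> carrier M" for v
    unfolding surj[symmetric] using that by (rule imageI)
  have ag: "abelian_group N"
  proof (rule abelian_groupI)
    show "\<zero>\<^bsub>N\<^esub> \<in> carrier N" using zero cl M.zero_closed by metis
  next
    fix x y z assume "x \<in> carrier N" "y \<in> carrier N" "z \<in> carrier N"
    then obtain u v w where u: "u \<in> carrier M" "v \<in> carrier M" "w \<in> carrier M"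
      and e: "x = h u" "y = h v" "z = h w"
      unfolding surj[symmetric] by blast
    then show "(x \<oplus>\<^bsub>N\<^esub> y) \<oplus>\<^bsub>N\<^esub> z = x \<oplus>\<^bsub>N\<^esub> (y \<oplus>\<^bsub>N\<^esub> z)"
      by (simp add: add[symmetric] M.a_assoc)
  next
    fix x y assume "x \<in> carrier N" "y \<in> carrier N"
    then obtain u v where u: "u \<in> carrier M" "v \<in> carrier M"
      and e: "x = h u" "y = h v"
      unfolding surj[symmetric] by blast
    then show "x \<oplus>\<^bsub>N\<^esub> y = y \<oplus>\<^bsub>N\<^esub> x" "x \<oplus>\<^bsub>N\<^esub> y \<in> carrier N"
      by (simp_all add: add[symmetric] M.a_comm cl)
  next
    fix x assume "x \<in> carrier N"
    then obtain u where u: "u \<in> carrier M" and e: "x = h u" unfolding surj[symmetric] by blast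
    then show "\<zero>\<^bsub>N\<^esub> \<oplus>\<^bsub>N\<^esub> x = x"
      by (simp add: add[symmetric] zero[symmetric])
    have "h (\<ominus>\<^bsub>M\<^esub> u) \<oplus>\<^bsub>N\<^esub> x = \<zero>\<^bsub>N\<^esub>" using u e by (simp add: add[symmetric] M.l_neg zero)
    then show "\<exists>y\<in>carrier N. y \<oplus>\<^bsub>N\<^esub> x = \<zero>\<^bsub>N\<^esub>" using u cl by (metis M.a_inv_closed)
  qed
  have md: "module S N"
  proof (rule moduleI[OF S ag])
    fix a x assume "a \<in> carrier S" "x \<in> carrier N"
    then obtain r u where "r \<in> carrier R" "u \<in> carrier M" "a = \<pi> r" "x = h u"
      unfolding surj[symmetric] \<pi>(2)[symmetric] by blast
    then show "a \<odot>\<^bsub>N\<^esub> x \<in> carrier N" by (simp add: smult[symmetric] cl)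
  next
    fix a b x assume "a \<in> carrier S" "b \<in> carrier S" "x \<in> carrier N"
    then obtain r s u where e: "r \<in> carrier R" "s \<in> carrier R" "u \<in> carrier M" "a = \<pi> r" "b = \<pi> s" "x = h u"
      unfolding surj[symmetric] \<pi>(2)[symmetric] by blast
    then have "a \<oplus>\<^bsub>S\<^esub> b = \<pi> (r \<oplus> s)" "a \<otimes>\<^bsub>S\<^esub> b = \<pi> (r \<otimes> s)"
      using ring_hom_add[OF \<pi>(1)] ring_hom_mult[OF \<pi>(1)] by auto
    then show "(a \<oplus>\<^bsub>S\<^esub> b) \<odot>\<^bsub>N\<^esub> x = (a \<odot>\<^bsub>N\<^esub> x) \<oplus>\<^bsub>N\<^esub> (b \<odot>\<^bsub>N\<^esub> x)" "(a \<otimes>\<^bsub>S\<^esub> b) \<odot>\<^bsub>N\<^esub> x = a \<odot>\<^bsub>N\<^esub> (b \<odot>\<^bsub>N\<^esub> x)"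
      using e by (simp_all add: smult[symmetric] add[symmetric] smult_l_distr smult_assoc1)
  next
    fix a x y assume "a \<in> carrier S" "x \<in> carrier N" "y \<in> carrier N"
    then obtain r u v where "r \<in> carrier R" "u \<in> carrier M" "v \<in> carrier M" "a = \<pi> r" "x = h u" "y = h v"
      unfolding surj[symmetric] \<pi>(2)[symmetric] by blast
    then show "a \<odot>\<^bsub>N\<^esub> (x \<oplus>\<^bsub>N\<^esub> y) = (a \<odot>\<^bsub>N\<^esub> x) \<oplus>\<^bsub>N\<^esub> (a \<odot>\<^bsub>N\<^esub> y)"
      by (simp add: smult[symmetric] add[symmetric] smult_r_distr)
  next
    fix x assume "x \<in> carrier N"
    then obtain u where "u \<in> carrier M" "x = h u" unfolding surj[symmetric] by blast
    then show "\<one>\<^bsub>S\<^esub> \<odot>\<^bsub>N\<^esub> x = x" by (simp add: ring_hom_one[OF \<pi>(1), symmetric] smult[symmetric])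
  qed
  show ?thesis
    by (intro surj_semilinear_map.intro semilinear_map.intro semilinear_map_axioms.intro
      surj_semilinear_map_axioms.intro module_axioms md \<pi>) (use cl add smult in auto)
qed

lemma id_ring_hom: "id \<in> ring_hom R R"
  by (auto simp: ring_hom_def)

lemma linear_mapI:
  assumes "module R M" "module R N"
    and "\<And>v. v \<in> carrier M \<Longrightarrow> h v \<in> carrier N"
    and "\<And>u v. u \<in> carrier M \<Longrightarrow> v \<in> carrier M \<Longrightarrow> h (u \<oplus>\<^bsub>M\<^esub> v) = h u \<oplus>\<^bsub>N\<^esub> h v"
    and "\<And>a v. a \<in> carrier R \<Longrightarrow> v \<in> carrier M \<Longrightarrow> h (a \<odot>\<^bsub>M\<^esub> v) = a \<odot>\<^bsub>N\<^esub> h v"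
  shows "surj_semilinear_map R R M N id h"
  by (intro surj_semilinear_map.intro semilinear_map.intro semilinear_map_axioms.intro
      surj_semilinear_map_axioms.intro id_ring_hom assms(1,2)) (use assms(3-5) in \<open>simp_all\<close>)

lemma (in module) smult_map:
  assumes "a \<in> carrier R"
  shows "surj_semilinear_map R R M M id (\<lambda>v. a \<odot>\<^bsub>M\<^esub> v)"
  by (rule linear_mapI) (use assms in \<open>simp_all add: module_axioms smult_r_distr smult_commute\<close>)

lemma (in module) submodule_colon:
  assumes "submodule H R M" "a \<in> carrier R"
  shows "submodule {v \<in> carrier M. a \<odot>\<^bsub>M\<^esub> v \<in> H} R M"
  by (rule semilinear_map.vimage_submodule[OF surj_semilinear_map.axioms(1)[OF smult_map] assms(1)]) fact

lemma regular_module_module: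
  assumes "cring R"
  shows "module R (regular_module R)"
proof -
  interpret cring R by fact
  have "abelian_group (regular_module R)"
  proof (rule abelian_groupI)
    fix x assume "x \<in> carrier (regular_module R)"
    then show "\<exists>y\<in>carrier (regular_module R). y \<oplus>\<^bsub>regular_module R\<^esub> x = \<zero>\<^bsub>regular_module R\<^esub>"
      using l_neg a_inv_closed by (auto simp: regular_module_def)
  qed (auto simp: regular_module_def a_ac)
  then show ?thesis
    by (rule moduleI[OF assms]) (auto simp: regular_module_def l_distr r_distr m_assoc)
qed

lemma (in module) submodule_cyclic:
  assumes e: "e \<in> carrier M"
  shows "submodule {r \<odot>\<^bsub>M\<^esub> e | r. r \<in> carrier R} R M" and "e \<in> {r \<odot>\<^bsub>M\<^esub> e | r. r \<in> carrier R}"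
proof -
  interpret R1: module R "regular_module R" by (rule regular_module_module[OF R.cring_axioms])
  interpret re: surj_semilinear_map R R "regular_module R" M id "\<lambda>r. r \<odot>\<^bsub>M\<^esub> e"
    by (rule linear_mapI[OF R1.module_axioms module_axioms])
      (use e in \<open>simp_all add: regular_module_def smult_l_distr smult_assoc1\<close>)
  have "(\<lambda>r. r \<odot>\<^bsub>M\<^esub> e) ` carrier (regular_module R) = {r \<odot>\<^bsub>M\<^esub> e | r. r \<in> carrier R}"
    by (auto simp: regular_module_def)
  then show "submodule {r \<odot>\<^bsub>M\<^esub> e | r. r \<in> carrier R} R M"
    using re.image_submodule[OF R1.carrier_is_submodule] by simp
  show "e \<in> {r \<odot>\<^bsub>M\<^esub> e | r. r \<in> carrier R}"
    unfolding mem_Collect_eq using e by (intro exI[of _ "\<one>"]) simp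
qed

lemma module_hom_semilinear:
  assumes "module R M" "module R N" "f \<in> module_hom R M N"
  shows "surj_semilinear_map R R M N id f"
  by (rule linear_mapI[OF assms(1,2)]) (use assms(3) in \<open>simp_all add: module_hom_def Pi_iff PiE_def\<close>)

lemma semilinear_module_hom:
  assumes "semilinear_map R R M N id f"
  shows "restrict f (carrier M) \<in> module_hom R M N"
proof -
  interpret semilinear_map R R M N id f by fact
  show ?thesis
    by (auto simp: module_hom_def hom_add hom_smult)
qed

section \<open>Quotient modules\<close>

lemma (in module) submodule_abelian_subgroup:
  assumes H: "submodule H R M"
  shows "abelian_subgroup H M"
  by (rule abelian_subgroupI3[OF additive_subgroup.intro[OF submodule.axioms(1)[OF H]]
        M.abelian_group_axioms])

lemma (in module) coset_eq_iff:
  assumes H: "submodule H R M" and "u \<in> carrier M" "v \<in> carrier M"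
  shows "H +>\<^bsub>M\<^esub> u = H +>\<^bsub>M\<^esub> v \<longleftrightarrow> u \<ominus>\<^bsub>M\<^esub> v \<in> H"
proof -
  interpret H: abelian_subgroup H M by (rule submodule_abelian_subgroup[OF H])
  show ?thesis
  proof
    assume "H +>\<^bsub>M\<^esub> u = H +>\<^bsub>M\<^esub> v"
    then have "u \<in> H +>\<^bsub>M\<^esub> v" using H.a_rcos_self[OF assms(2)] by simp
    then show "u \<ominus>\<^bsub>M\<^esub> v \<in> H" using H.a_rcos_module_imp assms(2,3) by (simp add: M.minus_eq)
  next
    assume "u \<ominus>\<^bsub>M\<^esub> v \<in> H"
    then have "u \<in> H +>\<^bsub>M\<^esub> v" using H.a_rcos_module_rev assms(2,3) by (simp add: M.minus_eq)
    then show "H +>\<^bsub>M\<^esub> u = H +>\<^bsub>M\<^esub> v"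
      using H.a_repr_independence'[of u v] assms(3) by simp
  qed
qed

lemma mem_coset: "x \<in> H +>\<^bsub>M\<^esub> v \<longleftrightarrow> (\<exists>k\<in>H. x = k \<oplus>\<^bsub>M\<^esub> v)"
  by (auto simp: a_r_coset_def')

lemma (in module) quot_module_map:
  assumes H: "submodule H R M"
  shows "surj_semilinear_map R R M (quot_module M H) id (\<lambda>v. H +>\<^bsub>M\<^esub> v)"
proof (rule module_surj_image)
  interpret H: abelian_subgroup H M by (rule submodule_abelian_subgroup[OF H])
  show "cring R" by (rule R.cring_axioms)
  show "id \<in> ring_hom R R" by (rule id_ring_hom)
  show "(\<lambda>v. H +>\<^bsub>M\<^esub> v) ` carrier M = carrier (quot_module M H)"
    by (auto simp: quot_module_def A_RCOSETS_def')
  show "H +>\<^bsub>M\<^esub> \<zero>\<^bsub>M\<^esub> = \<zero>\<^bsub>quot_module M H\<^esub>"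
    using submoduleE(1)[OF H] by (simp add: quot_module_def)
  fix v assume v: "v \<in> carrier M"
  { fix u assume "u \<in> carrier M"
    then show "H +>\<^bsub>M\<^esub> (u \<oplus>\<^bsub>M\<^esub> v) = (H +>\<^bsub>M\<^esub> u) \<oplus>\<^bsub>quot_module M H\<^esub> (H +>\<^bsub>M\<^esub> v)"
      using v by (simp add: quot_module_def H.a_rcos_sum) }
  fix a assume a: "a \<in> carrier R"
  \<comment> \<open>The scalar action on cosets is a union over representatives; it is a single
    coset because all representatives \<open>w\<close> yield the same one.\<close>
  have "H +>\<^bsub>M\<^esub> (a \<odot>\<^bsub>M\<^esub> w) = H +>\<^bsub>M\<^esub> (a \<odot>\<^bsub>M\<^esub> v)" if w: "w \<in> H +>\<^bsub>M\<^esub> v" for w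
  proof -
    obtain k where k: "k \<in> H" "w = k \<oplus>\<^bsub>M\<^esub> v" using w by (auto simp: mem_coset)
    have "k \<in> carrier M" using submoduleE(1)[OF H] k by blast
    then have "(a \<odot>\<^bsub>M\<^esub> w) \<ominus>\<^bsub>M\<^esub> (a \<odot>\<^bsub>M\<^esub> v) = a \<odot>\<^bsub>M\<^esub> k"
      using k a v by (simp add: smult_r_distr add_minus_cancel)
    then show ?thesis
      using k \<open>k \<in> carrier M\<close> a v submoduleE(4)[OF H a k(1)] by (subst coset_eq_iff[OF H]) auto
  qed
  moreover have "v \<in> H +>\<^bsub>M\<^esub> v" using v by (rule H.a_rcos_self)
  ultimately have "(\<Union>w\<in>H +>\<^bsub>M\<^esub> v. H +>\<^bsub>M\<^esub> (a \<odot>\<^bsub>M\<^esub> w)) = H +>\<^bsub>M\<^esub> (a \<odot>\<^bsub>M\<^esub> v)" by blast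
  then show "H +>\<^bsub>M\<^esub> (a \<odot>\<^bsub>M\<^esub> v) = id a \<odot>\<^bsub>quot_module M H\<^esub> (H +>\<^bsub>M\<^esub> v)"
    by (simp add: quot_module_def)
qed simp

lemma (in module) quot_module_kernel:
  assumes H: "submodule H R M" and v: "v \<in> carrier M"
  shows "H +>\<^bsub>M\<^esub> v = \<zero>\<^bsub>quot_module M H\<^esub> \<longleftrightarrow> v \<in> H"
proof -
  have "H +>\<^bsub>M\<^esub> v = H +>\<^bsub>M\<^esub> \<zero>\<^bsub>M\<^esub> \<longleftrightarrow> v \<ominus>\<^bsub>M\<^esub> \<zero>\<^bsub>M\<^esub> \<in> H"
    by (rule coset_eq_iff[OF H v]) simp
  then show ?thesis
    using submoduleE(1)[OF H] v add_minus_cancel[of v "\<zero>\<^bsub>M\<^esub>"] by (simp add: quot_module_def)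
qed

lemma carrier_quot_module: "carrier (quot_module M H) = (\<lambda>v. H +>\<^bsub>M\<^esub> v) ` carrier M"
  by (auto simp: quot_module_def A_RCOSETS_def')

lemma (in module) reduction_map:
  assumes K: "ideal K R"
  shows "surj_semilinear_map R (R Quot K) M (reduction R K M)
    (\<lambda>a. K +> a) (\<lambda>v. ideal_smult R K M +>\<^bsub>M\<^esub> v)"
proof (rule module_surj_image)
  define H where "H = ideal_smult R K M"
  interpret K: ideal K R by (rule K)
  have KR: "K \<subseteq> carrier R" using K.a_subset .
  then have H: "submodule H R M" unfolding H_def by (rule ideal_smult_submodule)
  interpret H: abelian_subgroup H M by (rule submodule_abelian_subgroup[OF H])
  show "cring (R Quot K)" by (rule K.quotient_is_cring[OF R.cring_axioms])
  show "(\<lambda>a. K +> a) \<in> ring_hom R (R Quot K)" by (rule K.rcos_ring_hom)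
  show "(\<lambda>a. K +> a) ` carrier R = carrier (R Quot K)"
    by (auto simp: FactRing_def A_RCOSETS_def')
  show "(\<lambda>v. ideal_smult R K M +>\<^bsub>M\<^esub> v) ` carrier M = carrier (reduction R K M)"
    by (auto simp: reduction_def A_RCOSETS_def')
  show "ideal_smult R K M +>\<^bsub>M\<^esub> \<zero>\<^bsub>M\<^esub> = \<zero>\<^bsub>reduction R K M\<^esub>"
    using submoduleE(1)[OF H] by (simp add: reduction_def H_def)
  fix v assume v: "v \<in> carrier M"
  { fix u assume "u \<in> carrier M"
    then show "ideal_smult R K M +>\<^bsub>M\<^esub> (u \<oplus>\<^bsub>M\<^esub> v)
        = (ideal_smult R K M +>\<^bsub>M\<^esub> u) \<oplus>\<^bsub>reduction R K M\<^esub> (ideal_smult R K M +>\<^bsub>M\<^esub> v)"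
      using v H.a_rcos_sum[of u v] by (simp add: reduction_def H_def) }
  fix a assume a: "a \<in> carrier R"
  \<comment> \<open>Scalar and vector both range over cosets. With \<open>b = c \<oplus> a\<close>
    and \<open>w = k \<oplus> v\<close>, the difference of \<open>b w\<close> and \<open>a v\<close>
    is \<open>c w\<close> plus \<open>a k\<close>; the first is in \<open>KM\<close> because
    \<open>c \<in> K\<close>, the second because \<open>k \<in> KM\<close>.\<close>
  have "H +>\<^bsub>M\<^esub> (b \<odot>\<^bsub>M\<^esub> w) = H +>\<^bsub>M\<^esub> (a \<odot>\<^bsub>M\<^esub> v)" if b: "b \<in> K +> a" and w: "w \<in> H +>\<^bsub>M\<^esub> v" for b w
  proof -
    obtain k where k: "k \<in> H" "w = k \<oplus>\<^bsub>M\<^esub> v" using w by (auto simp: mem_coset)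
    obtain c where c: "c \<in> K" "b = c \<oplus> a" using b by (auto simp: mem_coset)
    have cl: "k \<in> carrier M" "c \<in> carrier R" using submoduleE(1)[OF H] k KR c by blast+
    then have wb: "w \<in> carrier M" "b \<in> carrier R" using a v c k by auto
    have "b \<odot>\<^bsub>M\<^esub> w = (c \<odot>\<^bsub>M\<^esub> w \<oplus>\<^bsub>M\<^esub> a \<odot>\<^bsub>M\<^esub> k) \<oplus>\<^bsub>M\<^esub> a \<odot>\<^bsub>M\<^esub> v"
      unfolding c(2) using a v cl wb
      by (simp add: smult_l_distr k(2) smult_r_distr M.a_ac)
    then have "(b \<odot>\<^bsub>M\<^esub> w) \<ominus>\<^bsub>M\<^esub> (a \<odot>\<^bsub>M\<^esub> v) = c \<odot>\<^bsub>M\<^esub> w \<oplus>\<^bsub>M\<^esub> a \<odot>\<^bsub>M\<^esub> k"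
      using a v cl wb by (simp add: add_minus_cancel)
    moreover have "c \<odot>\<^bsub>M\<^esub> w \<in> H" unfolding H_def using c wb by (intro ideal_smult_incl) auto
    ultimately have "(b \<odot>\<^bsub>M\<^esub> w) \<ominus>\<^bsub>M\<^esub> (a \<odot>\<^bsub>M\<^esub> v) \<in> H"
      using submoduleE(4)[OF H a k(1)] submoduleE(5)[OF H] by simp
    then show ?thesis
      using wb a v by (subst coset_eq_iff[OF H]) auto
  qed
  moreover have "v \<in> H +>\<^bsub>M\<^esub> v" "a \<in> K +> a" using v a by (auto intro: H.a_rcos_self K.a_rcos_self)
  ultimately have "(\<Union>b\<in>K +> a. \<Union>w\<in>H +>\<^bsub>M\<^esub> v. H +>\<^bsub>M\<^esub> (b \<odot>\<^bsub>M\<^esub> w)) = H +>\<^bsub>M\<^esub> (a \<odot>\<^bsub>M\<^esub> v)"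
    by blast
  then show "ideal_smult R K M +>\<^bsub>M\<^esub> (a \<odot>\<^bsub>M\<^esub> v)
      = (K +> a) \<odot>\<^bsub>reduction R K M\<^esub> (ideal_smult R K M +>\<^bsub>M\<^esub> v)"
    by (simp add: reduction_def H_def)
qed

lemma carrier_reduction: "carrier (reduction R K M) = (\<lambda>v. ideal_smult R K M +>\<^bsub>M\<^esub> v) ` carrier M"
  by (auto simp: reduction_def A_RCOSETS_def')

lemma (in module) reduction_kernel:
  assumes K: "K \<subseteq> carrier R" and v: "v \<in> carrier M"
  shows "ideal_smult R K M +>\<^bsub>M\<^esub> v = \<zero>\<^bsub>reduction R K M\<^esub> \<longleftrightarrow> v \<in> ideal_smult R K M"
proof -
  have "\<zero>\<^bsub>reduction R K M\<^esub> = \<zero>\<^bsub>quot_module M (ideal_smult R K M)\<^esub>"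
    by (simp add: quot_module_def reduction_def)
  then show ?thesis using quot_module_kernel[OF ideal_smult_submodule[OF K] v] by simp
qed

section \<open>Noetherian modules\<close>

text \<open>The maximal condition on submodules inside \<open>P\<close>, stated within the fixed
  module \<open>M\<close> so that an induction on generators of \<open>P\<close> never changes the
  module.\<close>

definition noetherian_below ::
    "('a, 'r) ring_scheme \<Rightarrow> ('a, 'b, 'm) module_scheme \<Rightarrow> 'b set \<Rightarrow> bool"
  where "noetherian_below R M P \<longleftrightarrow> (\<forall>F. F \<noteq> {} \<and> (\<forall>H\<in>F. submodule H R M \<and> H \<subseteq> P) \<longrightarrow>
    (\<exists>H\<in>F. \<forall>Q\<in>F. H \<subseteq> Q \<longrightarrow> Q = H))"

text \<open>Zorn's lemma applies because in a Noetherian ring a nonempty chain of ideals contains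
  its union.\<close>

lemma noetherian_ring_maximal:
  assumes "noetherian_ring R" "F \<noteq> {}" "\<And>I. I \<in> F \<Longrightarrow> ideal I R"
  shows "\<exists>I\<in>F. \<forall>J\<in>F. I \<subseteq> J \<longrightarrow> J = I"
proof (rule subset_Zorn_nonempty[OF assms(2)])
  interpret noetherian_ring R by (rule assms(1))
  fix C assume C: "C \<noteq> {}" "subset.chain F C"
  then have "subset.chain {I. ideal I R} C"
    using assms(3) unfolding subset_chain_def by blast
  then have "\<Union>C \<in> C" by (rule ideal_chain_is_trivial[OF C(1)])
  then show "\<Union>C \<in> F" using C unfolding subset_chain_def by blast
qed

text \<open>Modulo the old span \<open>P\<close> the new span is cyclic, so a submodule is
  controlled by its trace on \<open>P\<close> and by the ideal \<open>\<beta>\<close> of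
  coefficients that \<open>a\<close> may take modulo \<open>P\<close>. The trace is made maximal,
  and then the ideal among the members with that trace; a larger member with the same trace and
  ideal must coincide.\<close>

lemma (in module) noetherian_below_insert:
  assumes noeth: "noetherian_ring R" and A: "A \<subseteq> carrier M" "a \<in> carrier M"
    and IH: "noetherian_below R M (span_submodule R M A)"
  shows "noetherian_below R M (span_submodule R M (insert a A))"
  unfolding noetherian_below_def
proof (intro allI impI, elim conjE)
  fix F assume F: "F \<noteq> {}" "\<forall>H\<in>F. submodule H R M \<and> H \<subseteq> span_submodule R M (insert a A)"
  define P where "P = span_submodule R M A"
  have P: "submodule P R M" unfolding P_def by (rule span_submodule[OF A(1)])
  define \<beta> where "\<beta> H = {r \<in> carrier R. \<forall>v\<in>{a}. r \<odot>\<^bsub>M\<^esub> v \<in> submodule_add M H P}" for H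
  have sub: "submodule H R M" "H \<subseteq> span_submodule R M (insert a A)" if "H \<in> F" for H
    using F that by auto
  have "submodule (H \<inter> P) R M \<and> H \<inter> P \<subseteq> P" if "H \<in> F" for H
    using submodule_Int[OF sub(1)[OF that] P] by blast
  then have "\<exists>K\<in>(\<lambda>H. H \<inter> P) ` F. \<forall>Q\<in>(\<lambda>H. H \<inter> P) ` F. K \<subseteq> Q \<longrightarrow> Q = K"
    using F(1) by (intro IH[folded P_def, unfolded noetherian_below_def, rule_format]) blast
  then obtain K' where K': "K' \<in> (\<lambda>H. H \<inter> P) ` F" "\<forall>Q\<in>(\<lambda>H. H \<inter> P) ` F. K' \<subseteq> Q \<longrightarrow> Q = K'"
    by (rule bexE)
  then obtain K where KF: "K \<in> F" "K' = K \<inter> P" by (elim imageE)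
  note K = KF(1) K'(2)[unfolded KF(2)]
  define G where "G = {H \<in> F. H \<inter> P = K \<inter> P}"
  have "\<exists>I\<in>\<beta> ` G. \<forall>J\<in>\<beta> ` G. I \<subseteq> J \<longrightarrow> J = I"
  proof (rule noetherian_ring_maximal[OF noeth])
    show "\<beta> ` G \<noteq> {}" using K unfolding G_def by blast
    fix I assume "I \<in> \<beta> ` G"
    then obtain H where H: "H \<in> F" "I = \<beta> H" unfolding G_def by blast
    show "ideal I R" unfolding H(2) \<beta>_def
      by (rule ideal_colon[OF submodule_add(1)[OF sub(1)[OF H(1)] P]]) (use A(2) in simp)
  qed
  then obtain I where I: "I \<in> \<beta> ` G" "\<forall>J\<in>\<beta> ` G. I \<subseteq> J \<longrightarrow> J = I" by (rule bexE)
  then obtain H where HG: "H \<in> G" "I = \<beta> H" by (elim imageE)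
  note H = HG(1) I(2)[unfolded HG(2)]
  have HF: "H \<in> F" "H \<inter> P = K \<inter> P" using H by (auto simp: G_def)
  have "Q = H" if Q: "Q \<in> F" "H \<subseteq> Q" for Q
  proof
    have "K \<inter> P \<subseteq> Q \<inter> P" using Q(2) HF(2) by blast
    then have QP: "Q \<inter> P = H \<inter> P"
      unfolding HF(2) by (rule K(2)[rule_format, OF imageI[OF Q(1)]])
    then have "Q \<in> G" using Q HF by (simp add: G_def)
    moreover have "submodule_add M H P \<subseteq> submodule_add M Q P"
      using Q(2) unfolding submodule_add_def by blast
    then have "\<beta> H \<subseteq> \<beta> Q" unfolding \<beta>_def by blast
    ultimately have \<beta>eq: "\<beta> Q = \<beta> H" by (intro H(2)[rule_format] imageI)
    have C: "submodule {r \<odot>\<^bsub>M\<^esub> a | r. r \<in> carrier R} R M" "a \<in> {r \<odot>\<^bsub>M\<^esub> a | r. r \<in> carrier R}"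
      using submodule_cyclic[OF A(2)] by auto
    have "span_submodule R M (insert a A) \<subseteq> submodule_add M {r \<odot>\<^bsub>M\<^esub> a | r. r \<in> carrier R} P"
      using submodule_add[OF C(1) P] C(2) span_submodule_incl[of A R M]
      by (intro span_submodule_least) (auto simp: P_def)
    then have "Q \<subseteq> submodule_add M {r \<odot>\<^bsub>M\<^esub> a | r. r \<in> carrier R} P"
      using sub(2)[OF Q(1)] by blast
    moreover have "q \<in> H" if q: "q \<in> Q" "r \<in> carrier R" "p \<in> P" "q = r \<odot>\<^bsub>M\<^esub> a \<oplus>\<^bsub>M\<^esub> p" for q r p
    proof -
      have cl: "p \<in> carrier M" "q \<in> carrier M" using submoduleE(1)[OF P] submoduleE(1)[OF sub(1)[OF Q(1)]] q by blast+
      have "r \<odot>\<^bsub>M\<^esub> a = q \<oplus>\<^bsub>M\<^esub> \<ominus>\<^bsub>M\<^esub> p"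
        using q cl A(2) add_minus_cancel[of "r \<odot>\<^bsub>M\<^esub> a" p] by (simp add: M.minus_eq)
      moreover have "\<ominus>\<^bsub>M\<^esub> p \<in> P" by (rule submoduleE(3)[OF P q(3)])
      ultimately have "r \<in> \<beta> Q" using q unfolding \<beta>_def submodule_add_def by blast
      then obtain h p' where hp: "h \<in> H" "p' \<in> P" "r \<odot>\<^bsub>M\<^esub> a = h \<oplus>\<^bsub>M\<^esub> p'"
        unfolding \<beta>eq unfolding \<beta>_def submodule_add_def by blast
      have cl': "h \<in> carrier M" "p' \<in> carrier M" using submoduleE(1)[OF P] submoduleE(1)[OF sub(1)[OF HF(1)]] hp by blast+
      \<comment> \<open>Modulo \<open>P\<close> the elements \<open>q\<close> and \<open>h\<close>
        agree; their difference lies in \<open>Q \<inter> P\<close>, which equals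
        \<open>H \<inter> P\<close>, so \<open>q\<close> is back in \<open>H\<close>.\<close>
      have qe: "q = h \<oplus>\<^bsub>M\<^esub> (p' \<oplus>\<^bsub>M\<^esub> p)" using q hp cl cl' by (simp add: M.a_assoc)
      then have "p' \<oplus>\<^bsub>M\<^esub> p = q \<ominus>\<^bsub>M\<^esub> h"
        using cl cl' add_minus_cancel[of "p' \<oplus>\<^bsub>M\<^esub> p" h] by (simp add: M.a_comm)
      also have "\<dots> \<in> Q" using q hp Q by (intro submodule_minus[OF sub(1)[OF Q(1)]]) auto
      finally have "p' \<oplus>\<^bsub>M\<^esub> p \<in> Q \<inter> P" using submoduleE(5)[OF P hp(2) q(3)] by simp
      then have "p' \<oplus>\<^bsub>M\<^esub> p \<in> H" using QP by blast
      then show ?thesis unfolding qe using hp submoduleE(5)[OF sub(1)[OF HF(1)]] by blast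
    qed
    ultimately show "Q \<subseteq> H" unfolding submodule_add_def by blast
    show "H \<subseteq> Q" by fact
  qed
  then show "\<exists>H\<in>F. \<forall>Q\<in>F. H \<subseteq> Q \<longrightarrow> Q = H" using HF by blast
qed

theorem (in module) finitely_generated_noetherian:
  assumes noeth: "noetherian_ring R" and fg: "finitely_generated R M"
  shows "noetherian_below R M (carrier M)"
proof -
  obtain A where A: "finite A" "A \<subseteq> carrier M" "span_submodule R M A = carrier M"
    using fg unfolding finitely_generated_def by blast
  have "noetherian_below R M (span_submodule R M A)"
    using A(1,2)
  proof (induction A rule: finite_induct)
    case empty
    have "H = {\<zero>\<^bsub>M\<^esub>}" if "submodule H R M" "H \<subseteq> {\<zero>\<^bsub>M\<^esub>}" for H
      using that submoduleE(2) by blast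
    then show ?case unfolding noetherian_below_def span_submodule_empty by (metis equals0I)
  next
    case (insert a A)
    then show ?case by (intro noetherian_below_insert noeth) auto
  qed
  then show ?thesis using A by simp
qed

lemma (in module) noetherian_maximal:
  assumes "noetherian_below R M (carrier M)" "F \<noteq> {}" "\<And>H. H \<in> F \<Longrightarrow> submodule H R M"
  shows "\<exists>H\<in>F. \<forall>Q\<in>F. H \<subseteq> Q \<longrightarrow> Q = H"
  using assms(2,3) submoduleE(1)
  by (intro assms(1)[unfolded noetherian_below_def, rule_format]) blast

text \<open>A submodule maximal among those spanned by finitely many elements of \<open>Z\<close>
  contains each \<open>z \<in> Z\<close>, since adjoining \<open>z\<close> gives another such
  submodule.\<close>

lemma (in module) noetherian_submodule_finitely_generated:
  assumes noeth: "noetherian_below R M (carrier M)" and Z: "submodule Z R M"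
  obtains A where "finite A" "A \<subseteq> Z" "span_submodule R M A = Z"
proof -
  have ZM: "Z \<subseteq> carrier M" using Z by (rule submoduleE(1))
  define F where "F = {span_submodule R M A | A. finite A \<and> A \<subseteq> Z}"
  have "\<exists>H\<in>F. \<forall>Q\<in>F. H \<subseteq> Q \<longrightarrow> Q = H"
  proof (rule noetherian_maximal[OF noeth])
    show "F \<noteq> {}" unfolding F_def by blast
    show "\<And>H. H \<in> F \<Longrightarrow> submodule H R M" unfolding F_def using span_submodule ZM by blast
  qed
  then obtain H where H: "H \<in> F" "\<And>Q. Q \<in> F \<Longrightarrow> H \<subseteq> Q \<Longrightarrow> Q = H" by blast
  obtain A where A: "finite A" "A \<subseteq> Z" "H = span_submodule R M A" using H(1) by (auto simp: F_def)
  have "z \<in> H" if z: "z \<in> Z" for z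
  proof -
    have "span_submodule R M (insert z A) \<in> F" unfolding F_def using A z by blast
    moreover have "H \<subseteq> span_submodule R M (insert z A)" unfolding A(3) by (rule span_submodule_mono) blast
    ultimately show ?thesis using H(2) span_submodule_incl[of "insert z A" R M] by blast
  qed
  then have "H = Z" using span_submodule_least[OF Z A(2)] A(3) by blast
  then show thesis using that A by blast
qed

section \<open>Ideal powers\<close>

context cring
begin

lemma ideal_power_ideal: "ideal I R \<Longrightarrow> ideal (ideal_power R I n) R"
  by (induction n) (auto intro: oneideal ideal_prod_is_ideal)

lemma ideal_power_add:
  assumes "ideal I R"
  shows "ideal_power R I (m + n) = ideal_prod R (ideal_power R I m) (ideal_power R I n)"
proof (induction m)
  case 0
  show ?case
    using ideal_prod_one[OF ideal_power_ideal[OF assms]]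
      ideal_prod_commute[OF oneideal ideal_power_ideal[OF assms]] by simp
next
  case (Suc m)
  then show ?case using ideal_prod_assoc[OF assms] ideal_power_ideal[OF assms] by simp
qed

lemma ideal_power_1: "ideal I R \<Longrightarrow> ideal_power R I (Suc 0) = I"
  by (simp add: ideal_prod_one)

lemma ideal_prod_least:
  assumes "ideal Q R" "\<And>a b. a \<in> I \<Longrightarrow> b \<in> J \<Longrightarrow> a \<otimes> b \<in> Q"
  shows "ideal_prod R I J \<subseteq> Q"
proof
  fix s assume "s \<in> ideal_prod R I J"
  then show "s \<in> Q"
    by induction (use assms additive_subgroup.a_closed[OF ideal.axioms(1)[OF assms(1)]] in auto)
qed

lemma ideal_power_Suc_subset:
  assumes "ideal I R"
  shows "ideal_power R I (Suc n) \<subseteq> ideal_power R I n"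
  using ideal_prod_inter[OF assms ideal_power_ideal[OF assms]] by auto

lemma ideal_power_antimono:
  assumes "ideal I R" "m \<le> n"
  shows "ideal_power R I n \<subseteq> ideal_power R I m"
  using assms(2)
proof (induction rule: dec_induct)
  case (step n)
  then show ?case using ideal_power_Suc_subset[OF assms(1), of n] by blast
qed simp

lemma pow_in_ideal_power:
  assumes "ideal I R" "a \<in> I"
  shows "a [^] n \<in> ideal_power R I n"
proof (induction n)
  case (Suc n)
  have "a \<in> carrier R" using assms by (rule ideal.Icarr)
  then have "a [^] Suc n = a \<otimes> a [^] n" by (metis nat_pow_Suc2)
  then show ?case using assms(2) Suc by (simp add: ideal_prod.prod)
qed simp

lemma pow_radical_ideal_power:
  assumes I: "ideal I R" and a: "a \<in> ideal_radical R I"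
  shows "\<exists>k :: nat. a [^] k \<in> ideal_power R I n"
proof -
  obtain j :: nat where j: "a \<in> carrier R" "a [^] j \<in> I" using a by (auto simp: ideal_radical_def)
  have "a [^] (j * n) = (a [^] j) [^] n" using j(1) by (simp add: nat_pow_pow)
  then show ?thesis using pow_in_ideal_power[OF I j(2)] by metis
qed

text \<open>Noetherian induction: if \<open>Q\<close> is a maximal counterexample and \<open>a [^] k\<close> is the last power
  outside \<open>Q\<close> of some \<open>a \<in> I - Q\<close>, then both \<open>Q + (a [^] k)\<close> and \<open>Q : a [^] k\<close> are bigger than \<open>Q\<close>.\<close>

lemma ideal_power_subset_if_radical:
  assumes noeth: "noetherian_ring R" and I: "ideal I R" and Q: "ideal Q R" and IQ: "I \<subseteq> ideal_radical R Q"
  shows "\<exists>n. ideal_power R I n \<subseteq> Q"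
proof (rule ccontr)
  define F where "F = {Q. ideal Q R \<and> I \<subseteq> ideal_radical R Q \<and> (\<forall>n. \<not> ideal_power R I n \<subseteq> Q)}"
  assume "\<not> ?thesis"
  then have "F \<noteq> {}" unfolding F_def using Q IQ by blast
  then have "\<exists>P\<in>F. \<forall>Q\<in>F. P \<subseteq> Q \<longrightarrow> Q = P"
    by (intro noetherian_ring_maximal[OF noeth]) (auto simp: F_def)
  then obtain P where P: "P \<in> F" "\<And>Q. Q \<in> F \<Longrightarrow> P \<subseteq> Q \<Longrightarrow> Q = P" by blast
  have PI: "ideal P R" "I \<subseteq> ideal_radical R P" "\<And>n. \<not> ideal_power R I n \<subseteq> P" using P(1) by (auto simp: F_def)
  interpret P: ideal P R by (rule PI)
  have "\<not> I \<subseteq> P" using PI(3)[of "Suc 0"] ideal_power_1[OF I] by simp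
  then obtain a where a: "a \<in> I" "a \<notin> P" by blast
  have aR: "a \<in> carrier R" using I a(1) by (rule ideal.Icarr)
  define k where "k = (LEAST k :: nat. a [^] k \<in> P)"
  have "\<exists>k :: nat. a [^] k \<in> P" using PI(2) a(1) by (auto simp: ideal_radical_def)
  then have k: "a [^] k \<in> P" unfolding k_def by (rule LeastI_ex)
  have "k \<noteq> 0"
  proof
    assume "k = 0"
    then have "\<one> \<in> P" using k by simp
    then show False using P.one_imp_carrier a aR by blast
  qed
  then obtain j where j: "k = Suc j" by (cases k) auto
  define b where "b = a [^] j"
  have bR: "b \<in> carrier R" using aR by (simp add: b_def)
  have "b \<notin> P" using not_less_Least[of j "\<lambda>k. a [^] k \<in> P"] j by (auto simp: b_def k_def)
  have ab: "a \<otimes> b \<in> P" using k aR m_comm[of a b] bR by (simp add: j b_def)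
  have rad: "I \<subseteq> ideal_radical R Q" if "P \<subseteq> Q" for Q using PI(2) that unfolding ideal_radical_def by blast
  have step: "\<exists>n. ideal_power R I n \<subseteq> Q" if "ideal Q R" "P \<subseteq> Q" "Q \<noteq> P" for Q
    using P(2)[of Q] that rad[OF that(2)] unfolding F_def by blast
  define U where "U = P <+>\<^bsub>R\<^esub> PIdl b"
  have U: "ideal U R" unfolding U_def by (rule add_ideals[OF PI(1) cgenideal_ideal[OF bR]])
  have "P \<subseteq> U"
  proof
    fix p assume "p \<in> P"
    moreover have "\<zero> \<in> PIdl b" using cgenideal_ideal[OF bR] by (simp add: additive_subgroup.zero_closed ideal.axioms(1))
    ultimately have "p \<oplus> \<zero> \<in> U" unfolding U_def set_add_def' by blast
    then show "p \<in> U" using P.Icarr[OF \<open>p \<in> P\<close>] by simp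
  qed
  moreover have "b \<in> U"
  proof -
    have "\<zero> \<oplus> b \<in> U"
      unfolding U_def set_add_def' using cgenideal_self[OF bR] P.zero_closed by blast
    then show ?thesis using bR by simp
  qed
  ultimately obtain m where m: "ideal_power R I m \<subseteq> U" using step[OF U] \<open>b \<notin> P\<close> by blast
  define V where "V = {r \<in> carrier R. r \<otimes> b \<in> P}"
  have V: "ideal V R"
  proof (rule idealI)
    show "subgroup V (add_monoid R)"
    proof (rule add.subgroupI)
      show "V \<subseteq> carrier R" unfolding V_def by blast
      have "\<zero> \<in> V" using bR by (simp add: V_def)
      then show "V \<noteq> {}" by blast
    qed (use bR in \<open>simp_all add: V_def l_distr l_minus P.a_inv_closed\<close>)
    show "\<And>a x. a \<in> V \<Longrightarrow> x \<in> carrier R \<Longrightarrow> x \<otimes> a \<in> V"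
      using bR by (auto simp: V_def m_assoc P.I_l_closed)
    then show "\<And>a x. a \<in> V \<Longrightarrow> x \<in> carrier R \<Longrightarrow> a \<otimes> x \<in> V"
      by (metis (no_types, lifting) V_def m_comm mem_Collect_eq)
  qed (rule ring_axioms)
  have "P \<subseteq> V" using bR P.I_r_closed P.Icarr by (auto simp: V_def)
  moreover have "a \<in> V" using aR ab by (simp add: V_def)
  ultimately obtain n where n: "ideal_power R I n \<subseteq> V" using step[OF V] a by blast
  have "ideal_power R I (n + m) \<subseteq> P"
    unfolding ideal_power_add[OF I]
  proof (rule ideal_prod_least[OF PI(1)])
    fix v u assume "v \<in> ideal_power R I n" "u \<in> ideal_power R I m"
    then have "v \<in> V" "u \<in> U" using m n by auto
    then obtain p r where pr: "p \<in> P" "r \<in> carrier R" "u = p \<oplus> r \<otimes> b"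
      by (auto simp: U_def set_add_def' cgenideal_def)
    \<comment> \<open>With \<open>u = p + r b\<close>, the part \<open>v p\<close> lies in
      \<open>P\<close> as \<open>p\<close> does, and \<open>r (v b)\<close> because \<open>v\<close>
      is in the colon ideal \<open>V\<close>; hence \<open>I^n I^m\<close> falls into
      \<open>P\<close>.\<close>
    have "v \<otimes> u = v \<otimes> p \<oplus> r \<otimes> (v \<otimes> b)"
      using \<open>v \<in> V\<close> pr P.Icarr[OF pr(1)] bR by (simp add: V_def r_distr m_lcomm)
    then show "v \<otimes> u \<in> P"
      using \<open>v \<in> V\<close> pr P.I_l_closed by (simp add: V_def)
  qed
  then show False using PI(3) by blast
qed

end

text \<open>Trades exponents that depend on \<open>a \<in> I\<close> for one exponent
  \<open>n\<close>: the annihilator of \<open>M/Q\<close> has \<open>I\<close> in its radical and so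
  contains a power of \<open>I\<close>.\<close>

lemma (in module) ideal_smult_subset_if_powers:
  assumes noeth: "noetherian_ring R" and I: "ideal I R" and Q: "submodule Q R M"
    and pow: "\<And>a. a \<in> I \<Longrightarrow> \<exists>k :: nat. \<forall>v\<in>carrier M. a [^]\<^bsub>R\<^esub> k \<odot>\<^bsub>M\<^esub> v \<in> Q"
  shows "\<exists>n. ideal_smult R (ideal_power R I n) M \<subseteq> Q"
proof -
  define L where "L = {r \<in> carrier R. \<forall>v\<in>carrier M. r \<odot>\<^bsub>M\<^esub> v \<in> Q}"
  have "ideal L R" unfolding L_def by (rule ideal_colon[OF Q]) simp
  moreover have "I \<subseteq> ideal_radical R L"
    using pow ideal.Icarr[OF I] unfolding ideal_radical_def L_def by blast
  ultimately obtain n where n: "ideal_power R I n \<subseteq> L"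
    using R.ideal_power_subset_if_radical[OF noeth I] by blast
  have "ideal_smult R (ideal_power R I n) M \<subseteq> Q"
    by (rule ideal_smult_least[OF Q]) (use n L_def in auto)
  then show ?thesis by blast
qed

section \<open>Superficial elements\<close>

lemma local_ring_proper_ideal:
  assumes loc: "noetherian_local_ring R \<mm>" and Q: "ideal Q R" and one: "\<one>\<^bsub>R\<^esub> \<notin> Q"
  shows "Q \<subseteq> \<mm>"
proof -
  have noeth: "noetherian_ring R" and max: "{P. maximalideal P R} = {\<mm>}"
    using loc by (auto simp: noetherian_local_ring_def)
  interpret cring R using loc by (simp add: noetherian_local_ring_def)
  define F where "F = {J. ideal J R \<and> Q \<subseteq> J \<and> \<one>\<^bsub>R\<^esub> \<notin> J}"
  have "\<exists>I\<in>F. \<forall>J\<in>F. I \<subseteq> J \<longrightarrow> J = I"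
    using Q one by (intro noetherian_ring_maximal[OF noeth]) (auto simp: F_def)
  then obtain P where P: "P \<in> F" "\<forall>J\<in>F. P \<subseteq> J \<longrightarrow> J = P" by (rule bexE)
  have "maximalideal P R"
  proof (rule maximalidealI)
    show "ideal P R" using P(1) by (simp add: F_def)
    show "carrier R \<noteq> P" using P(1) one_closed unfolding F_def by blast
    fix J assume J: "ideal J R" "P \<subseteq> J" "J \<subseteq> carrier R"
    show "J = P \<or> J = carrier R"
    proof (cases "\<one>\<^bsub>R\<^esub> \<in> J")
      case True
      then show ?thesis using ideal.one_imp_carrier[OF J(1)] by blast
    next
      case False
      then have "J \<in> F" using J P(1) unfolding F_def by blast
      then show ?thesis using P(2) J(2) by blast
    qed
  qed
  then have "P = \<mm>" using max by blast
  then show ?thesis using P(1) by (simp add: F_def)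
qed

lemma local_ring_one_notin:
  assumes "noetherian_local_ring R \<mm>"
  shows "ideal \<mm> R" and "\<one>\<^bsub>R\<^esub> \<notin> \<mm>"
proof -
  have "maximalideal \<mm> R" using assms unfolding noetherian_local_ring_def by blast
  then interpret maximalideal \<mm> R .
  show "ideal \<mm> R" by (rule ideal_axioms)
  show "\<one>\<^bsub>R\<^esub> \<notin> \<mm>" using one_imp_carrier I_notcarr by blast
qed

text \<open>The hypothesis \<open>step\<close> is the equation \<open>K = IK\<close> in the form in
  which an intersection argument delivers it. If a maximal proper submodule \<open>P\<close> of
  \<open>K\<close> missed some \<open>a k\<close>, then \<open>K = P + R a k\<close> and
  \<open>(1 - r a) k \<in> P\<close> for some \<open>r\<close>, so \<open>1 - r a\<close> would lie
  in the maximal ideal along with \<open>r a\<close>.\<close>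

lemma (in module) nakayama:
  assumes loc: "noetherian_local_ring R \<mm>" and noeth: "noetherian_below R M (carrier M)"
    and I: "I \<subseteq> \<mm>" and K: "submodule K R M"
    and step: "\<And>P. \<lbrakk>submodule P R M; P \<subseteq> K; \<forall>a\<in>I. \<forall>k\<in>K. a \<odot>\<^bsub>M\<^esub> k \<in> P\<rbrakk> \<Longrightarrow> K \<subseteq> P"
  shows "K = {\<zero>\<^bsub>M\<^esub>}"
proof (rule ccontr)
  assume "K \<noteq> {\<zero>\<^bsub>M\<^esub>}"
  have KM: "K \<subseteq> carrier M" using submoduleE(1)[OF K] .
  interpret \<mm>: ideal \<mm> R by (rule local_ring_one_notin[OF loc])
  define F where "F = {P. submodule P R M \<and> P \<subset> K}"
  have "{\<zero>\<^bsub>M\<^esub>} \<in> F"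
    using K \<open>K \<noteq> {\<zero>\<^bsub>M\<^esub>}\<close> by (auto simp: F_def submodule_iff)
  then have "\<exists>P\<in>F. \<forall>Q\<in>F. P \<subseteq> Q \<longrightarrow> Q = P"
    by (intro noetherian_maximal[OF noeth]) (auto simp: F_def)
  then obtain P where PF: "P \<in> F" "\<forall>Q\<in>F. P \<subseteq> Q \<longrightarrow> Q = P" by (rule bexE)
  have P: "submodule P R M" "P \<subset> K" using PF(1) by (auto simp: F_def)
  have "a \<odot>\<^bsub>M\<^esub> k \<in> P" if a: "a \<in> I" and k: "k \<in> K" for a k
  proof (rule ccontr)
    assume ak: "a \<odot>\<^bsub>M\<^esub> k \<notin> P"
    have cl: "a \<in> carrier R" "k \<in> carrier M" using a I k KM \<mm>.Icarr by blast+
    have akK: "a \<odot>\<^bsub>M\<^esub> k \<in> K" using submoduleE(4)[OF K cl(1) k] .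
    have akM: "a \<odot>\<^bsub>M\<^esub> k \<in> carrier M" using cl by simp
    define C where "C = {r \<odot>\<^bsub>M\<^esub> (a \<odot>\<^bsub>M\<^esub> k) | r. r \<in> carrier R}"
    have C: "submodule C R M" "a \<odot>\<^bsub>M\<^esub> k \<in> C" using submodule_cyclic[OF akM] unfolding C_def by auto
    have CK: "C \<subseteq> K" unfolding C_def using submoduleE(4)[OF K _ akK] by blast
    have PC: "submodule (submodule_add M P C) R M" "P \<subseteq> submodule_add M P C" "C \<subseteq> submodule_add M P C"
      using submodule_add[OF P(1) C(1)] by auto
    have "submodule_add M P C \<subseteq> K"
      unfolding submodule_add_def using CK P(2) submoduleE(5)[OF K] by blast
    moreover have "submodule_add M P C \<noteq> P" using ak C(2) PC(3) by blast
    then have "submodule_add M P C \<notin> F" using PF(2) PC(2) by blast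
    ultimately have "submodule_add M P C = K" using PC(1) unfolding F_def by blast
    then have "k \<in> submodule_add M P C" using k by simp
    then obtain p w where "p \<in> P" "w \<in> C" and kpw: "k = p \<oplus>\<^bsub>M\<^esub> w"
      unfolding submodule_add_def mem_Collect_eq by (elim exE conjE)
    then obtain r where r: "r \<in> carrier R" "w = r \<odot>\<^bsub>M\<^esub> (a \<odot>\<^bsub>M\<^esub> k)"
      unfolding C_def by blast
    note pr = \<open>p \<in> P\<close> r(1) kpw[unfolded r(2)]
    have pM: "p \<in> carrier M" using pr(1) P(2) KM by blast
    define Q where "Q = {s \<in> carrier R. \<forall>v\<in>{k}. s \<odot>\<^bsub>M\<^esub> v \<in> P}"
    have Q: "ideal Q R" unfolding Q_def by (rule ideal_colon[OF P(1)]) (use cl in simp)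
    \<comment> \<open>If \<open>k\<close> were in \<open>P\<close>, so would be \<open>a k\<close>;
      hence \<open>(P : k)\<close> is proper and sits in the maximal ideal.\<close>
    have "k \<notin> P" using ak submoduleE(4)[OF P(1) cl(1)] by blast
    then have "\<one> \<notin> Q" using cl by (simp add: Q_def)
    then have Qm: "Q \<subseteq> \<mm>" by (rule local_ring_proper_ideal[OF loc Q])
    have ra: "r \<otimes> a \<in> \<mm>" using pr(2) a I by (intro \<mm>.I_l_closed) auto
    have "(\<one> \<ominus> r \<otimes> a) \<odot>\<^bsub>M\<^esub> k = k \<ominus>\<^bsub>M\<^esub> r \<odot>\<^bsub>M\<^esub> (a \<odot>\<^bsub>M\<^esub> k)"
      using cl pr(2) by (simp add: R.minus_eq smult_l_distr smult_l_minus smult_assoc1 M.minus_eq)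
    also have "\<dots> = p" using add_minus_cancel[OF pM, of "r \<odot>\<^bsub>M\<^esub> (a \<odot>\<^bsub>M\<^esub> k)"] pr cl by simp
    finally have "\<one> \<ominus> r \<otimes> a \<in> Q" using pr cl by (simp add: Q_def)
    then have "\<one> \<ominus> r \<otimes> a \<in> \<mm>" using Qm by blast
    then have "(\<one> \<ominus> r \<otimes> a) \<oplus> r \<otimes> a \<in> \<mm>" using ra by (rule \<mm>.a_closed)
    moreover have "(\<one> \<ominus> r \<otimes> a) \<oplus> r \<otimes> a = \<one>"
      using cl pr(2) by (simp add: R.minus_eq R.a_assoc R.l_neg)
    ultimately show False using local_ring_one_notin(2)[OF loc] by simp
  qed
  then have "K \<subseteq> P" using step[OF P(1)] P(2) by blast
  then show False using P(2) by blast
qed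

text \<open>A weak form of the Artin--Rees lemma, following Herstein: a submodule \<open>Q\<close> which is maximal with
  \<open>Q \<inter> K = L\<close> absorbs a power of each element of \<open>I\<close>.\<close>

lemma (in module) artin_rees:
  assumes noeth_ring: "noetherian_ring R" and noeth: "noetherian_below R M (carrier M)"
    and I: "ideal I R" and K: "submodule K R M" and L: "submodule L R M" "L \<subseteq> K"
    and absorb: "\<And>a. a \<in> I \<Longrightarrow> \<exists>c :: nat. \<forall>z\<in>K. a [^]\<^bsub>R\<^esub> c \<odot>\<^bsub>M\<^esub> z \<in> L"
  shows "\<exists>n. ideal_smult R (ideal_power R I n) M \<inter> K \<subseteq> L"
proof -
  have KM: "K \<subseteq> carrier M" using submoduleE(1)[OF K] .
  define F where "F = {Q. submodule Q R M \<and> L \<subseteq> Q \<and> Q \<inter> K \<subseteq> L}"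
  have "L \<in> F" using L by (auto simp: F_def)
  then have "\<exists>P\<in>F. \<forall>Q\<in>F. P \<subseteq> Q \<longrightarrow> Q = P"
    by (intro noetherian_maximal[OF noeth]) (auto simp: F_def)
  then obtain Q where QF: "Q \<in> F" "\<forall>P\<in>F. Q \<subseteq> P \<longrightarrow> P = Q" by (rule bexE)
  have Q: "submodule Q R M" "L \<subseteq> Q" "Q \<inter> K \<subseteq> L" using QF(1) by (auto simp: F_def)
  have QM: "Q \<subseteq> carrier M" using submoduleE(1)[OF Q(1)] .
  have "\<exists>k :: nat. \<forall>v\<in>carrier M. a [^] k \<odot>\<^bsub>M\<^esub> v \<in> Q" if a: "a \<in> I" for a
  proof -
    have aR: "a \<in> carrier R" by (rule ideal.Icarr[OF I a])
    \<comment> \<open>The ascending chain of colons \<open>(Q : a^k)\<close>. The index at which it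
      stabilises is the exponent with \<open>a^k M \<subseteq> Q\<close>.\<close>
    define U where "U k = {v \<in> carrier M. a [^] k \<odot>\<^bsub>M\<^esub> v \<in> Q}" for k :: nat
    have U: "submodule (U k) R M" for k
      unfolding U_def using aR by (intro submodule_colon[OF Q(1)]) simp
    have U_mono: "U k \<subseteq> U (j + k)" for j k :: nat
    proof
      fix v assume v: "v \<in> U k"
      then have "a [^] k \<odot>\<^bsub>M\<^esub> v \<in> Q" by (simp add: U_def)
      then have "a [^] j \<odot>\<^bsub>M\<^esub> (a [^] k \<odot>\<^bsub>M\<^esub> v) \<in> Q"
        by (rule submoduleE(4)[OF Q(1) R.nat_pow_closed[OF aR]])
      then show "v \<in> U (j + k)"
        using v aR by (simp add: U_def R.nat_pow_mult[symmetric] smult_assoc1)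
    qed
    have "\<exists>H\<in>range U. \<forall>Q\<in>range U. H \<subseteq> Q \<longrightarrow> Q = H"
      by (rule noetherian_maximal[OF noeth]) (use U in auto)
    then obtain k where k: "\<forall>Q\<in>range U. U k \<subseteq> Q \<longrightarrow> Q = U k" by blast
    obtain c :: nat where c: "\<forall>z\<in>K. a [^] c \<odot>\<^bsub>M\<^esub> z \<in> L" using absorb[OF a] by blast
    have stable: "U (c + k) = U k" using k U_mono[of k c] by blast
    define A where "A = (\<lambda>v. a [^] k \<odot>\<^bsub>M\<^esub> v) ` carrier M"
    have A: "submodule A R M"
      unfolding A_def by (rule surj_semilinear_map.image_submodule[OF smult_map carrier_is_submodule]) (use aR in simp)
    have S: "submodule (submodule_add M A Q) R M" "A \<subseteq> submodule_add M A Q" "Q \<subseteq> submodule_add M A Q"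
      using submodule_add[OF A Q(1)] by auto
    have "submodule_add M A Q \<inter> K \<subseteq> L"
    proof
      fix z assume z: "z \<in> submodule_add M A Q \<inter> K"
      then obtain e q where e: "e \<in> carrier M" "q \<in> Q" "z = a [^] k \<odot>\<^bsub>M\<^esub> e \<oplus>\<^bsub>M\<^esub> q"
        unfolding submodule_add_def A_def by blast
      have qM: "q \<in> carrier M" "a [^] k \<in> carrier R" "a [^] c \<in> carrier R" using e QM aR by auto
      \<comment> \<open>\<open>a^c\<close> sends \<open>z\<close> into \<open>L\<close>, hence into
        \<open>Q\<close>, so \<open>a^(c+k) e\<close> lies in \<open>Q\<close>; stability of the
        colons brings this down to \<open>a^k e\<close>.\<close>
      have "a [^] (c + k) \<odot>\<^bsub>M\<^esub> e = a [^] c \<odot>\<^bsub>M\<^esub> (a [^] k \<odot>\<^bsub>M\<^esub> e)"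
        using e qM aR by (simp add: R.nat_pow_mult[symmetric] smult_assoc1)
      also have "\<dots> = a [^] c \<odot>\<^bsub>M\<^esub> z \<ominus>\<^bsub>M\<^esub> a [^] c \<odot>\<^bsub>M\<^esub> q"
        using e qM by (simp add: smult_r_distr add_minus_cancel)
      also have "\<dots> \<in> Q"
        using z c Q(2) submoduleE(4)[OF Q(1) qM(3) e(2)] by (intro submodule_minus[OF Q(1)]) auto
      finally have "e \<in> U (c + k)" using e by (simp add: U_def)
      then have "a [^] k \<odot>\<^bsub>M\<^esub> e \<in> Q" unfolding stable by (simp add: U_def)
      then have "z \<in> Q" unfolding e(3) using e(2) by (rule submoduleE(5)[OF Q(1)])
      then show "z \<in> L" using Q(3) z by blast
    qed
    \<comment> \<open>Adjoining \<open>a^k M\<close> keeps \<open>Q\<close> in the family, so by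
      maximality it was contained in \<open>Q\<close> already.\<close>
    then have "submodule_add M A Q \<in> F" using S Q(2) unfolding F_def by blast
    then have "submodule_add M A Q = Q" using QF(2) S(3) by blast
    then have "A \<subseteq> Q" using S(2) by simp
    then show ?thesis unfolding A_def by blast
  qed
  then obtain n where "ideal_smult R (ideal_power R I n) M \<subseteq> Q"
    using ideal_smult_subset_if_powers[OF noeth_ring I Q(1)] by blast
  then show ?thesis using Q(3) by blast
qed

text \<open>Superficiality says nothing outside \<open>I^c M\<close>, so the direct argument reaches
  only the part \<open>K\<close> of the kernel of \<open>x\<close> inside \<open>I^c M\<close>: it
  lies in every \<open>I^n M\<close>, and Artin-Rees with Nakayama makes it zero. A power of the
  regular element \<open>y\<close> moves an arbitrary kernel element into \<open>K\<close>.\<close>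

lemma (in module) superficial_regular:
  assumes loc: "noetherian_local_ring R \<mm>" and noeth: "noetherian_below R M (carrier M)"
    and I: "ideal I R" "I \<subseteq> \<mm>" and x: "x \<in> carrier R" and sup: "superficial R I M x"
    and y: "y \<in> ideal_radical R I" "\<And>v. v \<in> carrier M \<Longrightarrow> y \<odot>\<^bsub>M\<^esub> v = \<zero>\<^bsub>M\<^esub> \<Longrightarrow> v = \<zero>\<^bsub>M\<^esub>"
    and v: "v \<in> carrier M" "x \<odot>\<^bsub>M\<^esub> v = \<zero>\<^bsub>M\<^esub>"
  shows "v = \<zero>\<^bsub>M\<^esub>"
proof -
  have noeth_ring: "noetherian_ring R" using loc by (simp add: noetherian_local_ring_def)
  obtain c where c: "\<And>n. n \<ge> c \<Longrightarrow> {e \<in> carrier M. x \<odot>\<^bsub>M\<^esub> e \<in> ideal_smult R (ideal_power R I (Suc n)) M}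
      \<inter> ideal_smult R (ideal_power R I c) M = ideal_smult R (ideal_power R I n) M"
    using sup unfolding superficial_def by blast
  have pow: "ideal (ideal_power R I n) R" for n by (rule R.ideal_power_ideal[OF I(1)])
  have ip: "submodule (ideal_smult R (ideal_power R I n) M) R M" for n
    by (rule ideal_smult_submodule[OF additive_subgroup.a_subset[OF ideal.axioms(1)[OF pow]]])
  define K where "K = {e \<in> carrier M. x \<odot>\<^bsub>M\<^esub> e \<in> {\<zero>\<^bsub>M\<^esub>}} \<inter> ideal_smult R (ideal_power R I c) M"
  have Z: "submodule {\<zero>\<^bsub>M\<^esub>} R M" by (auto simp: submodule_iff)
  have K: "submodule K R M"
    unfolding K_def by (rule submodule_Int[OF submodule_colon[OF Z x] ip])
  have KI: "K \<subseteq> ideal_smult R (ideal_power R I n) M" if "n \<ge> c" for n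
  proof -
    \<comment> \<open>\<open>x\<close> kills \<open>K\<close> and zero lies in
      \<open>I^(n+1) M\<close>, so \<open>K\<close> is inside the left-hand side of the superficial
      equation for \<open>n\<close>.\<close>
    have "K \<subseteq> {e \<in> carrier M. x \<odot>\<^bsub>M\<^esub> e \<in> ideal_smult R (ideal_power R I (Suc n)) M}
      \<inter> ideal_smult R (ideal_power R I c) M"
      using ip[of "Suc n"] unfolding K_def submodule_iff[of "ideal_smult R (ideal_power R I (Suc n)) M"]
      by (auto simp del: ideal_power.simps)
    then show ?thesis unfolding c[OF that] .
  qed
  have "K = {\<zero>\<^bsub>M\<^esub>}"
  proof (rule nakayama[OF loc noeth I(2) K])
    fix P assume P: "submodule P R M" "P \<subseteq> K" "\<forall>a\<in>I. \<forall>k\<in>K. a \<odot>\<^bsub>M\<^esub> k \<in> P"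
    \<comment> \<open>A submodule \<open>P\<close> containing \<open>IK\<close> absorbs already the
      first power of each \<open>a \<in> I\<close>, so Artin-Rees gives
      \<open>I^n M \<inter> K \<subseteq> P\<close>; and \<open>K\<close> lies in all late
      \<open>I^n M\<close>.\<close>
    have "\<exists>n. ideal_smult R (ideal_power R I n) M \<inter> K \<subseteq> P"
    proof (rule artin_rees[OF noeth_ring noeth I(1) K P(1,2)])
      fix a assume a: "a \<in> I"
      then have "a [^] (Suc 0) = a" using ideal.Icarr[OF I(1)] by simp
      then have "\<forall>z\<in>K. a [^] (Suc 0) \<odot>\<^bsub>M\<^esub> z \<in> P" using P(3) a by simp
      then show "\<exists>c :: nat. \<forall>z\<in>K. a [^] c \<odot>\<^bsub>M\<^esub> z \<in> P" by blast
    qed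
    then obtain n where n: "ideal_smult R (ideal_power R I n) M \<inter> K \<subseteq> P" by blast
    have "ideal_smult R (ideal_power R I (max n c)) M \<subseteq> ideal_smult R (ideal_power R I n) M"
      by (intro ideal_smult_mono R.ideal_power_antimono[OF I(1)]) simp
    then show "K \<subseteq> P" using n KI[of "max n c"] by auto
  qed
  obtain k :: nat where k: "y [^] k \<in> ideal_power R I c"
    using R.pow_radical_ideal_power[OF I(1) y(1)] by blast
  have yR: "y \<in> carrier R" using y(1) by (simp add: ideal_radical_def)
  have "x \<odot>\<^bsub>M\<^esub> (y [^] k \<odot>\<^bsub>M\<^esub> v) = y [^] k \<odot>\<^bsub>M\<^esub> (x \<odot>\<^bsub>M\<^esub> v)"
    using x yR v(1) by (intro smult_commute) simp_all
  also have "\<dots> = \<zero>\<^bsub>M\<^esub>" using yR v(2) by simp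
  finally have "y [^] k \<odot>\<^bsub>M\<^esub> v \<in> K"
    unfolding K_def using v yR k by (auto intro: ideal_smult_incl)
  then have "y [^] k \<odot>\<^bsub>M\<^esub> v = \<zero>\<^bsub>M\<^esub>" using \<open>K = {\<zero>\<^bsub>M\<^esub>}\<close> by simp
  \<comment> \<open>Regularity of \<open>y\<close> cancels one factor of \<open>y^k\<close> at a
    time.\<close>
  then show ?thesis
  proof (induction k)
    case 0
    then show ?case using v by simp
  next
    case (Suc k)
    have "y \<odot>\<^bsub>M\<^esub> (y [^] k \<odot>\<^bsub>M\<^esub> v) = y [^] Suc k \<odot>\<^bsub>M\<^esub> v"
      using yR v by (simp add: smult_assoc1[symmetric] R.m_comm)
    then have "y [^] k \<odot>\<^bsub>M\<^esub> v = \<zero>\<^bsub>M\<^esub>" using y(2)[of "y [^] k \<odot>\<^bsub>M\<^esub> v"] Suc.prems yR v by simp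
    then show ?case by (rule Suc.IH)
  qed
qed

text \<open>The superficial equation gives \<open>v \<in> I^n M\<close> only once
  \<open>v \<in> I^c M\<close> is known. Artin-Rees for \<open>x I^c M\<close> inside
  \<open>x M\<close> supplies this for large \<open>n\<close>: it puts \<open>x v\<close> into
  \<open>x I^c M\<close>, and regularity of \<open>x\<close> cancels \<open>x\<close>.\<close>

lemma (in module) superficial_colon:
  assumes noeth_ring: "noetherian_ring R" and noeth: "noetherian_below R M (carrier M)"
    and I: "ideal I R" and x: "x \<in> carrier R" and sup: "superficial R I M x"
    and reg: "\<And>v. v \<in> carrier M \<Longrightarrow> x \<odot>\<^bsub>M\<^esub> v = \<zero>\<^bsub>M\<^esub> \<Longrightarrow> v = \<zero>\<^bsub>M\<^esub>"
  shows "\<exists>n0. \<forall>n\<ge>n0. \<forall>v\<in>carrier M. x \<odot>\<^bsub>M\<^esub> v \<in> ideal_smult R (ideal_power R I (Suc n)) M \<longrightarrow>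
    v \<in> ideal_smult R (ideal_power R I n) M"
proof -
  obtain c where c: "\<And>n. n \<ge> c \<Longrightarrow> {e \<in> carrier M. x \<odot>\<^bsub>M\<^esub> e \<in> ideal_smult R (ideal_power R I (Suc n)) M}
      \<inter> ideal_smult R (ideal_power R I c) M = ideal_smult R (ideal_power R I n) M"
    using sup unfolding superficial_def by blast
  have pow: "ideal (ideal_power R I n) R" for n by (rule R.ideal_power_ideal[OF I(1)])
  have ip: "submodule (ideal_smult R (ideal_power R I n) M) R M" for n
    by (rule ideal_smult_submodule[OF additive_subgroup.a_subset[OF ideal.axioms(1)[OF pow]]])
  interpret mx: surj_semilinear_map R R M M id "\<lambda>v. x \<odot>\<^bsub>M\<^esub> v" by (rule smult_map[OF x])
  define K L where "K = (\<lambda>v. x \<odot>\<^bsub>M\<^esub> v) ` carrier M"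
    and "L = (\<lambda>v. x \<odot>\<^bsub>M\<^esub> v) ` ideal_smult R (ideal_power R I c) M"
  have KL: "submodule K R M" "submodule L R M" "L \<subseteq> K"
    unfolding K_def L_def using mx.image_submodule[OF carrier_is_submodule] mx.image_submodule[OF ip]
      submoduleE(1)[OF ip] by blast+
  have "\<exists>n. ideal_smult R (ideal_power R I n) M \<inter> K \<subseteq> L"
  proof (rule artin_rees[OF noeth_ring noeth I KL])
    fix a assume a: "a \<in> I"
    have "a [^] c \<odot>\<^bsub>M\<^esub> z \<in> L" if z: "z \<in> K" for z
    proof -
      obtain v where v: "v \<in> carrier M" "z = x \<odot>\<^bsub>M\<^esub> v" using z unfolding K_def by blast
      have ac: "a [^] c \<in> carrier R" "a [^] c \<in> ideal_power R I c"
        using R.pow_in_ideal_power[OF I a] ideal.Icarr[OF I a] by auto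
      \<comment> \<open>The constant \<open>c\<close> of superficiality doubles as the absorbing
        exponent, because \<open>a^c \<in> I^c\<close>.\<close>
      have "a [^] c \<odot>\<^bsub>M\<^esub> z = x \<odot>\<^bsub>M\<^esub> (a [^] c \<odot>\<^bsub>M\<^esub> v)"
        unfolding v(2) using x ac v(1) by (simp add: smult_assoc1[symmetric] R.m_comm)
      then show ?thesis unfolding L_def using ideal_smult_incl[OF ac(2) v(1)] by blast
    qed
    then show "\<exists>c :: nat. \<forall>z\<in>K. a [^] c \<odot>\<^bsub>M\<^esub> z \<in> L" by blast
  qed
  then obtain n1 where n1: "ideal_smult R (ideal_power R I n1) M \<inter> K \<subseteq> L" by blast
  show ?thesis
  proof (intro exI[of _ "max n1 c"] allI impI ballI)
    fix n v assume n: "max n1 c \<le> n" and v: "v \<in> carrier M"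
      and xv: "x \<odot>\<^bsub>M\<^esub> v \<in> ideal_smult R (ideal_power R I (Suc n)) M"
    have "ideal_smult R (ideal_power R I (Suc n)) M \<subseteq> ideal_smult R (ideal_power R I n1) M"
      using n by (intro ideal_smult_mono R.ideal_power_antimono[OF I(1)]) simp
    moreover have "x \<odot>\<^bsub>M\<^esub> v \<in> K" unfolding K_def using v by blast
    ultimately have "x \<odot>\<^bsub>M\<^esub> v \<in> L" using n1 xv by blast
    then obtain w where w: "w \<in> ideal_smult R (ideal_power R I c) M" "x \<odot>\<^bsub>M\<^esub> v = x \<odot>\<^bsub>M\<^esub> w"
      unfolding L_def by blast
    have "w \<in> carrier M" using w submoduleE(1)[OF ip] by blast
    then have "v = w" using inj_onD[OF mx.inj_onI_kernel[OF reg] w(2)] v by blast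
    then show "v \<in> ideal_smult R (ideal_power R I n) M"
      using c[of n] n v xv w(1) by auto
  qed
qed

section \<open>Direct sums and positive depth\<close>

lemma direct_sum_module:
  assumes "module R M" "module R N"
  shows "module R (direct_sum M N)"
proof -
  interpret M: module R M by fact
  interpret N: module R N by fact
  have "abelian_group (direct_sum M N)"
  proof (rule abelian_groupI)
    fix u assume "u \<in> carrier (direct_sum M N)"
    then show "\<exists>v\<in>carrier (direct_sum M N). v \<oplus>\<^bsub>direct_sum M N\<^esub> u = \<zero>\<^bsub>direct_sum M N\<^esub>"
      by (intro bexI[of _ "(\<ominus>\<^bsub>M\<^esub> fst u, \<ominus>\<^bsub>N\<^esub> snd u)"])
        (auto simp: direct_sum_def M.M.l_neg N.M.l_neg)
  qed (auto simp: direct_sum_def M.M.a_ac N.M.a_ac)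
  then show ?thesis
    by (rule moduleI[OF M.R.cring_axioms])
      (auto simp: direct_sum_def M.smult_l_distr M.smult_r_distr M.smult_assoc1
        N.smult_l_distr N.smult_r_distr N.smult_assoc1)
qed

text \<open>The inclusion of \<open>M\<close> and the projection to \<open>M\<close> both respect
  the filtrations by powers of \<open>I\<close>, so \<open>I^n (L \<oplus> M)\<close> meets the
  summand \<open>M\<close> exactly in \<open>I^n M\<close>. The superficial equation is then
  restricted to vectors \<open>(0, v)\<close>, with the same \<open>c\<close>.\<close>

lemma superficial_direct_sumD:
  assumes "module R L" "module R M" "ideal I R" and sup: "superficial R I (direct_sum L M) x"
    and x: "x \<in> carrier R"
  shows "superficial R I M x"
proof -
  let ?D = "direct_sum L M"
  interpret L: module R L by fact
  interpret M: module R M by fact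
  have carr: "(\<zero>\<^bsub>L\<^esub>, v) \<in> carrier ?D \<longleftrightarrow> v \<in> carrier M" for v
    by (simp add: direct_sum_def)
  have xs: "x \<odot>\<^bsub>?D\<^esub> (\<zero>\<^bsub>L\<^esub>, v) = (\<zero>\<^bsub>L\<^esub>, x \<odot>\<^bsub>M\<^esub> v)" for v
    using x by (simp add: direct_sum_def)
  have D: "module R ?D" by (rule direct_sum_module) fact+
  interpret pr: surj_semilinear_map R R "?D" M id snd
    by (rule linear_mapI[OF D assms(2)]) (simp_all add: direct_sum_def mem_Times_iff)
  interpret inj: surj_semilinear_map R R M "?D" id "\<lambda>v. (\<zero>\<^bsub>L\<^esub>, v)"
    by (rule linear_mapI[OF assms(2) D]) (simp_all add: direct_sum_def)
  have iff: "(\<zero>\<^bsub>L\<^esub>, v) \<in> ideal_smult R (ideal_power R I n) ?D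
      \<longleftrightarrow> v \<in> ideal_smult R (ideal_power R I n) M" for v n
  proof -
    have "ideal_power R I n \<subseteq> carrier R"
      by (rule additive_subgroup.a_subset[OF ideal.axioms(1)[OF L.R.ideal_power_ideal[OF assms(3)]]])
    then have "snd ` ideal_smult R (ideal_power R I n) ?D \<subseteq> ideal_smult R (ideal_power R I n) M"
      "(\<lambda>v. (\<zero>\<^bsub>L\<^esub>, v)) ` ideal_smult R (ideal_power R I n) M \<subseteq> ideal_smult R (ideal_power R I n) ?D"
      using pr.image_ideal_smult_subset inj.image_ideal_smult_subset by simp_all
    then show ?thesis unfolding image_subset_iff by force
  qed
  obtain c where c: "\<And>n. n \<ge> c \<Longrightarrow>
      {e \<in> carrier ?D. x \<odot>\<^bsub>?D\<^esub> e \<in> ideal_smult R (ideal_power R I (Suc n)) ?D}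
      \<inter> ideal_smult R (ideal_power R I c) ?D = ideal_smult R (ideal_power R I n) ?D"
    using sup unfolding superficial_def by blast
  show ?thesis
    unfolding superficial_def
  proof (intro exI[of _ c] allI impI)
    fix n assume "c \<le> n"
    show "{e \<in> carrier M. x \<odot>\<^bsub>M\<^esub> e \<in> ideal_smult R (ideal_power R I (Suc n)) M}
      \<inter> ideal_smult R (ideal_power R I c) M = ideal_smult R (ideal_power R I n) M"
    proof (rule Set.set_eqI)
      fix v
      have "(\<zero>\<^bsub>L\<^esub>, v) \<in> {e \<in> carrier ?D. x \<odot>\<^bsub>?D\<^esub> e \<in> ideal_smult R (ideal_power R I (Suc n)) ?D}
        \<inter> ideal_smult R (ideal_power R I c) ?D
        \<longleftrightarrow> (\<zero>\<^bsub>L\<^esub>, v) \<in> ideal_smult R (ideal_power R I n) ?D"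
        using c[OF \<open>c \<le> n\<close>] by simp
      then show "v \<in> {e \<in> carrier M. x \<odot>\<^bsub>M\<^esub> e \<in> ideal_smult R (ideal_power R I (Suc n)) M}
        \<inter> ideal_smult R (ideal_power R I c) M \<longleftrightarrow> v \<in> ideal_smult R (ideal_power R I n) M"
        unfolding Int_iff mem_Collect_eq iff carr xs .
    qed
  qed
qed

text \<open>Positive depth provides a nonempty regular sequence, and its first entry serves as
  \<open>y\<close>: the empty prefix generates the zero ideal, so the condition at index
  \<open>0\<close> is plain regularity on \<open>M\<close>.\<close>

lemma (in module) depth_pos_regular:
  assumes "depth R \<mm> M > 0"
  obtains y where "y \<in> \<mm>" "y \<in> carrier R" "\<And>v. v \<in> carrier M \<Longrightarrow> y \<odot>\<^bsub>M\<^esub> v = \<zero>\<^bsub>M\<^esub> \<Longrightarrow> v = \<zero>\<^bsub>M\<^esub>"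
proof -
  obtain xs where xs: "set xs \<subseteq> \<mm>" "regular_sequence R M xs" "enat (length xs) > 0"
    using assms unfolding depth_def less_Sup_iff by blast
  then obtain y ys where y: "xs = y # ys" by (cases xs) (auto simp: zero_enat_def)
  have "genideal R {} = {\<zero>}"
    using R.genideal_minimal[OF R.zeroideal, of "{}"] additive_subgroup.zero_closed[OF ideal.axioms(1)[OF R.genideal_ideal[of "{}"]]]
    by auto
  have Z: "ideal_smult R (genideal R {}) M = {\<zero>\<^bsub>M\<^esub>}"
  proof
    have "submodule {\<zero>\<^bsub>M\<^esub>} R M" by (auto simp: submodule_iff)
    then show "ideal_smult R (genideal R {}) M \<subseteq> {\<zero>\<^bsub>M\<^esub>}"
      by (rule ideal_smult_least) (auto simp: \<open>genideal R {} = {\<zero>}\<close>)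
    show "{\<zero>\<^bsub>M\<^esub>} \<subseteq> ideal_smult R (genideal R {}) M"
      using ideal_smult_submodule[of "genideal R {}"] by (simp add: submodule_iff \<open>genideal R {} = {\<zero>}\<close>)
  qed
  have "xs ! 0 = y" "take 0 xs = []" "0 < length xs" using y by auto
  then have "\<forall>v\<in>carrier M. y \<odot>\<^bsub>M\<^esub> v \<in> ideal_smult R (genideal R {}) M \<longrightarrow> v \<in> ideal_smult R (genideal R {}) M"
    using xs(2) unfolding regular_sequence_def by (metis list.set(1))
  moreover have "y \<in> \<mm>" "y \<in> carrier R" using y xs unfolding regular_sequence_def by auto
  ultimately show thesis using that Z by auto
qed

section \<open>Length\<close>



text \<open>A supremum of natural numbers that is at least \<open>n\<close> has a member that is at
  least \<open>n\<close>, and the longer chain is truncated. Length estimates can thus be made with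
  chains of a prescribed finite length, infinite length included.\<close>

lemma (in module) enat_le_module_length:
  "enat n \<le> module_length R M \<longleftrightarrow>
    (\<exists>H. (\<forall>i\<le>n. submodule (H i) R M) \<and> (\<forall>i<n. H i \<subset> H (Suc i)))" (is "_ \<longleftrightarrow> (\<exists>H. ?chain n H)")
proof
  assume le: "enat n \<le> module_length R M"
  show "\<exists>H. ?chain n H"
  proof (cases n)
    case 0
    then show ?thesis using carrier_is_submodule by auto
  next
    case (Suc k)
    then have "enat k < module_length R M" using le by (metis Suc_ile_eq)
    then obtain y where y: "y \<in> {enat n | n. \<exists>H. ?chain n H}" "enat k < y"
      unfolding module_length_def less_Sup_iff by (elim bexE)
    then obtain m H where m: "y = enat m" "?chain m H" by blast
    then have "n \<le> m" using y Suc by simp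
    then have "?chain n H" using m(2) by simp
    then show ?thesis by blast
  qed
next
  assume "\<exists>H. ?chain n H"
  then show "enat n \<le> module_length R M"
    unfolding module_length_def by (intro Sup_upper) blast
qed

lemma (in module) module_length_least:
  assumes "\<And>n H. \<lbrakk>\<And>i. i \<le> n \<Longrightarrow> submodule (H i) R M; \<And>i. i < n \<Longrightarrow> H i \<subset> H (Suc i)\<rbrakk> \<Longrightarrow> enat n \<le> x"
  shows "module_length R M \<le> x"
  unfolding module_length_def by (rule Sup_least) (use assms in blast)

text \<open>Discarding repetitions keeps one inclusion for each strict step. The last equation
  records where the thinned chain ends, which the induction needs in order to append
  \<open>\<alpha> (Suc n)\<close>.\<close>

lemma strict_subchain:
  fixes \<alpha> :: "nat \<Rightarrow> 'x set"
  assumes "\<And>i. i < n \<Longrightarrow> \<alpha> i \<subseteq> \<alpha> (Suc i)"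
  shows "\<exists>H. (\<forall>i\<le>card {i. i < n \<and> \<alpha> i \<noteq> \<alpha> (Suc i)}. H i \<in> \<alpha> ` {..n}) \<and>
    (\<forall>i<card {i. i < n \<and> \<alpha> i \<noteq> \<alpha> (Suc i)}. H i \<subset> H (Suc i)) \<and>
    H (card {i. i < n \<and> \<alpha> i \<noteq> \<alpha> (Suc i)}) = \<alpha> n"
  using assms
proof (induction n)
  case 0
  show ?case by (rule exI[of _ "\<lambda>_. \<alpha> 0"]) simp
next
  case (Suc n)
  define k where "k = card {i. i < n \<and> \<alpha> i \<noteq> \<alpha> (Suc i)}"
  obtain H where H: "\<forall>i\<le>k. H i \<in> \<alpha> ` {..n}" "\<forall>i<k. H i \<subset> H (Suc i)" "H k = \<alpha> n"
    using Suc.IH[OF Suc.prems[OF less_SucI]] unfolding k_def[symmetric] by blast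
  show ?case
  proof (cases "\<alpha> n = \<alpha> (Suc n)")
    case True
    have "{i. i < Suc n \<and> \<alpha> i \<noteq> \<alpha> (Suc i)} = {i. i < n \<and> \<alpha> i \<noteq> \<alpha> (Suc i)}"
      using True by (auto simp: less_Suc_eq)
    then have c: "card {i. i < Suc n \<and> \<alpha> i \<noteq> \<alpha> (Suc i)} = k" by (simp add: k_def)
    show ?thesis unfolding c using H True
      by (intro exI[of _ H]) (auto simp: atMost_Suc)
  next
    case False
    have "{i. i < Suc n \<and> \<alpha> i \<noteq> \<alpha> (Suc i)} = insert n {i. i < n \<and> \<alpha> i \<noteq> \<alpha> (Suc i)}"
      using False by (auto simp: less_Suc_eq)
    then have c: "card {i. i < Suc n \<and> \<alpha> i \<noteq> \<alpha> (Suc i)} = Suc k" by (simp add: k_def)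
    have "\<alpha> n \<subset> \<alpha> (Suc n)" using False Suc.prems[of n] by blast
    then show ?thesis unfolding c using H
      by (intro exI[of _ "H(Suc k := \<alpha> (Suc n))"]) (auto simp: atMost_Suc less_Suc_eq le_Suc_eq)
  qed
qed

lemma (in module) enat_strict_steps_le_length:
  assumes "\<And>i. i \<le> n \<Longrightarrow> submodule (\<alpha> i) R M" "\<And>i. i < n \<Longrightarrow> \<alpha> i \<subseteq> \<alpha> (Suc i)"
  shows "enat (card {i. i < n \<and> \<alpha> i \<noteq> \<alpha> (Suc i)}) \<le> module_length R M"
proof -
  obtain H where "\<forall>i\<le>card {i. i < n \<and> \<alpha> i \<noteq> \<alpha> (Suc i)}. H i \<in> \<alpha> ` {..n}"
    "\<forall>i<card {i. i < n \<and> \<alpha> i \<noteq> \<alpha> (Suc i)}. H i \<subset> H (Suc i)"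
    using strict_subchain[of n \<alpha>] assms(2) by blast
  then show ?thesis
    unfolding enat_le_module_length using assms(1) by (intro exI[of _ H]) fastforce
qed

text \<open>A chain in \<open>B\<close> is pulled back to \<open>A\<close> and pushed to
  \<open>C\<close>. A strict step stays strict on at least one side, so the two thinned chains
  together bound the number of steps. Exactness at \<open>B\<close> suffices, which admits
  evaluation maps \<open>g\<close> that are not onto.\<close>

lemma module_length_le_add:
  assumes "semilinear_map R R A B id f" and "surj_semilinear_map R S B C \<pi> g"
    and exact: "\<And>v. v \<in> carrier B \<Longrightarrow> g v = \<zero>\<^bsub>C\<^esub> \<Longrightarrow> v \<in> f ` carrier A"
  shows "module_length R B \<le> module_length R A + module_length S C"
proof -
  interpret f: semilinear_map R R A B id f by fact
  interpret g: surj_semilinear_map R S B C \<pi> g by fact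
  show ?thesis
  proof (rule f.cod.module_length_least)
    fix n H assume H: "\<And>i. i \<le> n \<Longrightarrow> submodule (H i) R B" "\<And>i. i < n \<Longrightarrow> H i \<subset> H (Suc i)"
    define \<alpha> \<beta> where "\<alpha> i = {a \<in> carrier A. f a \<in> H i}" and "\<beta> i = g ` H i" for i
    have \<alpha>: "\<And>i. i \<le> n \<Longrightarrow> submodule (\<alpha> i) R A" "\<And>i. i < n \<Longrightarrow> \<alpha> i \<subseteq> \<alpha> (Suc i)"
      unfolding \<alpha>_def using f.vimage_submodule[OF H(1)] H(2) by auto
    have \<beta>: "\<And>i. i \<le> n \<Longrightarrow> submodule (\<beta> i) S C" "\<And>i. i < n \<Longrightarrow> \<beta> i \<subseteq> \<beta> (Suc i)"
      unfolding \<beta>_def using g.image_submodule[OF H(1)] H(2) by auto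
    have ne: "\<alpha> i \<noteq> \<alpha> (Suc i) \<or> \<beta> i \<noteq> \<beta> (Suc i)" if i: "i < n" for i
    proof (rule ccontr)
      assume "\<not> ?thesis"
      then have eq: "\<alpha> i = \<alpha> (Suc i)" "\<beta> i = \<beta> (Suc i)" by auto
      have Hi: "submodule (H i) R B" "submodule (H (Suc i)) R B" using H(1) i by auto
      have "H (Suc i) \<subseteq> H i"
      proof
        fix h' assume h': "h' \<in> H (Suc i)"
        then have "g h' \<in> g ` H i" using eq(2) unfolding \<beta>_def by blast
        then obtain h where h: "h \<in> H i" "g h' = g h" by blast
        have cl: "h \<in> carrier B" "h' \<in> carrier B" "h \<in> H (Suc i)"
          using f.cod.submoduleE(1)[OF Hi(1)] f.cod.submoduleE(1)[OF Hi(2)] h h' H(2)[OF i] by blast+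
        \<comment> \<open>Elements with equal image differ by some \<open>f a\<close>, and
          \<open>a\<close> lies in \<open>\<alpha> (Suc i) = \<alpha> i\<close>, so the difference
          is already in \<open>H i\<close>.\<close>
        have "g (h' \<ominus>\<^bsub>B\<^esub> h) = \<zero>\<^bsub>C\<^esub>" using h(2) g.eq_iff_minus_kernel[OF cl(2,1)] by blast
        then obtain a where a: "a \<in> carrier A" "h' \<ominus>\<^bsub>B\<^esub> h = f a"
          using exact[of "h' \<ominus>\<^bsub>B\<^esub> h"] cl by blast
        have "h' \<ominus>\<^bsub>B\<^esub> h \<in> H (Suc i)" by (rule f.cod.submodule_minus[OF Hi(2) h' cl(3)])
        then have "a \<in> \<alpha> i" unfolding eq(1) using a by (simp add: \<alpha>_def)
        then have "h' \<ominus>\<^bsub>B\<^esub> h \<in> H i" unfolding a(2) by (simp add: \<alpha>_def)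
        then have "(h' \<ominus>\<^bsub>B\<^esub> h) \<oplus>\<^bsub>B\<^esub> h \<in> H i" using h(1) by (rule f.cod.submoduleE(5)[OF Hi(1)])
        then show "h' \<in> H i" using f.cod.minus_add_cancel(1)[OF cl(2,1)] by simp
      qed
      then show False using H(2)[OF i] by blast
    qed
    have "n = card {i. i < n}" by simp
    also have "\<dots> \<le> card ({i. i < n \<and> \<alpha> i \<noteq> \<alpha> (Suc i)} \<union> {i. i < n \<and> \<beta> i \<noteq> \<beta> (Suc i)})"
      using ne by (intro card_mono) auto
    also have "\<dots> \<le> card {i. i < n \<and> \<alpha> i \<noteq> \<alpha> (Suc i)} + card {i. i < n \<and> \<beta> i \<noteq> \<beta> (Suc i)}"
      by (rule card_Un_le)
    finally have "enat n \<le> enat (card {i. i < n \<and> \<alpha> i \<noteq> \<alpha> (Suc i)}) + enat (card {i. i < n \<and> \<beta> i \<noteq> \<beta> (Suc i)})"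
      by simp
    also have "\<dots> \<le> module_length R A + module_length S C"
      by (intro add_mono f.dom.enat_strict_steps_le_length g.cod.enat_strict_steps_le_length \<alpha> \<beta>)
    finally show "enat n \<le> module_length R A + module_length S C" .
  qed
qed

text \<open>If one summand is infinite, arbitrarily large \<open>k\<close> fit below it and force
  \<open>z = \<infinity>\<close>; so the bound may be checked on finite chains.\<close>

lemma enat_add_le:
  assumes "\<And>k l. enat k \<le> x \<Longrightarrow> enat l \<le> y \<Longrightarrow> enat (k + l) \<le> z"
  shows "x + y \<le> z"
proof (cases "x = \<infinity> \<or> y = \<infinity>")
  case True
  then have "enat k \<le> z" for k
    using assms[of k 0] assms[of 0 k] by (auto simp: zero_enat_def[symmetric])
  then have "z = \<infinity>" by (metis Suc_ile_eq enat.exhaust less_irrefl)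
  then show ?thesis by simp
next
  case False
  then obtain k l where "x = enat k" "y = enat l" by auto
  then show ?thesis using assms[of k l] by simp
qed

text \<open>For the lower bound, the images of a chain of \<open>A\<close> are followed by the
  preimages of a chain of \<open>C\<close>: the former lie in the kernel of \<open>g\<close>, the
  latter contain it. The ring of \<open>C\<close> may differ from that of \<open>A\<close> and
  \<open>B\<close>.\<close>

lemma module_length_add:
  assumes "surj_semilinear_map R R A B id f" and "surj_semilinear_map R S B C \<pi> g"
    and exact: "f ` carrier A = {v \<in> carrier B. g v = \<zero>\<^bsub>C\<^esub>}"
    and inj: "inj_on f (carrier A)" and surj: "g ` carrier B = carrier C"
  shows "module_length R B = module_length R A + module_length S C"
proof (rule antisym)
  interpret f: surj_semilinear_map R R A B id f by fact
  interpret g: surj_semilinear_map R S B C \<pi> g by fact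
  show "module_length R B \<le> module_length R A + module_length S C"
    by (rule module_length_le_add[OF f.semilinear_map_axioms assms(2)]) (use exact in blast)
  show "module_length R A + module_length S C \<le> module_length R B"
  proof (rule enat_add_le)
    fix k l assume "enat k \<le> module_length R A" "enat l \<le> module_length S C"
    then obtain P Q where P: "\<forall>i\<le>k. submodule (P i) R A" "\<forall>i<k. P i \<subset> P (Suc i)"
      and Q: "\<forall>i\<le>l. submodule (Q i) S C" "\<forall>i<l. Q i \<subset> Q (Suc i)"
      unfolding f.dom.enat_le_module_length g.cod.enat_le_module_length by blast
    define G where "G i = {v \<in> carrier B. g v \<in> Q i}" for i
    have PA: "P i \<subseteq> carrier A" if "i \<le> k" for i using P(1) that f.dom.submoduleE(1) by blast
    have fP: "f ` P i \<subset> f ` P (Suc i)" if "i < k" for i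
    proof
      show "f ` P i \<subseteq> f ` P (Suc i)" using P(2) that by blast
      show "f ` P i \<noteq> f ` P (Suc i)"
        using inj_on_image_eq_iff[OF inj PA PA, of i "Suc i"] P(2) that by auto
    qed
    have QC: "Q i \<subseteq> carrier C" if "i \<le> l" for i using Q(1) that g.cod.submoduleE(1) by blast
    have G: "G i \<subset> G (Suc i)" if "i < l" for i
    proof
      show "G i \<subseteq> G (Suc i)" using Q(2) that by (auto simp: G_def)
      have im: "g ` G j = Q j" if "j \<le> l" for j
      proof -
        have "Q j \<subseteq> g ` carrier B" using QC[OF that] unfolding surj .
        then show ?thesis unfolding G_def by blast
      qed
      show "G i \<noteq> G (Suc i)" using im[of i] im[of "Suc i"] Q(2) that by auto
    qed
    have link: "f ` P k \<subseteq> G 0"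
    proof -
      have "\<zero>\<^bsub>C\<^esub> \<in> Q 0" using Q(1) by (simp add: g.cod.submodule_iff)
      then have "{v \<in> carrier B. g v = \<zero>\<^bsub>C\<^esub>} \<subseteq> G 0" by (auto simp: G_def)
      then show ?thesis using PA[of k] exact by blast
    qed
    \<comment> \<open>Position \<open>k\<close> is taken by \<open>G 0\<close> rather than by the
      image of \<open>P k\<close>; the inclusion \<open>link\<close> keeps the step into position
      \<open>k\<close> strict.\<close>
    define H where "H i = (if i < k then f ` P i else G (i - k))" for i
    have "submodule (H i) R B" if "i \<le> k + l" for i
      using that P(1) Q(1) f.image_submodule g.vimage_submodule unfolding H_def G_def by auto
    moreover have "H i \<subset> H (Suc i)" if i: "i < k + l" for i
    proof -
      consider "Suc i < k" | "Suc i = k" | "k \<le> i" by linarith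
      then show ?thesis
      proof cases
        case 1
        then show ?thesis using fP[of i] by (simp add: H_def)
      next
        case 2
        then show ?thesis using fP[of i] link by (auto simp: H_def)
      next
        case 3
        then show ?thesis using G[of "i - k"] i by (simp add: H_def Suc_diff_le)
      qed
    qed
    ultimately show "enat (k + l) \<le> module_length R B"
      unfolding f.cod.enat_le_module_length by (intro exI[of _ H]) blast
  qed
qed

section \<open>Finite length over a local ring\<close>

lemma (in module) submodule_restrict_iff:
  assumes P: "submodule P R M"
  shows "submodule H R (M\<lparr>carrier := P\<rparr>) \<longleftrightarrow> submodule H R M \<and> H \<subseteq> P"
proof -
  interpret P: module R "M\<lparr>carrier := P\<rparr>" by (rule submodule.submodule_is_module[OF P module_axioms])
  show ?thesis unfolding P.submodule_iff submodule_iff using submoduleE(1)[OF P] by auto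
qed

lemma (in module) inclusion_map:
  assumes P: "submodule P R M" and Q: "submodule Q R M" "P \<subseteq> Q"
  shows "surj_semilinear_map R R (M\<lparr>carrier := P\<rparr>) (M\<lparr>carrier := Q\<rparr>) id id"
  by (rule linear_mapI[OF submodule.submodule_is_module[OF P module_axioms]
        submodule.submodule_is_module[OF Q(1) module_axioms]]) (use Q in auto)

lemma (in module) module_length_zero:
  assumes "carrier M = {\<zero>\<^bsub>M\<^esub>}"
  shows "module_length R M = 0"
proof -
  have "module_length R M \<le> 0"
  proof (rule module_length_least)
    fix n H assume H: "\<And>i. i \<le> n \<Longrightarrow> submodule (H i) R M" "\<And>i. i < n \<Longrightarrow> H i \<subset> H (Suc i)"
    have Z: "H i = {\<zero>\<^bsub>M\<^esub>}" if "i \<le> n" for i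
      using H(1)[OF that] assms by (auto simp: submodule_iff)
    have "\<not> 0 < n" using H(2)[of 0] Z[of 0] Z[of "Suc 0"] by auto
    then show "enat n \<le> 0" by (simp add: zero_enat_def)
  qed
  then show ?thesis by simp
qed

text \<open>If \<open>e \<in> H\<close>, then \<open>H\<close> is the whole sum. Otherwise the colon
  ideal \<open>(H : e)\<close> is proper, hence inside the maximal ideal, which sends
  \<open>e\<close> into \<open>P\<close>; so \<open>H\<close> adds nothing to
  \<open>P\<close>.\<close>

lemma (in module) between_cyclic:
  assumes loc: "noetherian_local_ring R \<mm>"
    and P: "submodule P R M" and e: "e \<in> carrier M" "\<And>a. a \<in> \<mm> \<Longrightarrow> a \<odot>\<^bsub>M\<^esub> e \<in> P"
    and H: "submodule H R M" "P \<subseteq> H" "H \<subseteq> submodule_add M P {r \<odot>\<^bsub>M\<^esub> e | r. r \<in> carrier R}"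
  shows "H = P \<or> H = submodule_add M P {r \<odot>\<^bsub>M\<^esub> e | r. r \<in> carrier R}"
proof (rule disjCI)
  assume "H \<noteq> submodule_add M P {r \<odot>\<^bsub>M\<^esub> e | r. r \<in> carrier R}"
  then have ne: "\<not> submodule_add M P {r \<odot>\<^bsub>M\<^esub> e | r. r \<in> carrier R} \<subseteq> H" using H(3) by blast
  have "e \<notin> H"
  proof
    assume "e \<in> H"
    then have "{r \<odot>\<^bsub>M\<^esub> e | r. r \<in> carrier R} \<subseteq> H" using submoduleE(4)[OF H(1)] by blast
    then have "submodule_add M P {r \<odot>\<^bsub>M\<^esub> e | r. r \<in> carrier R} \<subseteq> H"
      using H(2) submoduleE(5)[OF H(1)] unfolding submodule_add_def by blast
    then show False using ne by blast
  qed
  define Q where "Q = {s \<in> carrier R. \<forall>v\<in>{e}. s \<odot>\<^bsub>M\<^esub> v \<in> H}"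
  have Q: "ideal Q R" unfolding Q_def by (rule ideal_colon[OF H(1)]) (use e in simp)
  have "\<one> \<notin> Q" using \<open>e \<notin> H\<close> e by (simp add: Q_def)
  then have Qm: "Q \<subseteq> \<mm>" by (rule local_ring_proper_ideal[OF loc Q])
  have "h \<in> P" if h: "h \<in> H" for h
  proof -
    have "h \<in> submodule_add M P {r \<odot>\<^bsub>M\<^esub> e | r. r \<in> carrier R}" using h H(3) by blast
    then obtain p w where "p \<in> P" "w \<in> {r \<odot>\<^bsub>M\<^esub> e | r. r \<in> carrier R}" "h = p \<oplus>\<^bsub>M\<^esub> w"
      unfolding submodule_add_def by blast
    then obtain r where r: "p \<in> P" "r \<in> carrier R" "h = p \<oplus>\<^bsub>M\<^esub> r \<odot>\<^bsub>M\<^esub> e" by blast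
    have pM: "p \<in> carrier M" "p \<in> H" using r(1) submoduleE(1)[OF P] H(2) by blast+
    have "h \<ominus>\<^bsub>M\<^esub> p = r \<odot>\<^bsub>M\<^esub> e" using add_minus_cancel[of "r \<odot>\<^bsub>M\<^esub> e" p] pM e r by (simp add: M.a_comm)
    moreover have "h \<ominus>\<^bsub>M\<^esub> p \<in> H" by (rule submodule_minus[OF H(1) h pM(2)])
    ultimately have "r \<in> Q" using r by (simp add: Q_def)
    then have "r \<odot>\<^bsub>M\<^esub> e \<in> P" using e(2) Qm by blast
    then show ?thesis unfolding r(3) by (rule submoduleE(5)[OF P r(1)])
  qed
  then show "H = P" using H(2) by blast
qed

lemma (in module) module_length_quot_cyclic:
  assumes loc: "noetherian_local_ring R \<mm>"
    and P: "submodule P R M" and e: "e \<in> carrier M" "\<And>a. a \<in> \<mm> \<Longrightarrow> a \<odot>\<^bsub>M\<^esub> e \<in> P"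
    and E: "carrier M = submodule_add M P {r \<odot>\<^bsub>M\<^esub> e | r. r \<in> carrier R}"
  shows "module_length R (quot_module M P) \<le> 1"
proof -
  interpret q: surj_semilinear_map R R M "quot_module M P" id "\<lambda>v. P +>\<^bsub>M\<^esub> v"
    by (rule quot_module_map[OF P])
  have surj: "(\<lambda>v. P +>\<^bsub>M\<^esub> v) ` carrier M = carrier (quot_module M P)" by (simp add: carrier_quot_module)
  show ?thesis
  proof (rule q.cod.module_length_least)
    fix n H assume H: "\<And>i. i \<le> n \<Longrightarrow> submodule (H i) R (quot_module M P)" "\<And>i. i < n \<Longrightarrow> H i \<subset> H (Suc i)"
    define G where "G i = {v \<in> carrier M. P +>\<^bsub>M\<^esub> v \<in> H i}" for i
    have im: "(\<lambda>v. P +>\<^bsub>M\<^esub> v) ` G i = H i" if "i \<le> n" for i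
    proof -
      have "H i \<subseteq> (\<lambda>v. P +>\<^bsub>M\<^esub> v) ` carrier M"
        using q.cod.submoduleE(1)[OF H(1)[OF that]] unfolding surj .
      then show ?thesis unfolding G_def by blast
    qed
    have G: "G i = P \<or> G i = carrier M" if "i \<le> n" for i
    proof -
      have "submodule (G i) R M" unfolding G_def by (rule q.vimage_submodule[OF H(1)[OF that]])
      moreover have "P \<subseteq> G i"
      proof
        fix p assume p: "p \<in> P"
        then have "p \<in> carrier M" using submoduleE(1)[OF P] by blast
        moreover have "P +>\<^bsub>M\<^esub> p \<in> H i"
          using quot_module_kernel[OF P \<open>p \<in> carrier M\<close>] p H(1)[OF that] by (simp add: q.cod.submodule_iff)
        ultimately show "p \<in> G i" by (simp add: G_def)
      qed
      moreover have "G i \<subseteq> carrier M" by (auto simp: G_def)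
      ultimately show ?thesis using between_cyclic[OF loc P e] unfolding E by blast
    qed
    \<comment> \<open>Three members of a strict chain would need three different preimages, but only
      \<open>P\<close> and the whole module are available.\<close>
    have "\<not> 2 \<le> n"
    proof
      assume n: "2 \<le> n"
      have s: "H 0 \<subset> H 1" "H 1 \<subset> H 2" using H(2)[of 0] H(2)[of 1] n by (simp_all add: numeral_2_eq_2)
      have "G 0 \<noteq> G 1" "G 1 \<noteq> G 2" "G 0 \<noteq> G 2" using im[of 0] im[of 1] im[of 2] s n by auto
      then show False using G[of 0] G[of 1] G[of 2] n by auto
    qed
    then show "enat n \<le> 1" by (simp add: one_enat_def)
  qed
qed

text \<open>Among the submodules of finite length there is a maximal one, \<open>P\<close>. Were it
  proper, there would be \<open>e \<notin> P\<close> with \<open>\<mm> e \<subseteq> P\<close>, and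
  \<open>P + R e\<close> would exceed \<open>P\<close> in length by at most one.\<close>

theorem (in module) finite_length:
  assumes loc: "noetherian_local_ring R \<mm>" and noeth: "noetherian_below R M (carrier M)"
    and nil: "\<And>a. a \<in> \<mm> \<Longrightarrow> \<exists>k :: nat. \<forall>v\<in>carrier M. a [^] k \<odot>\<^bsub>M\<^esub> v = \<zero>\<^bsub>M\<^esub>"
  shows "module_length R M < \<infinity>"
proof -
  have noeth_ring: "noetherian_ring R" using loc by (simp add: noetherian_local_ring_def)
  have mI: "ideal \<mm> R" by (rule local_ring_one_notin[OF loc])
  have Z: "submodule {\<zero>\<^bsub>M\<^esub>} R M" by (auto simp: submodule_iff)
  obtain N where N: "ideal_smult R (ideal_power R \<mm> N) M \<subseteq> {\<zero>\<^bsub>M\<^esub>}"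
    using ideal_smult_subset_if_powers[OF noeth_ring mI Z] nil by auto
  define F where "F = {P. submodule P R M \<and> module_length R (M\<lparr>carrier := P\<rparr>) < \<infinity>}"
  have "module_length R (M\<lparr>carrier := {\<zero>\<^bsub>M\<^esub>}\<rparr>) = 0"
    by (rule module.module_length_zero[OF submodule.submodule_is_module[OF Z module_axioms]]) simp
  then have "{\<zero>\<^bsub>M\<^esub>} \<in> F" using Z by (simp add: F_def zero_enat_def)
  then have "\<exists>P\<in>F. \<forall>Q\<in>F. P \<subseteq> Q \<longrightarrow> Q = P"
    by (intro noetherian_maximal[OF noeth]) (auto simp: F_def)
  then obtain P where PF: "P \<in> F" "\<forall>Q\<in>F. P \<subseteq> Q \<longrightarrow> Q = P" by (rule bexE)
  have P: "submodule P R M" "module_length R (M\<lparr>carrier := P\<rparr>) < \<infinity>" using PF(1) by (auto simp: F_def)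
  have "P = carrier M"
  proof (rule ccontr)
    assume "P \<noteq> carrier M"
    then have PM: "\<not> carrier M \<subseteq> P" using submoduleE(1)[OF P(1)] by blast
    \<comment> \<open>The least exponent with \<open>\<mm>^n M \<subseteq> P\<close>. It is
      positive, and a product \<open>a v\<close> outside \<open>P\<close> with
      \<open>a \<in> \<mm>^(n-1)\<close> is the required \<open>e\<close>.\<close>
    define n where "n = (LEAST n. ideal_smult R (ideal_power R \<mm> n) M \<subseteq> P)"
    have "\<zero>\<^bsub>M\<^esub> \<in> P" using P(1) by (simp add: submodule_iff)
    then have "ideal_smult R (ideal_power R \<mm> N) M \<subseteq> P" using N by blast
    then have n: "ideal_smult R (ideal_power R \<mm> n) M \<subseteq> P" unfolding n_def by (rule LeastI)
    have "n \<noteq> 0"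
    proof
      assume "n = 0"
      have "v \<in> P" if v: "v \<in> carrier M" for v
      proof -
        have "\<one> \<odot>\<^bsub>M\<^esub> v \<in> ideal_smult R (ideal_power R \<mm> 0) M" using v by (intro ideal_smult_incl) auto
        then show ?thesis using n v \<open>n = 0\<close> by auto
      qed
      then show False using PM by blast
    qed
    then obtain j where j: "n = Suc j" by (cases n) auto
    have "\<not> ideal_smult R (ideal_power R \<mm> j) M \<subseteq> P"
      using not_less_Least[of j "\<lambda>n. ideal_smult R (ideal_power R \<mm> n) M \<subseteq> P"] j by (auto simp: n_def)
    then obtain a v where av: "a \<in> ideal_power R \<mm> j" "v \<in> carrier M" "a \<odot>\<^bsub>M\<^esub> v \<notin> P"
      using ideal_smult_least[OF P(1), of "ideal_power R \<mm> j"] by blast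
    define e where "e = a \<odot>\<^bsub>M\<^esub> v"
    have aR: "a \<in> carrier R" using ideal.Icarr[OF R.ideal_power_ideal[OF mI] av(1)] .
    have e: "e \<in> carrier M" "e \<notin> P" unfolding e_def using av aR by auto
    have me: "b \<odot>\<^bsub>M\<^esub> e \<in> P" if b: "b \<in> \<mm>" for b
    proof -
      have "b \<otimes> a \<in> ideal_power R \<mm> n" unfolding j using b av(1) by (simp add: ideal_prod.prod)
      then have "(b \<otimes> a) \<odot>\<^bsub>M\<^esub> v \<in> P" by (rule subsetD[OF n ideal_smult_incl[OF _ av(2)]])
      then show ?thesis unfolding e_def using ideal.Icarr[OF mI b] aR av(2) by (simp add: smult_assoc1)
    qed
    define C where "C = {r \<odot>\<^bsub>M\<^esub> e | r. r \<in> carrier R}"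
    have C: "submodule C R M" "e \<in> C" unfolding C_def by (rule submodule_cyclic[OF e(1)])+
    define P' where "P' = submodule_add M P C"
    have P': "submodule P' R M" "P \<subseteq> P'" "C \<subseteq> P'" unfolding P'_def by (rule submodule_add[OF P(1) C(1)])+
    interpret P': module R "M\<lparr>carrier := P'\<rparr>" by (rule submodule.submodule_is_module[OF P'(1) module_axioms])
    have PP': "submodule P R (M\<lparr>carrier := P'\<rparr>)" using P(1) P'(1,2) submodule_restrict_iff by blast
    have "module_length R (M\<lparr>carrier := P'\<rparr>)
        \<le> module_length R (M\<lparr>carrier := P\<rparr>) + module_length R (quot_module (M\<lparr>carrier := P'\<rparr>) P)"
    proof (rule module_length_le_add)
      show "semilinear_map R R (M\<lparr>carrier := P\<rparr>) (M\<lparr>carrier := P'\<rparr>) id id"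
        by (rule surj_semilinear_map.axioms(1)[OF inclusion_map[OF P(1) P'(1,2)]])
      show "surj_semilinear_map R R (M\<lparr>carrier := P'\<rparr>) (quot_module (M\<lparr>carrier := P'\<rparr>) P) id (\<lambda>v. P +>\<^bsub>M\<lparr>carrier := P'\<rparr>\<^esub> v)"
        by (rule P'.quot_module_map[OF PP'])
      fix v assume "v \<in> carrier (M\<lparr>carrier := P'\<rparr>)" "P +>\<^bsub>M\<lparr>carrier := P'\<rparr>\<^esub> v = \<zero>\<^bsub>quot_module (M\<lparr>carrier := P'\<rparr>) P\<^esub>"
      then have "v \<in> P" using P'.quot_module_kernel[OF PP'] by blast
      then show "v \<in> id ` carrier (M\<lparr>carrier := P\<rparr>)" by simp
    qed
    also have "module_length R (quot_module (M\<lparr>carrier := P'\<rparr>) P) \<le> 1"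
    proof (rule P'.module_length_quot_cyclic[OF loc PP'])
      show "e \<in> carrier (M\<lparr>carrier := P'\<rparr>)" using C P' by auto
      show "a \<odot>\<^bsub>M\<lparr>carrier := P'\<rparr>\<^esub> e \<in> P" if "a \<in> \<mm>" for a using me[OF that] by simp
      show "carrier (M\<lparr>carrier := P'\<rparr>) = submodule_add (M\<lparr>carrier := P'\<rparr>) P {r \<odot>\<^bsub>M\<lparr>carrier := P'\<rparr>\<^esub> e | r. r \<in> carrier R}"
        by (simp add: P'_def C_def submodule_add_def)
    qed
    finally have "module_length R (M\<lparr>carrier := P'\<rparr>) \<le> module_length R (M\<lparr>carrier := P\<rparr>) + 1"
      by (simp add: add_left_mono)
    also have "\<dots> < \<infinity>" using P(2) by (cases "module_length R (M\<lparr>carrier := P\<rparr>)") (auto simp: one_enat_def)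
    finally have "P' \<in> F" using P'(1) by (simp add: F_def)
    then have "P' = P" using PF(2) P'(2) by blast
    then show False using e C P' by blast
  qed
  then show ?thesis using P(2) by simp
qed

section \<open>Modules of homomorphisms\<close>

lemma module_hom_eqI:
  assumes "f \<in> module_hom R M N" "g \<in> module_hom R M N" "\<And>v. v \<in> carrier M \<Longrightarrow> f v = g v"
  shows "f = g"
  using assms by (intro extensionalityI[of f "carrier M"]) (auto simp: module_hom_def PiE_def)

lemma module_homD:
  assumes "f \<in> module_hom R M N"
  shows "\<And>v. v \<in> carrier M \<Longrightarrow> f v \<in> carrier N"
    and "\<And>u v. u \<in> carrier M \<Longrightarrow> v \<in> carrier M \<Longrightarrow> f (u \<oplus>\<^bsub>M\<^esub> v) = f u \<oplus>\<^bsub>N\<^esub> f v"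
    and "\<And>a v. a \<in> carrier R \<Longrightarrow> v \<in> carrier M \<Longrightarrow> f (a \<odot>\<^bsub>M\<^esub> v) = a \<odot>\<^bsub>N\<^esub> f v"
  using assms unfolding module_hom_def by blast+

lemma module_homI:
  assumes "\<And>v. v \<in> carrier M \<Longrightarrow> f v \<in> carrier N"
    and "\<And>u v. u \<in> carrier M \<Longrightarrow> v \<in> carrier M \<Longrightarrow> f (u \<oplus>\<^bsub>M\<^esub> v) = f u \<oplus>\<^bsub>N\<^esub> f v"
    and "\<And>a v. a \<in> carrier R \<Longrightarrow> v \<in> carrier M \<Longrightarrow> f (a \<odot>\<^bsub>M\<^esub> v) = a \<odot>\<^bsub>N\<^esub> f v"
    and "f \<in> extensional (carrier M)"
  shows "f \<in> module_hom R M N"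
  unfolding module_hom_def using assms by (auto simp: PiE_def)

lemma module_hom_restrictI:
  assumes "module R M"
    and "\<And>v. v \<in> carrier M \<Longrightarrow> f v \<in> carrier N"
    and "\<And>u v. u \<in> carrier M \<Longrightarrow> v \<in> carrier M \<Longrightarrow> f (u \<oplus>\<^bsub>M\<^esub> v) = f u \<oplus>\<^bsub>N\<^esub> f v"
    and "\<And>a v. a \<in> carrier R \<Longrightarrow> v \<in> carrier M \<Longrightarrow> f (a \<odot>\<^bsub>M\<^esub> v) = a \<odot>\<^bsub>N\<^esub> f v"
  shows "restrict f (carrier M) \<in> module_hom R M N"
proof -
  interpret module R M by fact
  show ?thesis by (rule module_homI) (use assms(2-4) in simp_all)
qed

text \<open>Shared by \<open>hom_module\<close> and \<open>free_module\<close>: the functions are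
  extensional, so equations are tested pointwise on \<open>X\<close>, and negatives come from the
  scalar \<open>\<ominus> \<one>\<close>.\<close>

lemma pointwise_module:
  assumes N: "module R N"
    and sub: "carrier P \<subseteq> X \<rightarrow>\<^sub>E carrier N"
    and add: "\<And>f g. f \<oplus>\<^bsub>P\<^esub> g = (\<lambda>v\<in>X. f v \<oplus>\<^bsub>N\<^esub> g v)"
    and smult: "\<And>a f. a \<odot>\<^bsub>P\<^esub> f = (\<lambda>v\<in>X. a \<odot>\<^bsub>N\<^esub> f v)"
    and zero: "\<zero>\<^bsub>P\<^esub> = (\<lambda>v\<in>X. \<zero>\<^bsub>N\<^esub>)"
    and closed: "\<zero>\<^bsub>P\<^esub> \<in> carrier P" "\<And>f g. f \<in> carrier P \<Longrightarrow> g \<in> carrier P \<Longrightarrow> f \<oplus>\<^bsub>P\<^esub> g \<in> carrier P"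
      "\<And>a f. a \<in> carrier R \<Longrightarrow> f \<in> carrier P \<Longrightarrow> a \<odot>\<^bsub>P\<^esub> f \<in> carrier P"
  shows "module R P"
proof -
  interpret N: module R N by fact
  have D: "f v \<in> carrier N" if "f \<in> carrier P" "v \<in> X" for f v using that sub by (auto simp: PiE_iff)
  have eqI: "f = g" if "f \<in> carrier P" "g \<in> carrier P" "\<And>v. v \<in> X \<Longrightarrow> f v = g v" for f g
    by (rule extensionalityI[of f X]) (use that sub in \<open>auto simp: PiE_iff\<close>)
  note app = add smult zero
  have "abelian_group P"
  proof (rule abelian_groupI)
    fix f assume f: "f \<in> carrier P"
    then show "\<zero>\<^bsub>P\<^esub> \<oplus>\<^bsub>P\<^esub> f = f" by (intro eqI closed) (simp_all add: app D)
    have m: "(\<ominus>\<^bsub>R\<^esub> \<one>\<^bsub>R\<^esub>) \<odot>\<^bsub>P\<^esub> f \<in> carrier P" using f by (intro closed) simp_all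
    moreover have "(\<ominus>\<^bsub>R\<^esub> \<one>\<^bsub>R\<^esub>) \<odot>\<^bsub>P\<^esub> f \<oplus>\<^bsub>P\<^esub> f = \<zero>\<^bsub>P\<^esub>"
      using f m by (intro eqI closed) (simp_all add: app D N.smult_l_minus N.M.l_neg)
    ultimately show "\<exists>g\<in>carrier P. g \<oplus>\<^bsub>P\<^esub> f = \<zero>\<^bsub>P\<^esub>" by blast
    fix g assume g: "g \<in> carrier P"
    then show "f \<oplus>\<^bsub>P\<^esub> g = g \<oplus>\<^bsub>P\<^esub> f" using f by (intro eqI closed) (simp_all add: app D N.M.a_comm)
    fix h assume "h \<in> carrier P"
    then show "f \<oplus>\<^bsub>P\<^esub> g \<oplus>\<^bsub>P\<^esub> h = f \<oplus>\<^bsub>P\<^esub> (g \<oplus>\<^bsub>P\<^esub> h)"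
      using f g by (intro eqI closed) (simp_all add: app D N.M.a_assoc)
  qed (rule closed, assumption+, rule closed)
  then show ?thesis
  proof (rule moduleI[OF N.R.cring_axioms])
    fix a f assume a: "a \<in> carrier R" and f: "f \<in> carrier P"
    show "a \<odot>\<^bsub>P\<^esub> f \<in> carrier P" by (rule closed(3)[OF a f])
    { fix b assume b: "b \<in> carrier R"
      show "(a \<oplus>\<^bsub>R\<^esub> b) \<odot>\<^bsub>P\<^esub> f = a \<odot>\<^bsub>P\<^esub> f \<oplus>\<^bsub>P\<^esub> b \<odot>\<^bsub>P\<^esub> f"
        using a b f by (intro eqI closed) (simp_all add: app D N.smult_l_distr)
      show "(a \<otimes>\<^bsub>R\<^esub> b) \<odot>\<^bsub>P\<^esub> f = a \<odot>\<^bsub>P\<^esub> (b \<odot>\<^bsub>P\<^esub> f)"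
        using a b f by (intro eqI closed) (simp_all add: app D N.smult_assoc1) }
    fix g assume "g \<in> carrier P"
    then show "a \<odot>\<^bsub>P\<^esub> (f \<oplus>\<^bsub>P\<^esub> g) = a \<odot>\<^bsub>P\<^esub> f \<oplus>\<^bsub>P\<^esub> a \<odot>\<^bsub>P\<^esub> g"
      using a f by (intro eqI closed) (simp_all add: app D N.smult_r_distr)
  next
    fix f assume "f \<in> carrier P"
    then show "\<one>\<^bsub>R\<^esub> \<odot>\<^bsub>P\<^esub> f = f" by (intro eqI closed) (simp_all add: app D)
  qed
qed

lemma hom_module_module:
  assumes M: "module R M" and N: "module R N"
  shows "module R (hom_module R M N)"
proof (rule pointwise_module[OF N, of _ "carrier M"])
  interpret N: module R N by fact
  have car: "carrier (hom_module R M N) = module_hom R M N" by (simp add: hom_module_def)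
  show "carrier (hom_module R M N) \<subseteq> carrier M \<rightarrow>\<^sub>E carrier N" by (auto simp: car module_hom_def)
  show "\<zero>\<^bsub>hom_module R M N\<^esub> \<in> carrier (hom_module R M N)"
    unfolding car unfolding hom_module_def
    by simp (rule module_hom_restrictI[OF M], simp_all)
  fix f assume f: "f \<in> carrier (hom_module R M N)"
  note fD = module_homD[OF f[unfolded car]]
  { fix g assume g: "g \<in> carrier (hom_module R M N)"
    note gD = module_homD[OF g[unfolded car]]
    show "f \<oplus>\<^bsub>hom_module R M N\<^esub> g \<in> carrier (hom_module R M N)"
      unfolding car unfolding hom_module_def
      by simp (rule module_hom_restrictI[OF M], use fD gD in \<open>simp_all add: N.M.a_ac N.smult_r_distr\<close>) }
  fix a assume "a \<in> carrier R"
  then show "a \<odot>\<^bsub>hom_module R M N\<^esub> f \<in> carrier (hom_module R M N)"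
    unfolding car unfolding hom_module_def
    by simp (rule module_hom_restrictI[OF M], use fD in \<open>simp_all add: N.smult_r_distr N.smult_commute\<close>)
qed (simp_all add: hom_module_def)

text \<open>Evaluation at finitely many generators embeds \<open>Hom(M, W)\<close> into a finite
  power of \<open>W\<close>. In place of that power, vanishing is imposed at one generator at a
  time: passing from \<open>V A\<close> to \<open>V (insert a A)\<close> costs at most the length of
  \<open>W\<close>.\<close>

lemma hom_module_finite_length:
  assumes M: "module R M" and W: "module R W" and fg: "finitely_generated R M" and fin: "module_length R W < \<infinity>"
  shows "module_length R (hom_module R M W) < \<infinity>"
proof -
  interpret M: module R M by fact
  interpret W: module R W by fact
  define B where "B = hom_module R M W"
  interpret B: module R B unfolding B_def by (rule hom_module_module[OF M W])
  have car: "carrier B = module_hom R M W" by (simp add: B_def hom_module_def)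
  obtain A where A: "finite A" "A \<subseteq> carrier M" "span_submodule R M A = carrier M"
    using fg unfolding finitely_generated_def by blast
  define V where "V A = {f \<in> carrier B. \<forall>a\<in>A. f a = \<zero>\<^bsub>W\<^esub>}" for A
  have ev: "surj_semilinear_map R R B W id (\<lambda>f. f a)" if a: "a \<in> carrier M" for a
    by (rule linear_mapI[OF B.module_axioms W])
      (use a in \<open>simp_all add: car module_homD(1)\<close>, simp_all add: B_def hom_module_def)
  have V: "submodule (V A) R B" if "A \<subseteq> carrier M" for A
    unfolding B.submodule_iff
  proof (intro conjI ballI)
    have "\<zero>\<^bsub>B\<^esub> a = \<zero>\<^bsub>W\<^esub>" if "a \<in> carrier M" for a using that by (simp add: B_def hom_module_def)
    then show "\<zero>\<^bsub>B\<^esub> \<in> V A" using that B.M.zero_closed unfolding V_def by blast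
    show "V A \<subseteq> carrier B" by (auto simp: V_def)
  next
    fix f g assume fg: "f \<in> V A" "g \<in> V A"
    have "(f \<oplus>\<^bsub>B\<^esub> g) a = \<zero>\<^bsub>W\<^esub>" if "a \<in> A" for a
      using fg that \<open>A \<subseteq> carrier M\<close> by (auto simp: V_def B_def hom_module_def)
    then show "f \<oplus>\<^bsub>B\<^esub> g \<in> V A" using fg unfolding V_def by blast
  next
    fix r f assume f: "r \<in> carrier R" "f \<in> V A"
    have "(r \<odot>\<^bsub>B\<^esub> f) a = \<zero>\<^bsub>W\<^esub>" if "a \<in> A" for a
      using f that \<open>A \<subseteq> carrier M\<close> by (auto simp: V_def B_def hom_module_def)
    then show "r \<odot>\<^bsub>B\<^esub> f \<in> V A" using f unfolding V_def by blast
  qed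
  \<comment> \<open>Stated as an implication because \<open>V A\<close> shrinks as \<open>A\<close>
    grows: finiteness is carried from the small \<open>V A\<close> back to all of
    \<open>B = V {}\<close>.\<close>
  have "module_length R (B\<lparr>carrier := V A\<rparr>) < \<infinity> \<longrightarrow> module_length R B < \<infinity>"
    using A(1,2)
  proof (induction A rule: finite_induct)
    case empty
    then show ?case by (simp add: V_def)
  next
    case (insert a A)
    have sub: "V (insert a A) \<subseteq> V A" by (auto simp: V_def)
    have VA: "submodule (V A) R B" "submodule (V (insert a A)) R B" using V insert.prems by auto
    have "module_length R (B\<lparr>carrier := V A\<rparr>) \<le> module_length R (B\<lparr>carrier := V (insert a A)\<rparr>) + module_length R W"
    proof (rule module_length_le_add)
      show "semilinear_map R R (B\<lparr>carrier := V (insert a A)\<rparr>) (B\<lparr>carrier := V A\<rparr>) id id"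
        by (rule surj_semilinear_map.axioms(1)[OF B.inclusion_map[OF VA(2,1) sub]])
      interpret ev: surj_semilinear_map R R B W id "\<lambda>f. f a" using ev insert.prems by simp
      have VB: "V A \<subseteq> carrier B" by (auto simp: V_def)
      show "surj_semilinear_map R R (B\<lparr>carrier := V A\<rparr>) W id (\<lambda>f. f a)"
        by (rule linear_mapI[OF submodule.submodule_is_module[OF VA(1) B.module_axioms] W])
          (use VB ev.hom_closed ev.hom_add ev.hom_smult in \<open>simp_all add: subset_iff\<close>)
      show "f \<in> id ` carrier (B\<lparr>carrier := V (insert a A)\<rparr>)" if "f \<in> carrier (B\<lparr>carrier := V A\<rparr>)" "f a = \<zero>\<^bsub>W\<^esub>" for f
        using that by (simp add: V_def)
    qed
    moreover have "module_length R (B\<lparr>carrier := V (insert a A)\<rparr>) + module_length R W < \<infinity>"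
      if "module_length R (B\<lparr>carrier := V (insert a A)\<rparr>) < \<infinity>"
      using that fin by auto
    ultimately show ?case using insert.IH insert.prems by (auto intro: le_less_trans)
  qed
  \<comment> \<open>The kernel of a homomorphism is a submodule, so vanishing on generators means
    vanishing everywhere.\<close>
  moreover have "V A = {\<zero>\<^bsub>B\<^esub>}"
  proof
    show "{\<zero>\<^bsub>B\<^esub>} \<subseteq> V A" using V[OF A(2)] by (simp add: B.submodule_iff)
    show "V A \<subseteq> {\<zero>\<^bsub>B\<^esub>}"
    proof
      fix f assume f: "f \<in> V A"
      then have fB: "f \<in> module_hom R M W" by (simp add: V_def car)
      interpret f: surj_semilinear_map R R M W id f by (rule module_hom_semilinear[OF M W fB])
      have "carrier M \<subseteq> {v \<in> carrier M. f v = \<zero>\<^bsub>W\<^esub>}"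
        unfolding A(3)[symmetric] using f A(2) by (intro span_submodule_least[OF f.kernel_submodule, folded A(3)]) (auto simp: V_def A(3))
      then have fz: "f v = \<zero>\<^bsub>W\<^esub>" if "v \<in> carrier M" for v using that by blast
      have "\<zero>\<^bsub>B\<^esub> \<in> module_hom R M W" using B.M.zero_closed by (simp add: car)
      then have "f = \<zero>\<^bsub>B\<^esub>"
        by (rule module_hom_eqI[OF fB]) (simp add: fz B_def hom_module_def)
      then show "f \<in> {\<zero>\<^bsub>B\<^esub>}" by simp
    qed
  qed
  moreover have "module_length R (B\<lparr>carrier := {\<zero>\<^bsub>B\<^esub>}\<rparr>) = 0"
    using module.module_length_zero[OF submodule.submodule_is_module[OF V[OF A(2)] B.module_axioms]] calculation(2)
    by simp
  ultimately show ?thesis by (simp add: B_def zero_enat_def)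
qed

section \<open>Free resolutions\<close>

context cring
begin

lemma free_module_module: "module R (free_module R n)"
  by (rule pointwise_module[OF regular_module_module[OF cring_axioms], of _ "{..<n}"])
    (auto simp: free_module_def regular_module_def)

definition unit_vector :: "nat \<Rightarrow> nat \<Rightarrow> nat \<Rightarrow> 'a"
  where "unit_vector n i = (\<lambda>j\<in>{..<n}. if j = i then \<one> else \<zero>)"

lemma unit_vector_closed: "unit_vector n i \<in> carrier (free_module R n)"
  by (simp add: free_module_def unit_vector_def)

lemma free_module_submodule_eq:
  assumes H: "submodule H R (free_module R n)" and e: "\<And>i. i < n \<Longrightarrow> unit_vector n i \<in> H"
  shows "H = carrier (free_module R n)"
proof
  interpret F: module R "free_module R n" by (rule free_module_module)
  show "H \<subseteq> carrier (free_module R n)" by (rule F.submoduleE(1)[OF H])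
  show "carrier (free_module R n) \<subseteq> H"
  proof
    fix f assume "f \<in> carrier (free_module R n)"
    then have fD: "\<And>i. i < n \<Longrightarrow> f i \<in> carrier R" "f \<in> extensional {..<n}"
      by (auto simp: free_module_def PiE_def)
    \<comment> \<open>Truncations of \<open>f\<close>: passing from \<open>t k\<close> to
      \<open>t (Suc k)\<close> adds one multiple of a unit vector, and \<open>t n\<close> is
      \<open>f\<close>.\<close>
    define t where "t k = (\<lambda>j\<in>{..<n}. if j < k then f j else \<zero>)" for k
    have "t k \<in> H" if "k \<le> n" for k
      using that
    proof (induction k)
      case 0
      have "t 0 = \<zero>\<^bsub>free_module R n\<^esub>" by (simp add: t_def free_module_def)
      then show ?case using H by (simp add: F.submodule_iff)
    next
      case (Suc k)
      have "t (Suc k) = t k \<oplus>\<^bsub>free_module R n\<^esub> f k \<odot>\<^bsub>free_module R n\<^esub> unit_vector n k"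
        unfolding t_def free_module_def unit_vector_def
        using fD Suc.prems by (auto simp: less_Suc_eq intro!: restrict_ext)
      then show ?case
        using F.submoduleE(5)[OF H Suc.IH F.submoduleE(4)[OF H fD(1) e]] Suc.prems by simp
    qed
    moreover have "t n = f"
      by (rule extensionalityI[of _ "{..<n}"]) (use fD in \<open>simp_all add: t_def\<close>)
    ultimately show "f \<in> H" by (metis order_refl)
  qed
qed

lemma free_module_span: "span_submodule R (free_module R n) (unit_vector n ` {..<n}) = carrier (free_module R n)"
proof -
  interpret F: module R "free_module R n" by (rule free_module_module)
  show ?thesis
    using span_submodule_incl[of "unit_vector n ` {..<n}" R "free_module R n"]
    by (intro free_module_submodule_eq F.span_submodule) (auto intro: unit_vector_closed)
qed

lemma free_module_finitely_generated: "finitely_generated R (free_module R n)"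
  unfolding finitely_generated_def
  by (rule exI[of _ "unit_vector n ` {..<n}"]) (auto simp: free_module_span intro: unit_vector_closed)

lemma free_module_universal:
  assumes N: "module R N" and w: "\<And>i. i < n \<Longrightarrow> w i \<in> carrier N"
  shows "\<exists>h\<in>module_hom R (free_module R n) N. \<forall>i<n. h (unit_vector n i) = w i"
proof -
  interpret N: module R N by fact
  define h where "h = (\<lambda>f\<in>carrier (free_module R n). \<Oplus>\<^bsub>N\<^esub>i\<in>{..<n}. f i \<odot>\<^bsub>N\<^esub> w i)"
  have fD: "f i \<in> carrier R" if "f \<in> carrier (free_module R n)" "i < n" for f i
    using that by (auto simp: free_module_def PiE_def)
  have "h \<in> module_hom R (free_module R n) N"
    unfolding h_def
  proof (rule module_hom_restrictI[OF free_module_module])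
    fix f assume f: "f \<in> carrier (free_module R n)"
    then show "(\<Oplus>\<^bsub>N\<^esub>i\<in>{..<n}. f i \<odot>\<^bsub>N\<^esub> w i) \<in> carrier N"
      using fD w by (intro N.M.finsum_closed) simp
    { fix g assume g: "g \<in> carrier (free_module R n)"
      have "(\<Oplus>\<^bsub>N\<^esub>i\<in>{..<n}. (f \<oplus>\<^bsub>free_module R n\<^esub> g) i \<odot>\<^bsub>N\<^esub> w i) = (\<Oplus>\<^bsub>N\<^esub>i\<in>{..<n}. f i \<odot>\<^bsub>N\<^esub> w i \<oplus>\<^bsub>N\<^esub> g i \<odot>\<^bsub>N\<^esub> w i)"
        using fD[OF f] fD[OF g] w
        by (intro N.M.finsum_cong') (simp_all add: free_module_def N.smult_l_distr)
      also have "\<dots> = (\<Oplus>\<^bsub>N\<^esub>i\<in>{..<n}. f i \<odot>\<^bsub>N\<^esub> w i) \<oplus>\<^bsub>N\<^esub> (\<Oplus>\<^bsub>N\<^esub>i\<in>{..<n}. g i \<odot>\<^bsub>N\<^esub> w i)"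
        using fD[OF f] fD[OF g] w by (intro N.M.finsum_addf) simp_all
      finally show "(\<Oplus>\<^bsub>N\<^esub>i\<in>{..<n}. (f \<oplus>\<^bsub>free_module R n\<^esub> g) i \<odot>\<^bsub>N\<^esub> w i)
          = (\<Oplus>\<^bsub>N\<^esub>i\<in>{..<n}. f i \<odot>\<^bsub>N\<^esub> w i) \<oplus>\<^bsub>N\<^esub> (\<Oplus>\<^bsub>N\<^esub>i\<in>{..<n}. g i \<odot>\<^bsub>N\<^esub> w i)" . }
    { fix a assume a: "a \<in> carrier R"
      have "(\<Oplus>\<^bsub>N\<^esub>i\<in>{..<n}. (a \<odot>\<^bsub>free_module R n\<^esub> f) i \<odot>\<^bsub>N\<^esub> w i) = (\<Oplus>\<^bsub>N\<^esub>i\<in>{..<n}. a \<odot>\<^bsub>N\<^esub> (f i \<odot>\<^bsub>N\<^esub> w i))"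
        using fD[OF f] a w
        by (intro N.M.finsum_cong') (simp_all add: free_module_def N.smult_assoc1)
      also have "\<dots> = a \<odot>\<^bsub>N\<^esub> (\<Oplus>\<^bsub>N\<^esub>i\<in>{..<n}. f i \<odot>\<^bsub>N\<^esub> w i)"
        using fD[OF f] a w by (intro N.finsum_smult_ldistr[symmetric]) simp_all
      finally show "(\<Oplus>\<^bsub>N\<^esub>i\<in>{..<n}. (a \<odot>\<^bsub>free_module R n\<^esub> f) i \<odot>\<^bsub>N\<^esub> w i) = a \<odot>\<^bsub>N\<^esub> (\<Oplus>\<^bsub>N\<^esub>i\<in>{..<n}. f i \<odot>\<^bsub>N\<^esub> w i)" . }
  qed
  moreover have "h (unit_vector n i) = w i" if i: "i < n" for i
  proof -
    have "h (unit_vector n i) = (\<Oplus>\<^bsub>N\<^esub>j\<in>{..<n}. unit_vector n i j \<odot>\<^bsub>N\<^esub> w j)"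
      using unit_vector_closed by (simp add: h_def)
    also have "\<dots> = (\<Oplus>\<^bsub>N\<^esub>j\<in>{..<n}. if i = j then w j else \<zero>\<^bsub>N\<^esub>)"
      using w by (intro N.M.finsum_cong') (auto simp: unit_vector_def)
    also have "\<dots> = w i"
      using i w by (intro N.M.add.finprod_singleton) auto
    finally show ?thesis .
  qed
  ultimately show ?thesis by blast
qed

lemma free_module_cover:
  assumes N: "module R N" and A: "finite A" "A \<subseteq> carrier N"
  obtains n h where "h \<in> module_hom R (free_module R n) N"
    "h ` carrier (free_module R n) = span_submodule R N A"
proof -
  obtain xs where xs: "set xs = A" using finite_list[OF A(1)] by blast
  have "xs ! i \<in> carrier N" if "i < length xs" for i using that xs A(2) nth_mem by blast
  then obtain h where h: "h \<in> module_hom R (free_module R (length xs)) N"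
    "\<And>i. i < length xs \<Longrightarrow> h (unit_vector (length xs) i) = xs ! i"
    using free_module_universal[OF N, of "length xs" "\<lambda>i. xs ! i"] by blast
  interpret h: surj_semilinear_map R R "free_module R (length xs)" N id h
    by (rule module_hom_semilinear[OF free_module_module N h(1)])
  have "h ` unit_vector (length xs) ` {..<length xs} = A"
  proof -
    have "h ` unit_vector (length xs) ` {..<length xs} = (\<lambda>i. xs ! i) ` {..<length xs}"
      unfolding image_image by (rule image_cong) (simp_all add: h(2))
    also have "\<dots> = A" unfolding xs[symmetric] set_conv_nth by blast
    finally show ?thesis .
  qed
  then have "h ` carrier (free_module R (length xs)) = span_submodule R N A"
    using h.image_span[of "unit_vector (length xs) ` {..<length xs}"] unit_vector_closed
    unfolding free_module_span by auto
  then show thesis using that h(1) by blast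
qed

text \<open>Over a Noetherian ring each kernel in a free module of finite rank is again finitely
  generated and can be covered once more. Existence is what makes the \<open>SOME\<close> in
  \<open>chosen_resolution\<close> pick an actual resolution.\<close>

lemma free_resolution_exists:
  assumes noeth: "noetherian_ring R" and M: "module R M" and fg: "finitely_generated R M"
  shows "\<exists>r \<delta> \<epsilon>. free_resolution R M r \<delta> \<epsilon>"
proof -
  obtain A where A: "finite A" "A \<subseteq> carrier M" "span_submodule R M A = carrier M"
    using fg unfolding finitely_generated_def by blast
  obtain r0 \<epsilon> where \<epsilon>: "\<epsilon> \<in> module_hom R (free_module R r0) M" "\<epsilon> ` carrier (free_module R r0) = carrier M"
    using free_module_cover[OF M A(1,2)] A(3) by metis
  have cover: "\<exists>m h. h \<in> module_hom R (free_module R m) (free_module R n) \<and> h ` carrier (free_module R m) = Z"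
    if Z: "submodule Z R (free_module R n)" for n Z
  proof -
    interpret F: module R "free_module R n" by (rule free_module_module)
    obtain B where B: "finite B" "B \<subseteq> Z" "span_submodule R (free_module R n) B = Z"
      using F.noetherian_submodule_finitely_generated[OF
          F.finitely_generated_noetherian[OF noeth free_module_finitely_generated] Z] by blast
    have "B \<subseteq> carrier (free_module R n)" using B(2) F.submoduleE(1)[OF Z] by blast
    then show ?thesis using free_module_cover[OF F.module_axioms B(1)] B(3) by metis
  qed
  \<comment> \<open>Covers are chosen for all pairs of a rank and a set at once, guarded by an
    implication, so that the resolution becomes an ordinary recursion.\<close>
  have "\<forall>n Z. \<exists>c. submodule Z R (free_module R n) \<longrightarrow>
      snd c \<in> module_hom R (free_module R (fst c)) (free_module R n) \<and> snd c ` carrier (free_module R (fst c)) = Z"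
    using cover by fastforce
  then obtain c where c: "\<And>n Z. submodule Z R (free_module R n) \<Longrightarrow>
      snd (c n Z) \<in> module_hom R (free_module R (fst (c n Z))) (free_module R n) \<and>
      snd (c n Z) ` carrier (free_module R (fst (c n Z))) = Z"
    by metis
  define m h where "m n Z = fst (c n Z)" and "h n Z = snd (c n Z)" for n Z
  have mh: "\<And>n Z. submodule Z R (free_module R n) \<Longrightarrow>
      h n Z \<in> module_hom R (free_module R (m n Z)) (free_module R n) \<and> h n Z ` carrier (free_module R (m n Z)) = Z"
    unfolding m_def h_def by (rule c)
  \<comment> \<open>A state holds the current rank and the kernel that is to be covered
    next.\<close>
  define st where "st = rec_nat (r0, {v \<in> carrier (free_module R r0). \<epsilon> v = \<zero>\<^bsub>M\<^esub>})
    (\<lambda>_ (n, Z). (m n Z, {v \<in> carrier (free_module R (m n Z)). h n Z v = \<zero>\<^bsub>free_module R n\<^esub>}))"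
  define r Z where "r i = fst (st i)" and "Z i = snd (st i)" for i
  define \<delta> where "\<delta> i = h (r i) (Z i)" for i
  have r: "r 0 = r0" "\<And>i. r (Suc i) = m (r i) (Z i)"
    by (simp_all add: r_def Z_def st_def case_prod_beta)
  have Z: "Z 0 = {v \<in> carrier (free_module R (r 0)). \<epsilon> v = \<zero>\<^bsub>M\<^esub>}"
    "\<And>i. Z (Suc i) = {v \<in> carrier (free_module R (r (Suc i))). \<delta> i v = \<zero>\<^bsub>free_module R (r i)\<^esub>}"
    by (simp_all add: r_def Z_def st_def \<delta>_def case_prod_beta)
  have Zsub: "submodule (Z i) R (free_module R (r i))" for i
  proof (induction i)
    case 0
    interpret \<epsilon>: surj_semilinear_map R R "free_module R r0" M id \<epsilon>
      by (rule module_hom_semilinear[OF free_module_module M \<epsilon>(1)])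
    show ?case unfolding Z r(1) by (rule \<epsilon>.kernel_submodule)
  next
    case (Suc i)
    have "\<delta> i \<in> module_hom R (free_module R (r (Suc i))) (free_module R (r i))"
      using mh[OF Suc.IH] by (simp add: \<delta>_def r)
    then interpret \<delta>: surj_semilinear_map R R "free_module R (r (Suc i))" "free_module R (r i)" id "\<delta> i"
      by (rule module_hom_semilinear[OF free_module_module free_module_module])
    show ?case unfolding Z by (rule \<delta>.kernel_submodule)
  qed
  have "free_resolution R M r \<delta> \<epsilon>"
    unfolding free_resolution_def
  proof (intro conjI allI)
    show "\<epsilon> \<in> module_hom R (free_module R (r 0)) M" "\<epsilon> ` carrier (free_module R (r 0)) = carrier M"
      using \<epsilon> by (simp_all add: r)
    have *: "\<delta> i ` carrier (free_module R (r (Suc i))) = Z i" for i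
      using mh[OF Zsub] by (simp add: \<delta>_def r)
    show "\<delta> i \<in> module_hom R (free_module R (r (Suc i))) (free_module R (r i))" for i
      using mh[OF Zsub] by (simp add: \<delta>_def r)
    show "\<delta> 0 ` carrier (free_module R (r 1)) = {v \<in> carrier (free_module R (r 0)). \<epsilon> v = \<zero>\<^bsub>M\<^esub>}"
      using *[of 0] Z by simp
    show "\<delta> (Suc i) ` carrier (free_module R (r (Suc (Suc i)))) =
        {v \<in> carrier (free_module R (r (Suc i))). \<delta> i v = \<zero>\<^bsub>free_module R (r i)\<^esub>}" for i
      using *[of "Suc i"] Z by simp
  qed
  then show ?thesis by blast
qed

lemma chosen_resolution:
  assumes "noetherian_ring R" "module R M" "finitely_generated R M"
  obtains \<epsilon> where "free_resolution R M (fst (chosen_resolution R M)) (snd (chosen_resolution R M)) \<epsilon>"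
proof -
  have "\<exists>z. case z of (r, \<delta>) \<Rightarrow> \<exists>\<epsilon>. free_resolution R M r \<delta> \<epsilon>"
    using free_resolution_exists[OF assms] by auto
  then have "case chosen_resolution R M of (r, \<delta>) \<Rightarrow> \<exists>\<epsilon>. free_resolution R M r \<delta> \<epsilon>"
    unfolding chosen_resolution_def by (rule someI_ex)
  then show thesis using that by (auto simp: case_prod_beta)
qed

text \<open>Projectivity of free modules. The surjection \<open>p\<close> may change the ring, so a
  map into an \<open>S\<close>-module can be lifted to an \<open>R\<close>-module.\<close>

lemma free_module_lift:
  assumes p: "semilinear_map R S W V \<pi> p" and f: "semilinear_map R S (free_module R n) V \<pi> f"
    and surj: "p ` carrier W = carrier V"
  obtains g where "g \<in> module_hom R (free_module R n) W" "\<And>v. v \<in> carrier (free_module R n) \<Longrightarrow> p (g v) = f v"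
proof -
  interpret p: semilinear_map R S W V \<pi> p by fact
  interpret f: semilinear_map R S "free_module R n" V \<pi> f by fact
  have "\<exists>w\<in>carrier W. p w = f (unit_vector n i)" for i
  proof -
    have "f (unit_vector n i) \<in> p ` carrier W" unfolding surj using unit_vector_closed by simp
    then show ?thesis by (metis imageE)
  qed
  then obtain w where w: "\<And>i. w i \<in> carrier W" "\<And>i. p (w i) = f (unit_vector n i)" by metis
  have "\<exists>g\<in>module_hom R (free_module R n) W. \<forall>i<n. g (unit_vector n i) = w i"
    by (rule free_module_universal[OF p.dom.module_axioms w(1)])
  then obtain g where g: "g \<in> module_hom R (free_module R n) W" "\<forall>i<n. g (unit_vector n i) = w i"
    by (elim bexE)
  interpret g: surj_semilinear_map R R "free_module R n" W id g
    by (rule module_hom_semilinear[OF free_module_module p.dom.module_axioms g(1)])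
  \<comment> \<open>The lift is prescribed on unit vectors only; the set where
    \<open>p \<circ> g\<close> and \<open>f\<close> agree is a submodule containing them.\<close>
  have "submodule {v \<in> carrier (free_module R n). p (g v) = f v} R (free_module R n)"
    unfolding f.dom.submodule_iff
  proof (intro conjI ballI)
    show "{v \<in> carrier (free_module R n). p (g v) = f v} \<subseteq> carrier (free_module R n)" by blast
    show "\<zero>\<^bsub>free_module R n\<^esub> \<in> {v \<in> carrier (free_module R n). p (g v) = f v}" by simp
  next
    fix u v
    assume "u \<in> {v \<in> carrier (free_module R n). p (g v) = f v}" "v \<in> {v \<in> carrier (free_module R n). p (g v) = f v}"
    then show "u \<oplus>\<^bsub>free_module R n\<^esub> v \<in> {v \<in> carrier (free_module R n). p (g v) = f v}"
      by (simp add: g.hom_add p.hom_add f.hom_add)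
  next
    fix a v assume "a \<in> carrier R" "v \<in> {v \<in> carrier (free_module R n). p (g v) = f v}"
    then show "a \<odot>\<^bsub>free_module R n\<^esub> v \<in> {v \<in> carrier (free_module R n). p (g v) = f v}"
      by (simp add: g.hom_smult p.hom_smult f.hom_smult)
  qed
  then have "{v \<in> carrier (free_module R n). p (g v) = f v} = carrier (free_module R n)"
    by (rule free_module_submodule_eq) (simp add: unit_vector_closed g(2) w(2))
  then show thesis using that g(1) by blast
qed

end

text \<open>A map that vanishes on the kernel of \<open>\<epsilon>\<close> takes the same value on
  all preimages of a point, so composing it with any set-theoretic section works. Three rings occur
  because the lemma is used with \<open>T = R\<close>, for maps out of \<open>M\<close> and out of
  quotients of \<open>\<omega>\<close>, and with \<open>T = S\<close>, for maps out of
  \<open>N = M/xM\<close>.\<close>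

lemma semilinear_factor:
  assumes "surj_semilinear_map R T F M \<sigma> \<epsilon>" and surj: "\<epsilon> ` carrier F = carrier M"
    and "semilinear_map R S F W \<pi> f"
    and \<tau>: "\<tau> \<in> ring_hom T S" "\<And>a. a \<in> carrier R \<Longrightarrow> \<tau> (\<sigma> a) = \<pi> a"
    and ker: "\<And>v. v \<in> carrier F \<Longrightarrow> \<epsilon> v = \<zero>\<^bsub>M\<^esub> \<Longrightarrow> f v = \<zero>\<^bsub>W\<^esub>"
  shows "\<exists>g. semilinear_map T S M W \<tau> g \<and> (\<forall>v\<in>carrier F. g (\<epsilon> v) = f v)"
proof -
  interpret \<epsilon>: surj_semilinear_map R T F M \<sigma> \<epsilon> by fact
  interpret f: semilinear_map R S F W \<pi> f by fact
  define s where "s = inv_into (carrier F) \<epsilon>"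
  have s: "s m \<in> carrier F" "\<epsilon> (s m) = m" if "m \<in> carrier M" for m
    using that unfolding s_def surj[symmetric] by (auto intro: inv_into_into f_inv_into_f)
  define g where "g m = f (s m)" for m
  have ge: "g (\<epsilon> v) = f v" if v: "v \<in> carrier F" for v
  proof -
    have sv: "s (\<epsilon> v) \<in> carrier F" using s(1) v by simp
    have "\<epsilon> (s (\<epsilon> v) \<ominus>\<^bsub>F\<^esub> v) = \<zero>\<^bsub>M\<^esub>" using \<epsilon>.eq_iff_minus_kernel[OF sv v] s(2) v by simp
    then have "f (s (\<epsilon> v) \<ominus>\<^bsub>F\<^esub> v) = \<zero>\<^bsub>W\<^esub>" using ker sv v by simp
    then show ?thesis unfolding g_def using f.eq_iff_minus_kernel[OF sv v] by simp
  qed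
  have "semilinear_map T S M W \<tau> g"
  proof (intro semilinear_map.intro semilinear_map_axioms.intro \<epsilon>.cod.module_axioms f.cod.module_axioms \<tau>(1))
    fix u assume "u \<in> carrier M"
    then obtain u' where u': "u' \<in> carrier F" "u = \<epsilon> u'" unfolding surj[symmetric] by (elim imageE)
    then show "g u \<in> carrier W" by (simp add: ge)
    { fix a assume "a \<in> carrier T"
      then obtain a' where a': "a' \<in> carrier R" "a = \<sigma> a'" unfolding \<epsilon>.scalar_surj[symmetric] by (elim imageE)
      have "g (\<epsilon> (a' \<odot>\<^bsub>F\<^esub> u')) = \<tau> (\<sigma> a') \<odot>\<^bsub>W\<^esub> g (\<epsilon> u')" using u' a' by (simp add: ge f.hom_smult \<tau>(2))
      then show "g (a \<odot>\<^bsub>M\<^esub> u) = \<tau> a \<odot>\<^bsub>W\<^esub> g u" using u' a' by (simp add: \<epsilon>.hom_smult) }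
    { fix v assume "v \<in> carrier M"
      then obtain v' where v': "v' \<in> carrier F" "v = \<epsilon> v'" unfolding surj[symmetric] by (elim imageE)
      have "g (\<epsilon> (u' \<oplus>\<^bsub>F\<^esub> v')) = g (\<epsilon> u') \<oplus>\<^bsub>W\<^esub> g (\<epsilon> v')" using u' v' by (simp add: ge f.hom_add)
      then show "g (u \<oplus>\<^bsub>M\<^esub> v) = g u \<oplus>\<^bsub>W\<^esub> g v" using u' v' by (simp add: \<epsilon>.hom_add) }
  qed
  then show ?thesis using ge by blast
qed

lemma module_hom_factor:
  assumes F: "module R F" and M: "module R M" and W: "module R W"
    and \<epsilon>: "\<epsilon> \<in> module_hom R F M" "\<epsilon> ` carrier F = carrier M"
    and f: "f \<in> module_hom R F W" "\<And>v. v \<in> carrier F \<Longrightarrow> \<epsilon> v = \<zero>\<^bsub>M\<^esub> \<Longrightarrow> f v = \<zero>\<^bsub>W\<^esub>"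
  obtains g where "g \<in> module_hom R M W" "\<And>v. v \<in> carrier F \<Longrightarrow> g (\<epsilon> v) = f v"
proof -
  interpret \<epsilon>: surj_semilinear_map R R F M id \<epsilon> by (rule module_hom_semilinear[OF F M \<epsilon>(1)])
  interpret f: surj_semilinear_map R R F W id f by (rule module_hom_semilinear[OF F W f(1)])
  have "\<exists>g. semilinear_map R R M W id g \<and> (\<forall>v\<in>carrier F. g (\<epsilon> v) = f v)"
    by (rule semilinear_factor[OF \<epsilon>.surj_semilinear_map_axioms \<epsilon>(2) f.semilinear_map_axioms id_ring_hom])
      (simp_all add: f(2))
  then obtain g where g: "semilinear_map R R M W id g" "\<forall>v\<in>carrier F. g (\<epsilon> v) = f v" by blast
  show thesis
    by (rule that[OF semilinear_module_hom[OF g(1)]]) (simp add: g(2))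
qed

lemma module_hom_compose:
  assumes "module R L" and f: "f \<in> module_hom R L N" and g: "g \<in> module_hom R N K"
  shows "compose (carrier L) g f \<in> module_hom R L K"
  unfolding compose_def
  by (rule module_hom_restrictI[OF assms(1)]) (simp_all add: module_homD[OF f] module_homD[OF g])

lemma module_hom_corestrict:
  assumes L: "module R L" and "surj_semilinear_map R R W W' id \<phi>" and inj: "inj_on \<phi> (carrier W)"
    and k: "k \<in> module_hom R L W'" and im: "\<And>v. v \<in> carrier L \<Longrightarrow> k v \<in> \<phi> ` carrier W"
  shows "\<exists>f\<in>module_hom R L W. \<forall>v\<in>carrier L. \<phi> (f v) = k v"
proof -
  interpret \<phi>: surj_semilinear_map R R W W' id \<phi> by fact
  interpret k: surj_semilinear_map R R L W' id k by (rule module_hom_semilinear[OF L \<phi>.cod.module_axioms k])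
  define f where "f v = inv_into (carrier W) \<phi> (k v)" for v
  have f: "f v \<in> carrier W" "\<phi> (f v) = k v" if "v \<in> carrier L" for v
    unfolding f_def using im[OF that] by (rule inv_into_into, rule f_inv_into_f)
  have f_eq: "f v = w" if "v \<in> carrier L" "w \<in> carrier W" "\<phi> w = k v" for v w
    using inj_onD[OF inj, of "f v" w] f[OF that(1)] that by simp
  have "restrict f (carrier L) \<in> module_hom R L W"
  proof (rule module_hom_restrictI[OF L])
    fix v assume v: "v \<in> carrier L"
    then show "f v \<in> carrier W" by (rule f)
    { fix u assume "u \<in> carrier L"
      then show "f (v \<oplus>\<^bsub>L\<^esub> u) = f v \<oplus>\<^bsub>W\<^esub> f u"
        by (intro f_eq) (use v f in \<open>simp_all add: \<phi>.hom_add k.hom_add\<close>) }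
    { fix a assume "a \<in> carrier R"
      then show "f (a \<odot>\<^bsub>L\<^esub> v) = a \<odot>\<^bsub>W\<^esub> f v"
        by (intro f_eq) (use v f in \<open>simp_all add: \<phi>.hom_smult k.hom_smult\<close>) }
  qed
  then show ?thesis using f(2) by (intro bexI[of _ "restrict f (carrier L)"]) simp_all
qed

text \<open>The connecting homomorphism \<open>Hom(M, V) \<rightarrow> Ext\<^sup>1(M, W)\<close> vanishes, so \<open>f\<close> lifts along \<open>p\<close>.\<close>

lemma module_hom_lift:
  assumes noeth: "noetherian_ring R" and M: "module R M" and fg: "finitely_generated R M"
    and \<phi>: "surj_semilinear_map R R W W' id \<phi>" and inj: "inj_on \<phi> (carrier W)"
    and p: "semilinear_map R S W' V \<pi> p" and surj: "p ` carrier W' = carrier V"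
    and exact: "\<And>w. w \<in> carrier W' \<Longrightarrow> p w = \<zero>\<^bsub>V\<^esub> \<longleftrightarrow> w \<in> \<phi> ` carrier W"
    and ext: "\<And>h. \<lbrakk>h \<in> cocycles R M W 1;
        compose (carrier (resolution_module R M 1)) \<phi> h \<in> coboundaries R M W' 1\<rbrakk>
      \<Longrightarrow> h \<in> coboundaries R M W 1"
    and f: "semilinear_map R S M V \<pi> f"
  obtains g where "g \<in> module_hom R M W'" "\<And>v. v \<in> carrier M \<Longrightarrow> p (g v) = f v"
proof -
  interpret M: module R M by fact
  interpret \<phi>: surj_semilinear_map R R W W' id \<phi> by fact
  interpret p: semilinear_map R S W' V \<pi> p by fact
  interpret f: semilinear_map R S M V \<pi> f by fact
  obtain \<epsilon> where res: "free_resolution R M (fst (chosen_resolution R M)) (snd (chosen_resolution R M)) \<epsilon>"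
    using M.R.chosen_resolution[OF noeth M fg] by blast
  define F where "F i = resolution_module R M i" for i
  define \<delta> where "\<delta> = snd (chosen_resolution R M)"
  have Fmod: "module R (F i)" for i unfolding F_def resolution_module_def by (rule M.R.free_module_module)
  have \<epsilon>: "\<epsilon> \<in> module_hom R (F 0) M" "\<epsilon> ` carrier (F 0) = carrier M"
    and \<delta>: "\<And>i. \<delta> i \<in> module_hom R (F (Suc i)) (F i)"
    and ex0: "\<delta> 0 ` carrier (F 1) = {v \<in> carrier (F 0). \<epsilon> v = \<zero>\<^bsub>M\<^esub>}"
    and ex1: "\<delta> 1 ` carrier (F 2) = {v \<in> carrier (F 1). \<delta> 0 v = \<zero>\<^bsub>F 0\<^esub>}"
    using res unfolding free_resolution_def F_def resolution_module_def \<delta>_def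
    by (auto simp: numeral_2_eq_2)
  interpret \<epsilon>: surj_semilinear_map R R "F 0" M id \<epsilon> by (rule module_hom_semilinear[OF Fmod M \<epsilon>(1)])
  interpret d0: surj_semilinear_map R R "F (Suc 0)" "F 0" id "\<delta> 0" by (rule module_hom_semilinear[OF Fmod Fmod \<delta>])
  interpret d1: surj_semilinear_map R R "F (Suc (Suc 0))" "F (Suc 0)" id "\<delta> (Suc 0)" by (rule module_hom_semilinear[OF Fmod Fmod \<delta>])
  have f\<epsilon>: "semilinear_map R S (F 0) V \<pi> (\<lambda>v. f (\<epsilon> v))"
    by (intro semilinear_map.intro semilinear_map_axioms.intro Fmod p.cod.module_axioms f.ring_hom)
      (simp_all add: f.hom_add f.hom_smult \<epsilon>.hom_add \<epsilon>.hom_smult)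
  \<comment> \<open>\<open>g0\<close> lifts \<open>f\<close> on the degree \<open>0\<close> free
    module only. The obstruction to descending to \<open>M\<close> is
    \<open>g0 \<circ> \<delta> 0\<close>, which takes values in the kernel of \<open>p\<close> and
    hence comes from a map \<open>h\<close> into \<open>W\<close>.\<close>
  obtain g0 where g0: "g0 \<in> module_hom R (F 0) W'" "\<And>v. v \<in> carrier (F 0) \<Longrightarrow> p (g0 v) = f (\<epsilon> v)"
    using M.R.free_module_lift[OF p f\<epsilon>[unfolded F_def resolution_module_def] surj]
    unfolding F_def resolution_module_def by blast
  interpret g0: surj_semilinear_map R R "F 0" W' id g0 by (rule module_hom_semilinear[OF Fmod \<phi>.cod.module_axioms g0(1)])
  have ker: "g0 (\<delta> 0 v) \<in> \<phi> ` carrier W" if v: "v \<in> carrier (F 1)" for v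
  proof -
    have "\<epsilon> (\<delta> 0 v) = \<zero>\<^bsub>M\<^esub>" using ex0 v by auto
    then have "p (g0 (\<delta> 0 v)) = \<zero>\<^bsub>V\<^esub>" using v g0(2)[of "\<delta> 0 v"] by simp
    then show ?thesis using exact v by simp
  qed
  have "compose (carrier (F 1)) g0 (\<delta> 0) \<in> module_hom R (F 1) W'"
    using module_hom_compose[OF Fmod \<delta> g0(1)] by simp
  then have "\<exists>h\<in>module_hom R (F 1) W. \<forall>v\<in>carrier (F 1). \<phi> (h v) = compose (carrier (F 1)) g0 (\<delta> 0) v"
    by (rule module_hom_corestrict[OF Fmod \<phi>.surj_semilinear_map_axioms inj]) (simp add: compose_def ker)
  then obtain h where h_hom: "h \<in> module_hom R (F 1) W"
    and h: "\<And>v. v \<in> carrier (F 1) \<Longrightarrow> \<phi> (h v) = g0 (\<delta> 0 v)" by (auto simp: compose_def)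
  \<comment> \<open>\<open>\<phi> (h (\<delta> 1 v)) = g0 (\<delta> 0 (\<delta> 1 v))\<close> is
    zero, and \<open>\<phi>\<close> is injective.\<close>
  have "h \<in> cocycles R M W 1"
  proof -
    have "h (\<delta> 1 v) = \<zero>\<^bsub>W\<^esub>" if v: "v \<in> carrier (F 2)" for v
    proof -
      have "\<delta> 1 v \<in> carrier (F 1)" "\<delta> 0 (\<delta> 1 v) = \<zero>\<^bsub>F 0\<^esub>" using ex1 v by auto
      then show ?thesis
        using inj_onD[OF inj, of "h (\<delta> 1 v)" "\<zero>\<^bsub>W\<^esub>"] h module_homD(1)[OF h_hom] by simp
    qed
    then have "coboundary_map R M 1 h = \<zero>\<^bsub>cochains R M W (Suc 1)\<^esub>"
      by (auto simp: coboundary_map_def cochains_def hom_module_def compose_def F_def[symmetric] \<delta>_def[symmetric]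
          numeral_2_eq_2 intro!: restrict_ext)
    then show ?thesis using h_hom
      by (simp add: cocycles_def cochains_def hom_module_def F_def[symmetric])
  qed
  \<comment> \<open>Over \<open>W'\<close> the class of \<open>h\<close> dies, \<open>g0\<close>
    being a cochain that bounds it; injectivity on \<open>Ext^1\<close> then makes \<open>h\<close>
    itself a coboundary.\<close>
  moreover have "compose (carrier (resolution_module R M 1)) \<phi> h \<in> coboundaries R M W' 1"
  proof -
    have "compose (carrier (F 1)) \<phi> h = compose (carrier (F 1)) g0 (\<delta> 0)"
      using h by (auto simp: compose_def intro!: restrict_ext)
    then show ?thesis using g0(1)
      by (auto simp: coboundary_map_def cochains_def hom_module_def F_def[symmetric] \<delta>_def[symmetric])
  qed
  ultimately have "h \<in> coboundaries R M W 1" by (rule ext)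
  then obtain k where k: "k \<in> module_hom R (F 0) W" "h = compose (carrier (F 1)) k (\<delta> 0)"
    by (auto simp: coboundary_map_def cochains_def hom_module_def F_def[symmetric] \<delta>_def[symmetric])
  interpret k: surj_semilinear_map R R "F 0" W id k by (rule module_hom_semilinear[OF Fmod \<phi>.dom.module_axioms k(1)])
  \<comment> \<open>Subtracting \<open>\<phi> \<circ> k\<close> does not change the image under
    \<open>p\<close>, and it makes the lift vanish on the image of \<open>\<delta> 0\<close>, that
    is, on the kernel of \<open>\<epsilon>\<close>.\<close>
  define g1 where "g1 = (\<lambda>v\<in>carrier (F 0). g0 v \<ominus>\<^bsub>W'\<^esub> \<phi> (k v))"
  have g1: "g1 \<in> module_hom R (F 0) W'"
    unfolding g1_def
    by (rule module_hom_restrictI[OF Fmod])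
      (simp_all add: g0.hom_add k.hom_add \<phi>.hom_add g0.hom_smult k.hom_smult \<phi>.hom_smult
        \<phi>.cod.M.minus_eq \<phi>.cod.M.minus_add \<phi>.cod.M.a_ac \<phi>.cod.smult_r_distr \<phi>.cod.smult_r_minus)
  have "g1 v = \<zero>\<^bsub>W'\<^esub>" if v: "v \<in> carrier (F 0)" "\<epsilon> v = \<zero>\<^bsub>M\<^esub>" for v
  proof -
    have "v \<in> \<delta> 0 ` carrier (F 1)" using ex0 v by simp
    then obtain u where u: "u \<in> carrier (F 1)" "v = \<delta> 0 u" by blast
    have "\<phi> (k v) = g0 v" using h[OF u(1)] u by (simp add: k(2) compose_def)
    then show ?thesis using v by (simp add: g1_def \<phi>.cod.M.minus_eq \<phi>.cod.M.r_neg)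
  qed
  then obtain g where g: "g \<in> module_hom R M W'" "\<And>v. v \<in> carrier (F 0) \<Longrightarrow> g (\<epsilon> v) = g1 v"
    using module_hom_factor[OF Fmod M \<phi>.cod.module_axioms \<epsilon> g1] by blast
  have "p (g m) = f m" if m: "m \<in> carrier M" for m
  proof -
    obtain v where v: "v \<in> carrier (F 0)" "m = \<epsilon> v" using m unfolding \<epsilon>(2)[symmetric] by (elim imageE)
    have kv: "\<phi> (k v) \<in> carrier W'" "\<phi> (k v) \<in> \<phi> ` carrier W" using v(1) by simp_all
    have "p (\<phi> (k v)) = \<zero>\<^bsub>V\<^esub>" using exact[OF kv(1)] kv(2) by blast
    moreover have "g1 v \<oplus>\<^bsub>W'\<^esub> \<phi> (k v) = g0 v"
      using v(1) kv(1) \<phi>.cod.minus_add_cancel(1)[of "g0 v" "\<phi> (k v)"] by (simp add: g1_def)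
    moreover have "g1 v \<in> carrier W'" using v(1) kv(1) by (simp add: g1_def)
    ultimately have "p (g1 v) = p (g0 v)"
      using p.hom_add[of "g1 v" "\<phi> (k v)"] kv(1) p.hom_closed[of "g1 v"] by simp
    then show ?thesis using v g(2) g0(2) by simp
  qed
  then show thesis using that g(1) by blast
qed

section \<open>Ext\<close>

lemma carrier_hom_module: "carrier (hom_module R M N) = module_hom R M N"
  by (simp add: hom_module_def)

lemma hom_module_apply:
  assumes "v \<in> carrier M"
  shows "(f \<oplus>\<^bsub>hom_module R M N\<^esub> g) v = f v \<oplus>\<^bsub>N\<^esub> g v" "(a \<odot>\<^bsub>hom_module R M N\<^esub> g) v = a \<odot>\<^bsub>N\<^esub> g v"
    "\<zero>\<^bsub>hom_module R M N\<^esub> v = \<zero>\<^bsub>N\<^esub>"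
  using assms by (simp_all add: hom_module_def)

lemma hom_module_compose_linear:
  assumes L: "module R L" and N: "module R N" "module R N'" and \<phi>: "\<phi> \<in> module_hom R N N'"
  shows "surj_semilinear_map R R (hom_module R L N) (hom_module R L N') id (\<lambda>f. compose (carrier L) \<phi> f)"
proof -
  interpret C: module R "hom_module R L N" by (rule hom_module_module[OF L N(1)])
  interpret C': module R "hom_module R L N'" by (rule hom_module_module[OF L N(2)])
  have cl: "compose (carrier L) \<phi> f \<in> carrier (hom_module R L N')" if "f \<in> carrier (hom_module R L N)" for f
    using that unfolding carrier_hom_module by (rule module_hom_compose[OF L _ \<phi>])
  have app: "compose (carrier L) \<phi> f v = \<phi> (f v)" if "v \<in> carrier L" for f v
    using that by (simp add: compose_def)
  have fv: "f v \<in> carrier N" if "f \<in> carrier (hom_module R L N)" "v \<in> carrier L" for f v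
    by (rule module_homD(1)[OF that(1)[unfolded carrier_hom_module] that(2)])
  have eqI: "f = g" if "f \<in> carrier (hom_module R L N')" "g \<in> carrier (hom_module R L N')"
    "\<And>v. v \<in> carrier L \<Longrightarrow> f v = g v" for f g
    using that unfolding carrier_hom_module by (rule module_hom_eqI)
  show ?thesis
  proof (rule linear_mapI[OF C.module_axioms C'.module_axioms])
    fix f assume f: "f \<in> carrier (hom_module R L N)"
    show "compose (carrier L) \<phi> f \<in> carrier (hom_module R L N')" by (rule cl[OF f])
    { fix g assume g: "g \<in> carrier (hom_module R L N)"
      show "compose (carrier L) \<phi> (f \<oplus>\<^bsub>hom_module R L N\<^esub> g)
          = compose (carrier L) \<phi> f \<oplus>\<^bsub>hom_module R L N'\<^esub> compose (carrier L) \<phi> g"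
        by (rule eqI) (use f g in \<open>simp_all add: cl hom_module_apply app fv module_homD[OF \<phi>]\<close>) }
    { fix a assume a: "a \<in> carrier R"
      show "compose (carrier L) \<phi> (a \<odot>\<^bsub>hom_module R L N\<^esub> f) = a \<odot>\<^bsub>hom_module R L N'\<^esub> compose (carrier L) \<phi> f"
        by (rule eqI) (use f a in \<open>simp_all add: cl hom_module_apply app fv module_homD[OF \<phi>]\<close>) }
  qed
qed

text \<open>The two assumptions guarantee that the chosen resolution of \<open>M\<close> is a
  genuine one, so that \<open>Ext\<close> with first argument \<open>M\<close> has its usual
  meaning.\<close>

locale fg_module = module R M for R (structure) and M (structure) +
  assumes noetherian: "noetherian_ring R" and finitely_generated: "finitely_generated R M"
begin

lemma resolution_module: "module R (resolution_module R M i)"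
  unfolding resolution_module_def by (rule R.free_module_module)

lemma differential_hom:
  "snd (chosen_resolution R M) i \<in> module_hom R (resolution_module R M (Suc i)) (resolution_module R M i)"
proof -
  obtain \<epsilon> where "free_resolution R M (fst (chosen_resolution R M)) (snd (chosen_resolution R M)) \<epsilon>"
    using R.chosen_resolution[OF noetherian module_axioms finitely_generated] by blast
  then show ?thesis unfolding free_resolution_def resolution_module_def by blast
qed

lemma differential_differential:
  assumes v: "v \<in> carrier (resolution_module R M (Suc (Suc i)))"
  shows "snd (chosen_resolution R M) i (snd (chosen_resolution R M) (Suc i) v) = \<zero>\<^bsub>resolution_module R M i\<^esub>"
proof -
  obtain \<epsilon> where "free_resolution R M (fst (chosen_resolution R M)) (snd (chosen_resolution R M)) \<epsilon>"
    using R.chosen_resolution[OF noetherian module_axioms finitely_generated] by blast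
  then have "snd (chosen_resolution R M) (Suc i) ` carrier (resolution_module R M (Suc (Suc i)))
      = {v \<in> carrier (resolution_module R M (Suc i)). snd (chosen_resolution R M) i v = \<zero>\<^bsub>resolution_module R M i\<^esub>}"
    unfolding free_resolution_def resolution_module_def by blast
  then show ?thesis using v by blast
qed

lemma carrier_cochains: "carrier (cochains R M N i) = module_hom R (resolution_module R M i) N"
  by (simp add: cochains_def hom_module_def)

lemma cochains_add:
  "v \<in> carrier (resolution_module R M i) \<Longrightarrow> (f \<oplus>\<^bsub>cochains R M N i\<^esub> g) v = f v \<oplus>\<^bsub>N\<^esub> g v"
  by (simp add: cochains_def hom_module_def)

lemma cochains_smult:
  "v \<in> carrier (resolution_module R M i) \<Longrightarrow> (a \<odot>\<^bsub>cochains R M N i\<^esub> g) v = a \<odot>\<^bsub>N\<^esub> g v"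
  by (simp add: cochains_def hom_module_def)

lemma cochains_zero:
  "v \<in> carrier (resolution_module R M i) \<Longrightarrow> \<zero>\<^bsub>cochains R M N i\<^esub> v = \<zero>\<^bsub>N\<^esub>"
  by (simp add: cochains_def hom_module_def)

lemma cochains_module: "module R N \<Longrightarrow> module R (cochains R M N i)"
  unfolding cochains_def by (rule hom_module_module[OF resolution_module])

lemma cochains_eqI:
  assumes "f \<in> carrier (cochains R M N i)" "g \<in> carrier (cochains R M N i)"
    "\<And>v. v \<in> carrier (resolution_module R M i) \<Longrightarrow> f v = g v"
  shows "f = g"
  using assms unfolding carrier_cochains by (rule module_hom_eqI)

lemma coboundary_map_closed:
  assumes "module R N" "f \<in> carrier (cochains R M N i)"
  shows "coboundary_map R M i f \<in> carrier (cochains R M N (Suc i))"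
  using assms differential_hom unfolding carrier_cochains coboundary_map_def
  by (intro module_hom_compose[OF resolution_module]) auto

lemma differential_closed:
  "v \<in> carrier (resolution_module R M (Suc i)) \<Longrightarrow> snd (chosen_resolution R M) i v \<in> carrier (resolution_module R M i)"
  by (rule module_homD(1)[OF differential_hom])

lemma coboundary_map_apply:
  "v \<in> carrier (resolution_module R M (Suc i)) \<Longrightarrow> coboundary_map R M i f v = f (snd (chosen_resolution R M) i v)"
  by (simp add: coboundary_map_def compose_def)

lemma coboundary_map_linear:
  assumes N: "module R N"
  shows "surj_semilinear_map R R (cochains R M N i) (cochains R M N (Suc i)) id (coboundary_map R M i)"
proof -
  interpret C: module R "cochains R M N i" by (rule cochains_module[OF N])
  interpret C': module R "cochains R M N (Suc i)" by (rule cochains_module[OF N])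
  show ?thesis
  proof (rule linear_mapI[OF C.module_axioms C'.module_axioms])
    fix f assume f: "f \<in> carrier (cochains R M N i)"
    show "coboundary_map R M i f \<in> carrier (cochains R M N (Suc i))" by (rule coboundary_map_closed[OF N f])
    { fix g assume g: "g \<in> carrier (cochains R M N i)"
      show "coboundary_map R M i (f \<oplus>\<^bsub>cochains R M N i\<^esub> g)
          = coboundary_map R M i f \<oplus>\<^bsub>cochains R M N (Suc i)\<^esub> coboundary_map R M i g"
        by (rule cochains_eqI[where N = N and i = "Suc i"])
          (use f g in \<open>simp_all add: coboundary_map_closed[OF N] coboundary_map_apply cochains_add differential_closed\<close>) }
    { fix a assume a: "a \<in> carrier R"
      show "coboundary_map R M i (a \<odot>\<^bsub>cochains R M N i\<^esub> f) = a \<odot>\<^bsub>cochains R M N (Suc i)\<^esub> coboundary_map R M i f"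
        by (rule cochains_eqI[where N = N and i = "Suc i"])
          (use f a in \<open>simp_all add: coboundary_map_closed[OF N] coboundary_map_apply cochains_smult differential_closed\<close>) }
  qed
qed

lemma cocycles_submodule:
  assumes N: "module R N"
  shows "submodule (cocycles R M N i) R (cochains R M N i)"
  unfolding cocycles_def
  by (rule semilinear_map.kernel_submodule[OF surj_semilinear_map.axioms(1)[OF coboundary_map_linear[OF N]]])

lemma coboundaries_submodule:
  assumes N: "module R N"
  shows "submodule (coboundaries R M N i) R (cochains R M N i)"
proof (cases i)
  case 0
  interpret C: module R "cochains R M N 0" by (rule cochains_module[OF N])
  show ?thesis unfolding 0 by (auto simp: C.submodule_iff)
next
  case (Suc j)
  interpret C: module R "cochains R M N j" by (rule cochains_module[OF N])
  show ?thesis unfolding Suc coboundaries.simps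
    by (rule surj_semilinear_map.image_submodule[OF coboundary_map_linear[OF N] C.carrier_is_submodule])
qed

lemma coboundaries_subset_cocycles:
  assumes N: "module R N"
  shows "coboundaries R M N i \<subseteq> cocycles R M N i"
proof (cases i)
  case 0
  interpret C: module R "cochains R M N 0" by (rule cochains_module[OF N])
  show ?thesis unfolding 0 using cocycles_submodule[OF N, of 0] by (simp add: C.submodule_iff)
next
  case (Suc j)
  show ?thesis unfolding Suc coboundaries.simps
  proof
    interpret C: module R "cochains R M N (Suc (Suc j))" by (rule cochains_module[OF N])
    fix f assume "f \<in> coboundary_map R M j ` carrier (cochains R M N j)"
    then obtain g where g: "g \<in> carrier (cochains R M N j)" "f = coboundary_map R M j g" by blast
    interpret g: surj_semilinear_map R R "resolution_module R M j" N id g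
      using g(1) unfolding carrier_cochains by (rule module_hom_semilinear[OF resolution_module N])
    have f: "f \<in> carrier (cochains R M N (Suc j))" unfolding g(2) by (rule coboundary_map_closed[OF N g(1)])
    have "coboundary_map R M (Suc j) f = \<zero>\<^bsub>cochains R M N (Suc (Suc j))\<^esub>"
      by (rule cochains_eqI[where N = N and i = "Suc (Suc j)"])
        (use coboundary_map_closed[OF N f] in \<open>simp_all add: coboundary_map_apply cochains_zero g(2)
          differential_closed differential_differential\<close>)
    then show "f \<in> cocycles R M N (Suc j)" using f by (simp add: cocycles_def)
  qed
qed

text \<open>\<open>Ext\<close> is a quotient of the record whose carrier is cut down to cocycles; a
  coset depends only on the addition, so it can be written in the full cochain module.\<close>

lemma Ext_quotient_map:
  assumes N: "module R N"
  shows "surj_semilinear_map R R ((cochains R M N i)\<lparr>carrier := cocycles R M N i\<rparr>) (Ext R i M N) id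
      (\<lambda>f. coboundaries R M N i +>\<^bsub>cochains R M N i\<^esub> f)"
    and "(\<lambda>f. coboundaries R M N i +>\<^bsub>cochains R M N i\<^esub> f) ` cocycles R M N i = carrier (Ext R i M N)"
    and "\<And>f. f \<in> cocycles R M N i \<Longrightarrow>
      coboundaries R M N i +>\<^bsub>cochains R M N i\<^esub> f = \<zero>\<^bsub>Ext R i M N\<^esub> \<longleftrightarrow> f \<in> coboundaries R M N i"
    and "\<zero>\<^bsub>Ext R i M N\<^esub> = coboundaries R M N i"
proof -
  interpret C: module R "cochains R M N i" by (rule cochains_module[OF N])
  interpret Z: module R "(cochains R M N i)\<lparr>carrier := cocycles R M N i\<rparr>"
    by (rule submodule.submodule_is_module[OF cocycles_submodule[OF N] C.module_axioms])
  have B: "submodule (coboundaries R M N i) R ((cochains R M N i)\<lparr>carrier := cocycles R M N i\<rparr>)"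
    using C.submodule_restrict_iff[OF cocycles_submodule[OF N]] coboundaries_submodule[OF N]
      coboundaries_subset_cocycles[OF N] by blast
  have coset: "coboundaries R M N i +>\<^bsub>(cochains R M N i)\<lparr>carrier := cocycles R M N i\<rparr>\<^esub> f
      = coboundaries R M N i +>\<^bsub>cochains R M N i\<^esub> f" for f
    by (simp add: a_r_coset_def')
  show "surj_semilinear_map R R ((cochains R M N i)\<lparr>carrier := cocycles R M N i\<rparr>) (Ext R i M N) id
      (\<lambda>f. coboundaries R M N i +>\<^bsub>cochains R M N i\<^esub> f)"
    using Z.quot_module_map[OF B] unfolding coset Ext_def .
  show "(\<lambda>f. coboundaries R M N i +>\<^bsub>cochains R M N i\<^esub> f) ` cocycles R M N i = carrier (Ext R i M N)"
    unfolding Ext_def carrier_quot_module coset by simp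
  show "coboundaries R M N i +>\<^bsub>cochains R M N i\<^esub> f = \<zero>\<^bsub>Ext R i M N\<^esub> \<longleftrightarrow> f \<in> coboundaries R M N i"
    if "f \<in> cocycles R M N i" for f
    using Z.quot_module_kernel[OF B, of f] that unfolding coset Ext_def by simp
  show "\<zero>\<^bsub>Ext R i M N\<^esub> = coboundaries R M N i" by (simp add: Ext_def quot_module_def)
qed

lemma zero_cocycle:
  assumes N: "module R N"
  shows "\<zero>\<^bsub>cochains R M N i\<^esub> \<in> cocycles R M N i" "\<zero>\<^bsub>cochains R M N i\<^esub> \<in> coboundaries R M N i"
proof -
  interpret C: module R "cochains R M N i" by (rule cochains_module[OF N])
  show "\<zero>\<^bsub>cochains R M N i\<^esub> \<in> cocycles R M N i" "\<zero>\<^bsub>cochains R M N i\<^esub> \<in> coboundaries R M N i"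
    using cocycles_submodule[OF N, of i] coboundaries_submodule[OF N, of i] by (simp_all add: C.submodule_iff)
qed

lemma Ext_zero_closed:
  assumes N: "module R N"
  shows "\<zero>\<^bsub>Ext R i M N\<^esub> \<in> carrier (Ext R i M N)"
proof -
  interpret E: surj_semilinear_map R R "(cochains R M N i)\<lparr>carrier := cocycles R M N i\<rparr>" "Ext R i M N" id
    "\<lambda>f. coboundaries R M N i +>\<^bsub>cochains R M N i\<^esub> f" by (rule Ext_quotient_map(1)[OF N])
  show ?thesis by simp
qed

lemma compose_cochains_linear:
  assumes "module R N" "module R N'" "\<phi> \<in> module_hom R N N'"
  shows "surj_semilinear_map R R (cochains R M N i) (cochains R M N' i) id
    (\<lambda>f. compose (carrier (resolution_module R M i)) \<phi> f)"
  unfolding cochains_def by (rule hom_module_compose_linear[OF resolution_module assms])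

lemma compose_coboundaries:
  assumes N: "module R N" "module R N'" and \<phi>: "\<phi> \<in> module_hom R N N'" and b: "b \<in> coboundaries R M N i"
  shows "compose (carrier (resolution_module R M i)) \<phi> b \<in> coboundaries R M N' i"
proof (cases i)
  case 0
  interpret c: surj_semilinear_map R R "cochains R M N 0" "cochains R M N' 0" id
    "\<lambda>f. compose (carrier (resolution_module R M 0)) \<phi> f" by (rule compose_cochains_linear[OF N \<phi>])
  show ?thesis using b c.hom_zero unfolding 0 by simp
next
  case (Suc j)
  then obtain f where f: "f \<in> carrier (cochains R M N j)" "b = coboundary_map R M j f" using b by auto
  interpret c: surj_semilinear_map R R "cochains R M N j" "cochains R M N' j" id
    "\<lambda>f. compose (carrier (resolution_module R M j)) \<phi> f" by (rule compose_cochains_linear[OF N \<phi>])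
  have "compose (carrier (resolution_module R M (Suc j))) \<phi> b
      = coboundary_map R M j (compose (carrier (resolution_module R M j)) \<phi> f)"
    unfolding f(2) coboundary_map_def compose_def
    by (rule restrict_ext) (simp add: differential_closed)
  then show ?thesis unfolding Suc using f(1) by simp
qed

text \<open>\<open>Ext_map\<close> is a union over all cocycles in a class; it collapses because
  composing with \<open>\<phi>\<close> takes coboundaries to coboundaries.\<close>

lemma Ext_map_coset:
  assumes N: "module R N" "module R N'" and \<phi>: "\<phi> \<in> module_hom R N N'" and f: "f \<in> cocycles R M N i"
  shows "Ext_map R i M N' \<phi> (coboundaries R M N i +>\<^bsub>cochains R M N i\<^esub> f)
    = coboundaries R M N' i +>\<^bsub>cochains R M N' i\<^esub> compose (carrier (resolution_module R M i)) \<phi> f"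
proof -
  interpret c: surj_semilinear_map R R "cochains R M N i" "cochains R M N' i" id
    "\<lambda>f. compose (carrier (resolution_module R M i)) \<phi> f" by (rule compose_cochains_linear[OF N \<phi>])
  have fC: "f \<in> carrier (cochains R M N i)" using f by (simp add: cocycles_def)
  have "coboundaries R M N' i +>\<^bsub>cochains R M N' i\<^esub> compose (carrier (resolution_module R M i)) \<phi> g
      = coboundaries R M N' i +>\<^bsub>cochains R M N' i\<^esub> compose (carrier (resolution_module R M i)) \<phi> f"
    if g: "g \<in> coboundaries R M N i +>\<^bsub>cochains R M N i\<^esub> f" for g
  proof -
    obtain b where b: "b \<in> coboundaries R M N i" "g = b \<oplus>\<^bsub>cochains R M N i\<^esub> f" using g unfolding mem_coset by blast
    have bC: "b \<in> carrier (cochains R M N i)"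
      using b(1) c.dom.submoduleE(1)[OF coboundaries_submodule[OF N(1)]] by blast
    have "compose (carrier (resolution_module R M i)) \<phi> g \<ominus>\<^bsub>cochains R M N' i\<^esub> compose (carrier (resolution_module R M i)) \<phi> f
        = compose (carrier (resolution_module R M i)) \<phi> b"
      unfolding b(2) using bC fC by (simp add: c.hom_add c.cod.add_minus_cancel)
    then show ?thesis
      using compose_coboundaries[OF N \<phi> b(1)] bC fC b(2)
      by (subst c.cod.coset_eq_iff[OF coboundaries_submodule[OF N(2)]]) simp_all
  qed
  moreover have "f \<in> coboundaries R M N i +>\<^bsub>cochains R M N i\<^esub> f"
    unfolding mem_coset using zero_cocycle(2)[OF N(1)] fC by (intro bexI[of _ "\<zero>\<^bsub>cochains R M N i\<^esub>"]) simp_all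
  ultimately show ?thesis unfolding Ext_map_def by blast
qed

lemma Ext_map_zero:
  assumes N: "module R N" "module R N'" and \<phi>: "\<phi> \<in> module_hom R N N'"
    and f: "f \<in> cocycles R M N i" "compose (carrier (resolution_module R M i)) \<phi> f \<in> coboundaries R M N' i"
  shows "Ext_map R i M N' \<phi> (coboundaries R M N i +>\<^bsub>cochains R M N i\<^esub> f) = \<zero>\<^bsub>Ext R i M N'\<^esub>"
proof -
  have "compose (carrier (resolution_module R M i)) \<phi> f \<in> cocycles R M N' i"
    using f(2) coboundaries_subset_cocycles[OF N(2)] by blast
  then show ?thesis unfolding Ext_map_coset[OF N \<phi> f(1)] using Ext_quotient_map(3)[OF N(2)] f(2) by blast
qed

end

section \<open>The adic filtration and multiplication between its quotients\<close>

lemma ideal_smult_product: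
  assumes W: "module R W" and I: "ideal I R" and a: "a \<in> ideal_power R I k"
    and w: "w \<in> ideal_smult R (ideal_power R I n) W"
  shows "a \<odot>\<^bsub>W\<^esub> w \<in> ideal_smult R (ideal_power R I (n + k)) W"
proof -
  interpret W: module R W by fact
  have sub: "ideal_power R I n \<subseteq> carrier R" for n
    by (rule additive_subgroup.a_subset[OF ideal.axioms(1)[OF W.R.ideal_power_ideal[OF I]]])
  have aR: "a \<in> carrier R" using a sub by blast
  have "submodule {v \<in> carrier W. a \<odot>\<^bsub>W\<^esub> v \<in> ideal_smult R (ideal_power R I (n + k)) W} R W"
    by (rule W.submodule_colon[OF W.ideal_smult_submodule[OF sub] aR])
  then have "ideal_smult R (ideal_power R I n) W \<subseteq> {v \<in> carrier W. a \<odot>\<^bsub>W\<^esub> v \<in> ideal_smult R (ideal_power R I (n + k)) W}"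
  proof (rule ideal_smult_least)
    fix b v assume b: "b \<in> ideal_power R I n" and v: "v \<in> carrier W"
    have bR: "b \<in> carrier R" using b sub by blast
    have "a \<otimes>\<^bsub>R\<^esub> b = b \<otimes>\<^bsub>R\<^esub> a" using aR bR by (rule W.R.m_comm)
    then have "a \<otimes>\<^bsub>R\<^esub> b \<in> ideal_power R I (n + k)"
      unfolding W.R.ideal_power_add[OF I] using ideal_prod.prod[OF b a] by simp
    then have "(a \<otimes>\<^bsub>R\<^esub> b) \<odot>\<^bsub>W\<^esub> v \<in> ideal_smult R (ideal_power R I (n + k)) W" by (rule ideal_smult_incl[OF _ v])
    then show "b \<odot>\<^bsub>W\<^esub> v \<in> {v \<in> carrier W. a \<odot>\<^bsub>W\<^esub> v \<in> ideal_smult R (ideal_power R I (n + k)) W}"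
      using aR bR v by (simp add: W.smult_assoc1)
  qed
  then show ?thesis using w by blast
qed

locale adic = module R W for R (structure) and W (structure) and I +
  assumes I: "ideal I R"
begin

abbreviation filt :: "nat \<Rightarrow> 'c set" where "filt n \<equiv> ideal_smult R (ideal_power R I n) W"

lemma power_subset: "ideal_power R I n \<subseteq> carrier R"
  by (rule additive_subgroup.a_subset[OF ideal.axioms(1)[OF R.ideal_power_ideal[OF I]]])

lemma filt_submodule: "submodule (filt n) R W"
  by (rule ideal_smult_submodule[OF power_subset])

lemma adic_quotient_map:
  "surj_semilinear_map R R W (adic_quotient R I W n) id (\<lambda>w. filt n +>\<^bsub>W\<^esub> w)"
  unfolding adic_quotient_def by (rule quot_module_map[OF filt_submodule])

lemma carrier_adic_quotient: "carrier (adic_quotient R I W n) = (\<lambda>w. filt n +>\<^bsub>W\<^esub> w) ` carrier W"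
  by (simp add: adic_quotient_def carrier_quot_module)

lemma adic_quotient_kernel: "w \<in> carrier W \<Longrightarrow> filt n +>\<^bsub>W\<^esub> w = \<zero>\<^bsub>adic_quotient R I W n\<^esub> \<longleftrightarrow> w \<in> filt n"
  unfolding adic_quotient_def by (rule quot_module_kernel[OF filt_submodule])

lemma adic_quotient_module: "module R (adic_quotient R I W n)"
proof -
  interpret q: surj_semilinear_map R R W "adic_quotient R I W n" id "\<lambda>w. filt n +>\<^bsub>W\<^esub> w" by (rule adic_quotient_map)
  show ?thesis by (rule q.cod.module_axioms)
qed

text \<open>Independence of the representative: \<open>b \<in> I^k\<close> carries
  \<open>I^n W\<close> into \<open>I^(n+k) W\<close>.\<close>

lemma adic_mult_coset:
  assumes b: "b \<in> ideal_power R I k" and w: "w \<in> carrier W"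
  shows "adic_mult R I W n k b (filt n +>\<^bsub>W\<^esub> w) = filt (n + k) +>\<^bsub>W\<^esub> (b \<odot>\<^bsub>W\<^esub> w)"
proof -
  have bR: "b \<in> carrier R" using b power_subset by blast
  have "filt (n + k) +>\<^bsub>W\<^esub> (b \<odot>\<^bsub>W\<^esub> v) = filt (n + k) +>\<^bsub>W\<^esub> (b \<odot>\<^bsub>W\<^esub> w)" if v: "v \<in> filt n +>\<^bsub>W\<^esub> w" for v
  proof -
    obtain u where u: "u \<in> filt n" "v = u \<oplus>\<^bsub>W\<^esub> w" using v unfolding mem_coset by blast
    have uW: "u \<in> carrier W" using u submoduleE(1)[OF filt_submodule] by blast
    have "(b \<odot>\<^bsub>W\<^esub> v) \<ominus>\<^bsub>W\<^esub> (b \<odot>\<^bsub>W\<^esub> w) = b \<odot>\<^bsub>W\<^esub> u"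
      unfolding u(2) using uW w bR by (simp add: smult_r_distr add_minus_cancel)
    then show ?thesis
      using ideal_smult_product[OF module_axioms I b u(1)] uW w bR u(2)
      by (subst coset_eq_iff[OF filt_submodule]) simp_all
  qed
  moreover have "w \<in> filt n +>\<^bsub>W\<^esub> w"
    unfolding mem_coset using filt_submodule[of n] w by (intro bexI[of _ "\<zero>\<^bsub>W\<^esub>"]) (simp_all add: submodule_iff)
  ultimately have "(\<Union>v\<in>filt n +>\<^bsub>W\<^esub> w. filt (n + k) +>\<^bsub>W\<^esub> (b \<odot>\<^bsub>W\<^esub> v)) = filt (n + k) +>\<^bsub>W\<^esub> (b \<odot>\<^bsub>W\<^esub> w)" by blast
  then show ?thesis using w by (simp add: adic_mult_def carrier_adic_quotient)
qed

lemma adic_mult_hom: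
  assumes b: "b \<in> ideal_power R I k"
  shows "adic_mult R I W n k b \<in> module_hom R (adic_quotient R I W n) (adic_quotient R I W (n + k))"
proof (rule module_homI)
  have bR: "b \<in> carrier R" using b power_subset by blast
  interpret q: surj_semilinear_map R R W "adic_quotient R I W n" id "\<lambda>w. filt n +>\<^bsub>W\<^esub> w" by (rule adic_quotient_map)
  interpret q': surj_semilinear_map R R W "adic_quotient R I W (n + k)" id "\<lambda>w. filt (n + k) +>\<^bsub>W\<^esub> w"
    by (rule adic_quotient_map)
  show "adic_mult R I W n k b \<in> extensional (carrier (adic_quotient R I W n))" by (simp add: adic_mult_def)
  fix X assume "X \<in> carrier (adic_quotient R I W n)"
  then obtain v where v: "v \<in> carrier W" "X = filt n +>\<^bsub>W\<^esub> v" unfolding carrier_adic_quotient by (elim imageE)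
  show "adic_mult R I W n k b X \<in> carrier (adic_quotient R I W (n + k))"
    unfolding v(2) adic_mult_coset[OF b v(1)] using v(1) bR by simp
  { fix Y assume "Y \<in> carrier (adic_quotient R I W n)"
    then obtain w where w: "w \<in> carrier W" "Y = filt n +>\<^bsub>W\<^esub> w" unfolding carrier_adic_quotient by (elim imageE)
    have "X \<oplus>\<^bsub>adic_quotient R I W n\<^esub> Y = filt n +>\<^bsub>W\<^esub> (v \<oplus>\<^bsub>W\<^esub> w)"
      unfolding v(2) w(2) by (rule q.hom_add[symmetric, OF v(1) w(1)])
    then show "adic_mult R I W n k b (X \<oplus>\<^bsub>adic_quotient R I W n\<^esub> Y)
        = adic_mult R I W n k b X \<oplus>\<^bsub>adic_quotient R I W (n + k)\<^esub> adic_mult R I W n k b Y"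
      using v w bR by (simp add: adic_mult_coset[OF b] smult_r_distr q'.hom_add) }
  { fix a assume a: "a \<in> carrier R"
    have "a \<odot>\<^bsub>adic_quotient R I W n\<^esub> X = filt n +>\<^bsub>W\<^esub> (a \<odot>\<^bsub>W\<^esub> v)"
      unfolding v(2) using q.hom_smult[OF a v(1)] by simp
    then show "adic_mult R I W n k b (a \<odot>\<^bsub>adic_quotient R I W n\<^esub> X)
        = a \<odot>\<^bsub>adic_quotient R I W (n + k)\<^esub> adic_mult R I W n k b X"
      using v a bR q'.hom_smult[of a "b \<odot>\<^bsub>W\<^esub> v"] by (simp add: adic_mult_coset[OF b] smult_commute) }
qed

lemma adic_mult_zero:
  assumes X: "X \<in> carrier (adic_quotient R I W n)"
  shows "adic_mult R I W n k \<zero> X = \<zero>\<^bsub>adic_quotient R I W (n + k)\<^esub>"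
proof -
  obtain v where v: "v \<in> carrier W" "X = filt n +>\<^bsub>W\<^esub> v" using X unfolding carrier_adic_quotient by (elim imageE)
  have "\<zero> \<in> ideal_power R I k"
    by (rule additive_subgroup.zero_closed[OF ideal.axioms(1)[OF R.ideal_power_ideal[OF I]]])
  then have "adic_mult R I W n k \<zero> X = filt (n + k) +>\<^bsub>W\<^esub> \<zero>\<^bsub>W\<^esub>"
    unfolding v(2) using v(1) by (simp add: adic_mult_coset)
  then show ?thesis using adic_quotient_kernel[of "\<zero>\<^bsub>W\<^esub>" "n + k"] filt_submodule by (simp add: submodule_iff)
qed

end

text \<open>Filter regularity speaks of families over all degrees, on which scalars act by a
  convolution sum. A single class placed in degree \<open>n\<close>, with zero in the second
  summand, reduces this to the one map that \<open>x\<close> induces from degree \<open>n\<close> to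
  degree \<open>n + 1\<close>.\<close>

lemma filter_regular_Ext_injective:
  assumes M: "module R M" and fg: "finitely_generated R M" and noeth: "noetherian_ring R"
    and \<omega>: "module R \<omega>" and I: "ideal I R" and x: "x \<in> I"
    and reg: "filter_regular (direct_sum (dual_Ext R I \<omega> M i) (dual_Ext R I \<omega> M j))
       (\<lambda>n. dual_Ext_grade R I \<omega> M i n \<times> dual_Ext_grade R I \<omega> M j n) (up_ring.monom (UP R) x 1)"
  shows "\<exists>n0. \<forall>n\<ge>n0. \<forall>h\<in>cocycles R M (adic_quotient R I \<omega> n) i.
    compose (carrier (resolution_module R M i)) (adic_mult R I \<omega> n 1 x) h
      \<in> coboundaries R M (adic_quotient R I \<omega> (n + 1)) i \<longrightarrow>
    h \<in> coboundaries R M (adic_quotient R I \<omega> n) i"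
proof -
  let ?G = "carrier (resolution_module R M i)"
  interpret M: fg_module R M by (intro fg_module.intro fg_module_axioms.intro M fg noeth)
  interpret A: adic R \<omega> I by (intro adic.intro adic_axioms.intro \<omega> I)
  interpret UP_ring R "UP R" by (simp add: UP_ring_def M.R.ring_axioms)
  define W where "W n = adic_quotient R I \<omega> n" for n
  have W: "module R (W n)" for n unfolding W_def by (rule A.adic_quotient_module)
  let ?B = "\<lambda>n. coboundaries R M (W n) i" and ?Z = "\<lambda>n. cocycles R M (W n) i"
    and ?C = "\<lambda>n. cochains R M (W n) i"
  have xR: "x \<in> carrier R" by (rule ideal.Icarr[OF I x])
  define y where "y = up_ring.monom (UP R) x 1"
  have coeff_y: "up_ring.coeff (UP R) y k = (if k = 1 then x else \<zero>\<^bsub>R\<^esub>)" for k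
    unfolding y_def using coeff_monom[OF xR, of 1 k] by auto
  have coeff_mem: "up_ring.coeff (UP R) y k \<in> ideal_power R I k" for k
    unfolding coeff_y using x M.R.ideal_power_1[OF I]
      additive_subgroup.zero_closed[OF ideal.axioms(1)[OF M.R.ideal_power_ideal[OF I]]] by auto
  define D where "D k = dual_Ext R I \<omega> M k" for k
  have piece: "dual_Ext_piece R I \<omega> M k n = Ext R k M (W n)" for k n by (simp add: dual_Ext_piece_def W_def)
  \<comment> \<open>The zero family, which fills the \<open>D j\<close> component; it is homogeneous
    of every degree.\<close>
  define z where "z k = (\<lambda>m. \<zero>\<^bsub>Ext R k M (W m)\<^esub>)" for k :: nat
  have z_grade: "z k \<in> dual_Ext_grade R I \<omega> M k n" for k n
    using M.Ext_zero_closed[OF W] by (simp add: z_def dual_Ext_grade_def dual_Ext_def piece)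
  obtain n0 where n0: "\<And>n. n \<ge> n0 \<Longrightarrow> inj_on (\<lambda>e. y \<odot>\<^bsub>direct_sum (D i) (D j)\<^esub> e)
      (dual_Ext_grade R I \<omega> M i n \<times> dual_Ext_grade R I \<omega> M j n)"
    using reg unfolding filter_regular_def y_def D_def by blast
  show ?thesis
  proof (intro exI[of _ n0] allI impI ballI)
    fix n h assume n: "n0 \<le> n" and "h \<in> cocycles R M (adic_quotient R I \<omega> n) i"
      and "compose ?G (adic_mult R I \<omega> n 1 x) h
        \<in> coboundaries R M (adic_quotient R I \<omega> (n + 1)) i"
    then have h: "h \<in> ?Z n"
      "compose ?G (adic_mult R I \<omega> n 1 x) h \<in> ?B (n + 1)"
      by (simp_all add: W_def)
    \<comment> \<open>A family concentrated in degree \<open>n\<close>, given by cocycle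
      representatives in every degree so that \<open>Ext_map\<close> can be evaluated on explicit
      cosets.\<close>
    define rep where "rep g m = (if m = n then g else \<zero>\<^bsub>?C m\<^esub>)" for g m
    define u where "u g m = ?B m +>\<^bsub>?C m\<^esub> rep g m" for g m
    have rep: "rep g m \<in> ?Z m" if "g \<in> ?Z n" for g m
      using that M.zero_cocycle(1)[OF W] by (simp add: rep_def)
    have u_car: "u g m \<in> carrier (Ext R i M (W m))" if "g \<in> ?Z n" for g m
      unfolding u_def using M.Ext_quotient_map(2)[OF W] rep[OF that] by blast
    have u_zero: "u g m = \<zero>\<^bsub>Ext R i M (W m)\<^esub>" if "g \<in> ?Z n" "m \<noteq> n" for g m
    proof -
      have "rep g m \<in> ?B m" using that(2) M.zero_cocycle(2)[OF W] by (simp add: rep_def)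
      then show ?thesis unfolding u_def using M.Ext_quotient_map(3)[OF W rep[OF that(1)]] by blast
    qed
    have u_grade: "u g \<in> dual_Ext_grade R I \<omega> M i n" if g: "g \<in> ?Z n" for g
    proof -
      have "finite {m. u g m \<noteq> \<zero>\<^bsub>Ext R i M (W m)\<^esub>}"
        by (rule finite_subset[of _ "{n}"]) (use u_zero[OF g] in auto)
      then show ?thesis using u_car[OF g] u_zero[OF g] by (simp add: dual_Ext_grade_def dual_Ext_def piece)
    qed
    \<comment> \<open>If \<open>x\<close> carries \<open>g\<close> to a coboundary, then
      \<open>x t\<close> kills the whole family: the term with \<open>k = 1\<close> and
      \<open>m = n + 1\<close> vanishes by assumption, every other one because the coefficient of
      \<open>y\<close> or the entry of the family is zero there.\<close>
    have y_u: "y \<odot>\<^bsub>D i\<^esub> u g = z i" if g: "g \<in> ?Z n"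
      "compose ?G (adic_mult R I \<omega> n 1 x) g \<in> ?B (n + 1)" for g
    proof
      fix m
      interpret E: surj_semilinear_map R R "(?C m)\<lparr>carrier := ?Z m\<rparr>" "Ext R i M (W m)" id
        "\<lambda>f. ?B m +>\<^bsub>?C m\<^esub> f" by (rule M.Ext_quotient_map(1)[OF W])
      have "Ext_map R i M (W m) (adic_mult R I \<omega> (m - k) k (up_ring.coeff (UP R) y k)) (u g (m - k)) = \<zero>\<^bsub>Ext R i M (W m)\<^esub>"
        if k: "k \<le> m" for k
      proof -
        have hom: "adic_mult R I \<omega> (m - k) k (up_ring.coeff (UP R) y k) \<in> module_hom R (W (m - k)) (W m)"
          using A.adic_mult_hom[OF coeff_mem[of k], of "m - k"] k by (simp add: W_def)
        have repC: "rep g (m - k) \<in> module_hom R (resolution_module R M i) (W (m - k))"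
          using rep[OF g(1)] by (simp add: cocycles_def M.carrier_cochains)
        have "compose ?G (adic_mult R I \<omega> (m - k) k (up_ring.coeff (UP R) y k)) (rep g (m - k))
            \<in> ?B m"
        proof (cases "k = 1 \<and> m - k = n")
          case True
          then have "m = n + 1" "m - k = n" "k = 1" using k by auto
          then show ?thesis using g(2) by (simp add: rep_def coeff_y)
        next
          case False
          have "compose ?G (adic_mult R I \<omega> (m - k) k (up_ring.coeff (UP R) y k)) (rep g (m - k))
            = \<zero>\<^bsub>?C m\<^esub>"
          proof (cases "m - k = n")
            case True
            then have "up_ring.coeff (UP R) y k = \<zero>\<^bsub>R\<^esub>" using False by (simp add: coeff_y)
            then have "adic_mult R I \<omega> (m - k) k (up_ring.coeff (UP R) y k) (rep g (m - k) v) = \<zero>\<^bsub>W m\<^esub>"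
              if "v \<in> ?G" for v
              using A.adic_mult_zero[of "rep g (m - k) v" "m - k" k] module_homD(1)[OF repC that] k
              by (simp add: W_def)
            then show ?thesis
              by (auto simp: compose_def cochains_def hom_module_def intro!: restrict_ext)
          next
            case False
            interpret hom: surj_semilinear_map R R "W (m - k)" "W m" id
              "adic_mult R I \<omega> (m - k) k (up_ring.coeff (UP R) y k)" by (rule module_hom_semilinear[OF W W hom])
            show ?thesis using False
              by (auto simp: rep_def compose_def cochains_def hom_module_def intro!: restrict_ext)
          qed
          then show ?thesis using M.zero_cocycle(2)[OF W] by simp
        qed
        then show ?thesis unfolding u_def by (rule M.Ext_map_zero[OF W W hom rep[OF g(1)]])
      qed
      then have "(\<Oplus>\<^bsub>Ext R i M (W m)\<^esub>k\<in>{..m}.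
          Ext_map R i M (W m) (adic_mult R I \<omega> (m - k) k (up_ring.coeff (UP R) y k)) (u g (m - k)))
          = (\<Oplus>\<^bsub>Ext R i M (W m)\<^esub>k\<in>{..m}. \<zero>\<^bsub>Ext R i M (W m)\<^esub>)"
        by (intro E.cod.M.finsum_cong') simp_all
      then show "(y \<odot>\<^bsub>D i\<^esub> u g) m = z i m"
        by (simp add: D_def dual_Ext_def piece z_def W_def[symmetric])
    qed
    have zh: "\<zero>\<^bsub>?C n\<^esub> \<in> ?Z n" by (rule M.zero_cocycle(1)[OF W])
    have "adic_mult R I \<omega> n 1 x \<in> module_hom R (W n) (W (n + 1))"
      unfolding W_def using x M.R.ideal_power_1[OF I] by (intro A.adic_mult_hom) simp
    then have "compose ?G (adic_mult R I \<omega> n 1 x) \<zero>\<^bsub>?C n\<^esub>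
        \<in> ?B (n + 1)"
      by (rule M.compose_coboundaries[OF W W _ M.zero_cocycle(2)[OF W]])
    then have "y \<odot>\<^bsub>D i\<^esub> u h = y \<odot>\<^bsub>D i\<^esub> u \<zero>\<^bsub>?C n\<^esub>"
      using y_u[OF h] y_u[OF zh] by simp
    \<comment> \<open>The families of \<open>h\<close> and of the zero cocycle have the same image
      under \<open>x t\<close>, so injectivity on the part of degree \<open>n\<close> identifies
      them.\<close>
    then have "y \<odot>\<^bsub>direct_sum (D i) (D j)\<^esub> (u h, z j) = y \<odot>\<^bsub>direct_sum (D i) (D j)\<^esub> (u \<zero>\<^bsub>?C n\<^esub>, z j)"
      by (simp add: direct_sum_def)
    then have "(u h, z j) = (u \<zero>\<^bsub>?C n\<^esub>, z j)"
      by (rule inj_onD[OF n0[OF n]]) (use u_grade[OF h(1)] u_grade[OF zh] z_grade in auto)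
    then have "u h n = u \<zero>\<^bsub>?C n\<^esub> n" by simp
    then have "?B n +>\<^bsub>?C n\<^esub> h
        = ?B n +>\<^bsub>?C n\<^esub> \<zero>\<^bsub>?C n\<^esub>"
      by (simp add: u_def rep_def)
    also have "\<dots> = \<zero>\<^bsub>Ext R i M (W n)\<^esub>"
      using M.Ext_quotient_map(3)[OF W zh] M.zero_cocycle(2)[OF W] by blast
    finally show "h \<in> coboundaries R M (adic_quotient R I \<omega> n) i"
      using M.Ext_quotient_map(3)[OF W h(1)] unfolding W_def by blast
  qed
qed

section \<open>Homomorphisms into a short exact sequence\<close>

text \<open>The sequence \<open>0 \<rightarrow> Hom_R(M, W) \<rightarrow> Hom_R(M, W') \<rightarrow>
  Hom_S(N, V) \<rightarrow> 0\<close> is exact. Its right-hand map \<open>\<Gamma>\<close> goes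
  straight to \<open>S\<close>-homomorphisms out of \<open>N = M/KM\<close>; it is onto because
  homomorphisms \<open>M \<rightarrow> V\<close> lift along \<open>p\<close>.\<close>

lemma hom_module_length_add:
  assumes noeth: "noetherian_ring R" and M: "module R M" and fg: "finitely_generated R M"
    and \<phi>: "\<phi> \<in> module_hom R W W'" and W: "module R W" and inj: "inj_on \<phi> (carrier W)"
    and p: "surj_semilinear_map R S W' V \<pi> p" and surj: "p ` carrier W' = carrier V"
    and exact: "\<And>w. w \<in> carrier W' \<Longrightarrow> p w = \<zero>\<^bsub>V\<^esub> \<longleftrightarrow> w \<in> \<phi> ` carrier W"
    and ext: "\<And>h. \<lbrakk>h \<in> cocycles R M W 1;
        compose (carrier (resolution_module R M 1)) \<phi> h \<in> coboundaries R M W' 1\<rbrakk>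
      \<Longrightarrow> h \<in> coboundaries R M W 1"
    and q: "surj_semilinear_map R S M N \<pi> q" and q_surj: "q ` carrier M = carrier N"
    and K: "K \<subseteq> carrier R" "\<And>a. a \<in> K \<Longrightarrow> \<pi> a = \<zero>\<^bsub>S\<^esub>"
      "\<And>m. m \<in> carrier M \<Longrightarrow> q m = \<zero>\<^bsub>N\<^esub> \<Longrightarrow> m \<in> ideal_smult R K M"
  shows "module_length R (hom_module R M W')
    = module_length R (hom_module R M W) + module_length S (hom_module S N V)"
proof -
  interpret p: surj_semilinear_map R S W' V \<pi> p by fact
  interpret q: surj_semilinear_map R S M N \<pi> q by fact
  interpret \<phi>: surj_semilinear_map R R W W' id \<phi> by (rule module_hom_semilinear[OF W p.dom.module_axioms \<phi>])
  have hN: "module S N" and hV: "module S V" and W': "module R W'"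
    by (rule q.cod.module_axioms p.cod.module_axioms p.dom.module_axioms)+
  define A B C where "A = hom_module R M W" and "B = hom_module R M W'" and "C = hom_module S N V"
  have carr: "carrier A = module_hom R M W" "carrier B = module_hom R M W'" "carrier C = module_hom S N V"
    by (simp_all add: A_def B_def C_def carrier_hom_module)
  have "\<exists>k\<in>module_hom S N V. \<forall>m\<in>carrier M. k (q m) = p (h m)" if h: "h \<in> module_hom R M W'" for h
  proof -
    interpret h: surj_semilinear_map R R M W' id h by (rule module_hom_semilinear[OF M W' h])
    have ph: "semilinear_map R S M V \<pi> (\<lambda>m. p (h m))"
      by (intro semilinear_map.intro semilinear_map_axioms.intro M hV p.ring_hom)
        (simp_all add: h.hom_add h.hom_smult p.hom_add p.hom_smult)
    interpret ph: semilinear_map R S M V \<pi> "\<lambda>m. p (h m)" by (rule ph)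
    \<comment> \<open>\<open>K\<close> acts as zero on the \<open>S\<close>-module \<open>V\<close>,
      so \<open>p \<circ> h\<close> kills \<open>KM\<close> and factors through
      \<open>N\<close>.\<close>
    have "ideal_smult R K M \<subseteq> {m \<in> carrier M. p (h m) = \<zero>\<^bsub>V\<^esub>}"
    proof (rule ideal_smult_least[OF ph.kernel_submodule])
      fix a m assume a: "a \<in> K" and m: "m \<in> carrier M"
      then have "p (h (a \<odot>\<^bsub>M\<^esub> m)) = \<zero>\<^bsub>V\<^esub>" using K(1,2) ph.hom_smult[of a m] by auto
      then show "a \<odot>\<^bsub>M\<^esub> m \<in> {m \<in> carrier M. p (h m) = \<zero>\<^bsub>V\<^esub>}" using a m K(1) by auto
    qed
    then have ker: "p (h m) = \<zero>\<^bsub>V\<^esub>" if "m \<in> carrier M" "q m = \<zero>\<^bsub>N\<^esub>" for m using K(3)[OF that] by blast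
    have "\<exists>k. semilinear_map S S N V id k \<and> (\<forall>m\<in>carrier M. k (q m) = p (h m))"
      by (rule semilinear_factor[OF q q_surj ph id_ring_hom _ ker]) simp_all
    then obtain k where k: "semilinear_map S S N V id k" "\<forall>m\<in>carrier M. k (q m) = p (h m)" by blast
    show ?thesis
      by (intro bexI[OF _ semilinear_module_hom[OF k(1)]]) (simp add: k(2))
  qed
  \<comment> \<open>\<open>\<Gamma> h\<close> is pinned down by its values at \<open>q m\<close>,
    since \<open>q\<close> is onto; semilinearity of \<open>\<Gamma>\<close> is therefore inherited
    from \<open>p\<close>.\<close>
  then obtain \<Gamma> where \<Gamma>: "\<And>h. h \<in> module_hom R M W' \<Longrightarrow> \<Gamma> h \<in> module_hom S N V"
    "\<And>h m. h \<in> module_hom R M W' \<Longrightarrow> m \<in> carrier M \<Longrightarrow> \<Gamma> h (q m) = p (h m)"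
    by metis
  have eqI: "k = l" if "k \<in> module_hom S N V" "l \<in> module_hom S N V" "\<And>m. m \<in> carrier M \<Longrightarrow> k (q m) = l (q m)" for k l
  proof (rule module_hom_eqI[OF that(1,2)])
    fix n assume "n \<in> carrier N"
    then obtain m where "m \<in> carrier M" "n = q m" unfolding q_surj[symmetric] by (elim imageE)
    then show "k n = l n" using that(3) by simp
  qed
  interpret A: module R A unfolding A_def by (rule hom_module_module[OF M W])
  interpret B: module R B unfolding B_def by (rule hom_module_module[OF M W'])
  interpret C: module S C unfolding C_def by (rule hom_module_module[OF hN hV])
  have \<Gamma>_lin: "surj_semilinear_map R S B C \<pi> \<Gamma>"
  proof (intro surj_semilinear_map.intro semilinear_map.intro semilinear_map_axioms.intro
      surj_semilinear_map_axioms.intro B.module_axioms C.module_axioms p.ring_hom p.scalar_surj)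
    fix h assume h: "h \<in> carrier B"
    then show "\<Gamma> h \<in> carrier C" unfolding carr by (rule \<Gamma>(1))
    { fix h' assume h': "h' \<in> carrier B"
      have hh: "h \<oplus>\<^bsub>B\<^esub> h' \<in> module_hom R M W'" using h h' B.M.a_closed unfolding carr by blast
      have GG: "\<Gamma> h \<oplus>\<^bsub>C\<^esub> \<Gamma> h' \<in> module_hom S N V"
        using \<Gamma>(1) h h' C.M.a_closed[of "\<Gamma> h" "\<Gamma> h'"] unfolding carr by blast
      show "\<Gamma> (h \<oplus>\<^bsub>B\<^esub> h') = \<Gamma> h \<oplus>\<^bsub>C\<^esub> \<Gamma> h'"
      proof (rule eqI[OF \<Gamma>(1)[OF hh] GG])
        fix m assume m: "m \<in> carrier M"
        have "h m \<in> carrier W'" "h' m \<in> carrier W'"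
          by (rule module_homD(1)[OF h[unfolded carr] m] module_homD(1)[OF h'[unfolded carr] m])+
        then show "\<Gamma> (h \<oplus>\<^bsub>B\<^esub> h') (q m) = (\<Gamma> h \<oplus>\<^bsub>C\<^esub> \<Gamma> h') (q m)"
          using h[unfolded carr] h'[unfolded carr] m unfolding \<Gamma>(2)[OF hh m] unfolding B_def C_def
          by (simp add: hom_module_apply \<Gamma>(2) p.hom_add)
      qed }
    { fix a assume a: "a \<in> carrier R"
      have ah: "a \<odot>\<^bsub>B\<^esub> h \<in> module_hom R M W'" using a h B.smult_closed unfolding carr by blast
      have aG: "\<pi> a \<odot>\<^bsub>C\<^esub> \<Gamma> h \<in> module_hom S N V"
        using \<Gamma>(1) h a C.smult_closed[of "\<pi> a" "\<Gamma> h"] unfolding carr by simp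
      show "\<Gamma> (a \<odot>\<^bsub>B\<^esub> h) = \<pi> a \<odot>\<^bsub>C\<^esub> \<Gamma> h"
      proof (rule eqI[OF \<Gamma>(1)[OF ah] aG])
        fix m assume m: "m \<in> carrier M"
        have "h m \<in> carrier W'" by (rule module_homD(1)[OF h[unfolded carr] m])
        then show "\<Gamma> (a \<odot>\<^bsub>B\<^esub> h) (q m) = (\<pi> a \<odot>\<^bsub>C\<^esub> \<Gamma> h) (q m)"
          using h[unfolded carr] m a unfolding \<Gamma>(2)[OF ah m] unfolding B_def C_def
          by (simp add: hom_module_apply \<Gamma>(2) p.hom_smult)
      qed }
  qed
  have \<Phi>: "surj_semilinear_map R R A B id (\<lambda>f. compose (carrier M) \<phi> f)"
    unfolding A_def B_def by (rule hom_module_compose_linear[OF M W W' \<phi>])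
  show ?thesis
    unfolding A_def[symmetric] B_def[symmetric] C_def[symmetric]
  proof (rule module_length_add[OF \<Phi> \<Gamma>_lin])
    show "inj_on (compose (carrier M) \<phi>) (carrier A)"
    proof (rule inj_onI)
      fix f g assume f: "f \<in> carrier A" and g: "g \<in> carrier A" and eq: "compose (carrier M) \<phi> f = compose (carrier M) \<phi> g"
      show "f = g"
      proof (rule module_hom_eqI[OF f[unfolded carr] g[unfolded carr]])
        fix m assume m: "m \<in> carrier M"
        have "\<phi> (f m) = \<phi> (g m)" using fun_cong[OF eq, of m] m by (simp add: compose_def)
        then show "f m = g m"
          by (rule inj_onD[OF inj]) (rule module_homD(1)[OF f[unfolded carr] m] module_homD(1)[OF g[unfolded carr] m])+
      qed
    qed
    show "compose (carrier M) \<phi> ` carrier A = {h \<in> carrier B. \<Gamma> h = \<zero>\<^bsub>C\<^esub>}"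
    proof (intro equalityI subsetI)
      fix h assume "h \<in> compose (carrier M) \<phi> ` carrier A"
      then obtain f where f: "f \<in> module_hom R M W" "h = compose (carrier M) \<phi> f" unfolding carr by (elim imageE)
      have h: "h \<in> module_hom R M W'" unfolding f(2) by (rule module_hom_compose[OF M f(1) \<phi>])
      have "\<Gamma> h = \<zero>\<^bsub>C\<^esub>"
      proof (rule eqI[OF \<Gamma>(1)[OF h]])
        show "\<zero>\<^bsub>C\<^esub> \<in> module_hom S N V" using C.M.zero_closed unfolding carr .
        fix m assume m: "m \<in> carrier M"
        have "h m \<in> carrier W'" by (rule module_homD(1)[OF h m])
        moreover have "h m \<in> \<phi> ` carrier W" using m module_homD(1)[OF f(1) m] by (simp add: f(2) compose_def)
        ultimately show "\<Gamma> h (q m) = \<zero>\<^bsub>C\<^esub> (q m)"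
          using exact m by (simp add: \<Gamma>(2)[OF h m] C_def hom_module_apply)
      qed
      then show "h \<in> {h \<in> carrier B. \<Gamma> h = \<zero>\<^bsub>C\<^esub>}" using h by (simp add: carr)
    next
      fix h assume "h \<in> {h \<in> carrier B. \<Gamma> h = \<zero>\<^bsub>C\<^esub>}"
      then have h: "h \<in> module_hom R M W'" "\<Gamma> h = \<zero>\<^bsub>C\<^esub>" by (simp_all add: carr)
      have "h m \<in> \<phi> ` carrier W" if m: "m \<in> carrier M" for m
      proof -
        have "p (h m) = \<zero>\<^bsub>V\<^esub>" using \<Gamma>(2)[OF h(1) m] m by (simp add: h(2) C_def hom_module_apply)
        then show ?thesis using exact module_homD(1)[OF h(1) m] by blast
      qed
      then obtain f where f: "f \<in> module_hom R M W" "\<forall>m\<in>carrier M. \<phi> (f m) = h m"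
        using module_hom_corestrict[OF M \<phi>.surj_semilinear_map_axioms inj h(1)] by blast
      have "h = compose (carrier M) \<phi> f"
        by (rule module_hom_eqI[OF h(1) module_hom_compose[OF M f(1) \<phi>]]) (simp add: compose_def f(2))
      then show "h \<in> compose (carrier M) \<phi> ` carrier A" using f(1) unfolding carr by blast
    qed
    show "\<Gamma> ` carrier B = carrier C"
    proof (intro equalityI subsetI)
      fix k assume "k \<in> \<Gamma> ` carrier B"
      then show "k \<in> carrier C" using \<Gamma>(1) unfolding carr by blast
    next
      fix k assume "k \<in> carrier C"
      then have k: "k \<in> module_hom S N V" by (simp add: carr)
      interpret k: surj_semilinear_map S S N V id k by (rule module_hom_semilinear[OF hN hV k])
      have kq: "semilinear_map R S M V \<pi> (\<lambda>m. k (q m))"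
        by (intro semilinear_map.intro semilinear_map_axioms.intro M hV p.ring_hom)
          (simp_all add: k.hom_add k.hom_smult q.hom_add q.hom_smult)
      obtain g where g: "g \<in> module_hom R M W'" "\<And>m. m \<in> carrier M \<Longrightarrow> p (g m) = k (q m)"
        using module_hom_lift[OF noeth M fg \<phi>.surj_semilinear_map_axioms inj p.semilinear_map_axioms surj exact ext kq]
        by metis
      have "\<Gamma> g = k" by (rule eqI[OF \<Gamma>(1)[OF g(1)] k]) (simp add: \<Gamma>(2)[OF g(1)] g(2))
      then show "k \<in> \<Gamma> ` carrier B" using g(1) unfolding carr by blast
    qed
  qed
qed

section \<open>Reduction modulo \<open>x\<close>\<close>

lemma ideal_prod_image:
  assumes "\<pi> \<in> ring_hom R S" "I \<subseteq> carrier R" "K \<subseteq> carrier R" "ring R"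
  shows "ideal_prod S (\<pi> ` I) (\<pi> ` K) = \<pi> ` ideal_prod R I K"
proof -
  interpret ring R by fact
  have cl: "s \<in> carrier R" if "s \<in> ideal_prod R I K" for s
    using that by induction (use assms(2,3) in auto)
  show ?thesis
  proof (intro equalityI subsetI)
    fix s assume "s \<in> ideal_prod S (\<pi> ` I) (\<pi> ` K)"
    then show "s \<in> \<pi> ` ideal_prod R I K"
    proof induction
      case (prod i j)
      then obtain a b where ab: "a \<in> I" "b \<in> K" "i = \<pi> a" "j = \<pi> b" by blast
      then have "\<pi> (a \<otimes>\<^bsub>R\<^esub> b) = i \<otimes>\<^bsub>S\<^esub> j" using ring_hom_mult[OF assms(1)] assms(2,3) by (simp add: subset_iff)
      then show ?case using ideal_prod.prod[OF ab(1,2), of R] by (metis imageI)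
    next
      case (sum s t)
      then obtain a b where ab: "a \<in> ideal_prod R I K" "b \<in> ideal_prod R I K" "s = \<pi> a" "t = \<pi> b" by blast
      then have "\<pi> (a \<oplus>\<^bsub>R\<^esub> b) = s \<oplus>\<^bsub>S\<^esub> t" using ring_hom_add[OF assms(1)] cl by simp
      then show ?case using ideal_prod.sum[OF ab(1,2)] by (metis imageI)
    qed
  next
    fix s assume "s \<in> \<pi> ` ideal_prod R I K"
    then obtain a where a: "a \<in> ideal_prod R I K" "s = \<pi> a" by blast
    have "\<pi> a \<in> ideal_prod S (\<pi> ` I) (\<pi> ` K)"
      using a(1)
    proof induction
      case (prod i j)
      then show ?case
        using ring_hom_mult[OF assms(1), of i j] assms(2,3) ideal_prod.prod[of "\<pi> i" "\<pi> ` I" "\<pi> j" "\<pi> ` K" S]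
        by (simp add: subset_iff)
    next
      case (sum s t)
      then show ?case using ring_hom_add[OF assms(1)] cl ideal_prod.sum by metis
    qed
    then show "s \<in> ideal_prod S (\<pi> ` I) (\<pi> ` K)" using a(2) by simp
  qed
qed

text \<open>Products of ideals map to products under any ring homomorphism; surjectivity of
  \<open>\<pi>\<close> enters at exponent \<open>0\<close>, where the power is the whole
  ring.\<close>

lemma ideal_power_image:
  assumes \<pi>: "\<pi> \<in> ring_hom R S" "\<pi> ` carrier R = carrier S" and I: "ideal I R" and R: "cring R"
  shows "ideal_power S (\<pi> ` I) n = \<pi> ` ideal_power R I n"
proof (induction n)
  case 0
  show ?case using \<pi>(2) by simp
next
  case (Suc n)
  interpret cring R by fact
  have "I \<subseteq> carrier R" "ideal_power R I n \<subseteq> carrier R"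
    using ideal_power_ideal[OF I] I by (simp_all add: additive_subgroup.a_subset ideal.axioms(1))
  then show ?case using Suc ideal_prod_image[OF \<pi>(1) _ _ ring_axioms] by simp
qed

lemma (in module) ideal_smult_cgenideal:
  assumes x: "x \<in> carrier R" and v: "v \<in> ideal_smult R (cgenideal R x) M"
  shows "\<exists>w\<in>carrier M. v = x \<odot>\<^bsub>M\<^esub> w"
proof -
  interpret mx: surj_semilinear_map R R M M id "\<lambda>v. x \<odot>\<^bsub>M\<^esub> v" by (rule smult_map[OF x])
  have "ideal_smult R (cgenideal R x) M \<subseteq> (\<lambda>v. x \<odot>\<^bsub>M\<^esub> v) ` carrier M"
  proof (rule ideal_smult_least[OF mx.image_submodule[OF carrier_is_submodule]])
    fix a v assume "a \<in> cgenideal R x" and v: "v \<in> carrier M"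
    then obtain r where r: "r \<in> carrier R" "a = r \<otimes> x" unfolding cgenideal_def by blast
    have "a \<odot>\<^bsub>M\<^esub> v = x \<odot>\<^bsub>M\<^esub> (r \<odot>\<^bsub>M\<^esub> v)" unfolding r(2) using r(1) x v by (simp add: smult_assoc1 smult_commute)
    then show "a \<odot>\<^bsub>M\<^esub> v \<in> (\<lambda>v. x \<odot>\<^bsub>M\<^esub> v) ` carrier M" using r(1) v by blast
  qed
  then show ?thesis using v by blast
qed

text \<open>The exact sequence used is \<open>\<omega>/I^n \<omega> \<rightarrow> \<omega>/I^(n+1)
  \<omega> \<rightarrow> \<omega>_S/J^(n+1) \<omega>_S\<close>. The hypothesis \<open>colon\<close>
  is injectivity of multiplication by \<open>x\<close>, whose image
  \<open>(x \<omega> + I^(n+1) \<omega>)/I^(n+1) \<omega>\<close> is the kernel of the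
  projection.\<close>

lemma hom_adic_length_add:
  fixes R (structure)
  assumes noeth: "noetherian_ring R" and M: "module R M" and fg: "finitely_generated R M"
    and \<omega>: "module R \<omega>" and I: "ideal I R" and x: "x \<in> I"
    and colon: "\<And>v. v \<in> carrier \<omega> \<Longrightarrow> x \<odot>\<^bsub>\<omega>\<^esub> v \<in> ideal_smult R (ideal_power R I (Suc n)) \<omega>
      \<Longrightarrow> v \<in> ideal_smult R (ideal_power R I n) \<omega>"
    and ext: "\<And>h. \<lbrakk>h \<in> cocycles R M (adic_quotient R I \<omega> n) 1;
      compose (carrier (resolution_module R M 1)) (adic_mult R I \<omega> n 1 x) h
        \<in> coboundaries R M (adic_quotient R I \<omega> (n + 1)) 1\<rbrakk>
      \<Longrightarrow> h \<in> coboundaries R M (adic_quotient R I \<omega> n) 1"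
  shows "module_length R (hom_module R M (adic_quotient R I \<omega> (n + 1)))
    = module_length R (hom_module R M (adic_quotient R I \<omega> n))
    + module_length (R Quot cgenideal R x) (hom_module (R Quot cgenideal R x) (reduction R (cgenideal R x) M)
        (adic_quotient (R Quot cgenideal R x) ((\<lambda>a. cgenideal R x +>\<^bsub>R\<^esub> a) ` I) (reduction R (cgenideal R x) \<omega>) (n + 1)))"
proof -
  interpret \<omega>: module R \<omega> by fact
  interpret A: adic R \<omega> I by (intro adic.intro adic_axioms.intro \<omega> I)
  define X where "X = cgenideal R x"
  define S where "S = R Quot X"
  define \<pi> where "\<pi> = (\<lambda>a. X +>\<^bsub>R\<^esub> a)"
  define J where "J = \<pi> ` I"
  define \<omega>S where "\<omega>S = reduction R X \<omega>"
  define N where "N = reduction R X M"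
  have xR: "x \<in> carrier R" by (rule ideal.Icarr[OF I x])
  have X: "ideal X R" unfolding X_def by (rule \<omega>.R.cgenideal_ideal[OF xR])
  have XR: "X \<subseteq> carrier R" using X by (simp add: additive_subgroup.a_subset ideal.axioms(1))
  define q where "q = (\<lambda>v. ideal_smult R X \<omega> +>\<^bsub>\<omega>\<^esub> v)"
  define qM where "qM = (\<lambda>v. ideal_smult R X M +>\<^bsub>M\<^esub> v)"
  interpret q: surj_semilinear_map R S \<omega> \<omega>S \<pi> q
    unfolding S_def \<omega>S_def \<pi>_def q_def by (rule \<omega>.reduction_map[OF X])
  interpret qM: surj_semilinear_map R S M N \<pi> qM
    unfolding S_def N_def \<pi>_def qM_def by (rule module.reduction_map[OF M X])
  have q_surj: "q ` carrier \<omega> = carrier \<omega>S" "qM ` carrier M = carrier N"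
    by (simp_all add: q_def qM_def \<omega>S_def N_def carrier_reduction)
  have \<pi>_zero: "\<pi> a = \<zero>\<^bsub>S\<^esub>" if "a \<in> X" for a
    using abelian_subgroup.a_rcos_const[OF abelian_subgroupI3[OF ideal.axioms(1)[OF X] \<omega>.R.abelian_group_axioms] that]
    by (simp add: \<pi>_def S_def FactRing_def)
  have xX: "x \<in> X" unfolding X_def by (rule \<omega>.R.cgenideal_self[OF xR])
  \<comment> \<open>The image of \<open>I^(n+1) \<omega>\<close> in
    \<open>\<omega>/x \<omega>\<close>; it is the submodule that defines \<open>V\<close>, because
    powers of \<open>J\<close> are images of powers of \<open>I\<close>.\<close>
  define F where "F = q ` A.filt (n + 1)"
  have F: "submodule F S \<omega>S" unfolding F_def by (rule q.image_submodule[OF A.filt_submodule])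
  have F_eq: "ideal_smult S (ideal_power S J (n + 1)) \<omega>S = F"
    unfolding F_def J_def ideal_power_image[OF q.ring_hom q.scalar_surj I \<omega>.R.cring_axioms]
    by (rule q.image_ideal_smult[OF A.power_subset q_surj(1), symmetric])
  define V where "V = adic_quotient S J \<omega>S (n + 1)"
  have V: "V = quot_module \<omega>S F" unfolding V_def adic_quotient_def F_eq by (rule refl)
  interpret r: surj_semilinear_map S S \<omega>S V id "\<lambda>u. F +>\<^bsub>\<omega>S\<^esub> u"
    unfolding V by (rule q.cod.quot_module_map[OF F])
  define W W' where "W = adic_quotient R I \<omega> n" and "W' = adic_quotient R I \<omega> (n + 1)"
  interpret w: surj_semilinear_map R R \<omega> W id "\<lambda>w. A.filt n +>\<^bsub>\<omega>\<^esub> w" unfolding W_def by (rule A.adic_quotient_map)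
  interpret w': surj_semilinear_map R R \<omega> W' id "\<lambda>w. A.filt (n + 1) +>\<^bsub>\<omega>\<^esub> w" unfolding W'_def by (rule A.adic_quotient_map)
  have W_surj: "(\<lambda>w. A.filt n +>\<^bsub>\<omega>\<^esub> w) ` carrier \<omega> = carrier W" "(\<lambda>w. A.filt (n + 1) +>\<^bsub>\<omega>\<^esub> w) ` carrier \<omega> = carrier W'"
    unfolding W_def W'_def A.carrier_adic_quotient by (rule refl)+
  have p0: "semilinear_map R S \<omega> V \<pi> (\<lambda>v. F +>\<^bsub>\<omega>S\<^esub> q v)"
    by (intro semilinear_map.intro semilinear_map_axioms.intro \<omega> r.cod.module_axioms q.ring_hom)
      (simp_all add: q.hom_add q.hom_smult r.hom_add r.hom_smult)
  have p0_kernel: "F +>\<^bsub>\<omega>S\<^esub> q v = \<zero>\<^bsub>V\<^esub> \<longleftrightarrow> q v \<in> F" if "v \<in> carrier \<omega>" for v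
    unfolding V by (rule q.cod.quot_module_kernel[OF F]) (use that in simp)
  \<comment> \<open>The projection onto \<open>V\<close> is defined on \<open>\<omega>\<close>
    itself and descends because it sends \<open>I^(n+1) \<omega>\<close> into
    \<open>F\<close>.\<close>
  have "\<exists>p. semilinear_map R S W' V \<pi> p \<and> (\<forall>v\<in>carrier \<omega>. p (A.filt (n + 1) +>\<^bsub>\<omega>\<^esub> v) = F +>\<^bsub>\<omega>S\<^esub> q v)"
  proof (rule semilinear_factor[OF w'.surj_semilinear_map_axioms W_surj(2) p0 q.ring_hom])
    fix v assume v: "v \<in> carrier \<omega>" "A.filt (n + 1) +>\<^bsub>\<omega>\<^esub> v = \<zero>\<^bsub>W'\<^esub>"
    then have "v \<in> A.filt (n + 1)" using A.adic_quotient_kernel unfolding W'_def by blast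
    then have "q v \<in> F" unfolding F_def by blast
    then show "F +>\<^bsub>\<omega>S\<^esub> q v = \<zero>\<^bsub>V\<^esub>" using p0_kernel[OF v(1)] by blast
  qed simp
  then obtain p where p: "semilinear_map R S W' V \<pi> p" "\<forall>v\<in>carrier \<omega>. p (A.filt (n + 1) +>\<^bsub>\<omega>\<^esub> v) = F +>\<^bsub>\<omega>S\<^esub> q v"
    by blast
  have psurj: "p ` carrier W' = carrier V"
  proof -
    have "p ` carrier W' = (\<lambda>v. F +>\<^bsub>\<omega>S\<^esub> q v) ` carrier \<omega>"
      unfolding W_surj(2)[symmetric] image_image by (rule image_cong[OF refl]) (rule p(2)[rule_format])
    also have "\<dots> = (\<lambda>u. F +>\<^bsub>\<omega>S\<^esub> u) ` carrier \<omega>S" unfolding q_surj(1)[symmetric] image_image by (rule refl)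
    also have "\<dots> = carrier V" unfolding V carrier_quot_module by (rule refl)
    finally show ?thesis .
  qed
  define \<phi> where "\<phi> = adic_mult R I \<omega> n 1 x"
  have x1: "x \<in> ideal_power R I 1" using x \<omega>.R.ideal_power_1[OF I] by simp
  have \<phi>: "\<phi> \<in> module_hom R W W'" unfolding \<phi>_def W_def W'_def by (rule A.adic_mult_hom[OF x1])
  have \<phi>_coset: "\<phi> (A.filt n +>\<^bsub>\<omega>\<^esub> v) = A.filt (n + 1) +>\<^bsub>\<omega>\<^esub> (x \<odot>\<^bsub>\<omega>\<^esub> v)" if "v \<in> carrier \<omega>" for v
    unfolding \<phi>_def by (rule A.adic_mult_coset[OF x1 that])
  interpret \<phi>: surj_semilinear_map R R W W' id \<phi>
    by (rule module_hom_semilinear[OF w.cod.module_axioms w'.cod.module_axioms \<phi>])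
  have inj: "inj_on \<phi> (carrier W)"
  proof (rule \<phi>.inj_onI_kernel)
    fix Y assume Y: "Y \<in> carrier W" "\<phi> Y = \<zero>\<^bsub>W'\<^esub>"
    obtain v where v: "v \<in> carrier \<omega>" "Y = A.filt n +>\<^bsub>\<omega>\<^esub> v" using Y(1) unfolding W_surj(1)[symmetric] by (elim imageE)
    have xv: "x \<odot>\<^bsub>\<omega>\<^esub> v \<in> carrier \<omega>" using xR v(1) by simp
    have "x \<odot>\<^bsub>\<omega>\<^esub> v \<in> A.filt (n + 1)"
      using Y(2) A.adic_quotient_kernel[OF xv] unfolding v(2) \<phi>_coset[OF v(1)] W'_def by blast
    then have "v \<in> A.filt n" using colon[OF v(1)] by simp
    then show "Y = \<zero>\<^bsub>W\<^esub>" unfolding v(2) W_def using A.adic_quotient_kernel[OF v(1)] by blast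
  qed
  have exact: "p w = \<zero>\<^bsub>V\<^esub> \<longleftrightarrow> w \<in> \<phi> ` carrier W" if w: "w \<in> carrier W'" for w
  proof
    obtain u where u: "u \<in> carrier \<omega>" "w = A.filt (n + 1) +>\<^bsub>\<omega>\<^esub> u"
      using w unfolding W_surj(2)[symmetric] by (elim imageE)
    assume "p w = \<zero>\<^bsub>V\<^esub>"
    then have "F +>\<^bsub>\<omega>S\<^esub> q u = \<zero>\<^bsub>V\<^esub>" unfolding u(2) p(2)[rule_format, OF u(1)] .
    then have "q u \<in> F" using p0_kernel[OF u(1)] by blast
    then obtain f where f: "f \<in> A.filt (n + 1)" "q u = q f" unfolding F_def by (elim imageE)
    have f\<omega>: "f \<in> carrier \<omega>" using f(1) \<omega>.submoduleE(1)[OF A.filt_submodule] by blast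
    \<comment> \<open>\<open>u\<close> and some \<open>f \<in> I^(n+1) \<omega>\<close> agree modulo
      \<open>x \<omega>\<close>, so \<open>u = f + x v\<close>, and modulo
      \<open>I^(n+1) \<omega>\<close> only \<open>x v\<close> is left.\<close>
    have "q (u \<ominus>\<^bsub>\<omega>\<^esub> f) = \<zero>\<^bsub>\<omega>S\<^esub>" using q.eq_iff_minus_kernel[OF u(1) f\<omega>] f(2) by blast
    then have "u \<ominus>\<^bsub>\<omega>\<^esub> f \<in> ideal_smult R X \<omega>"
      unfolding q_def \<omega>S_def using \<omega>.reduction_kernel[OF XR, of "u \<ominus>\<^bsub>\<omega>\<^esub> f"] u(1) f\<omega> by simp
    then obtain v where v: "v \<in> carrier \<omega>" "u \<ominus>\<^bsub>\<omega>\<^esub> f = x \<odot>\<^bsub>\<omega>\<^esub> v"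
      unfolding X_def using \<omega>.ideal_smult_cgenideal[OF xR] by blast
    have xv: "x \<odot>\<^bsub>\<omega>\<^esub> v \<in> carrier \<omega>" using xR v(1) by simp
    have "u = f \<oplus>\<^bsub>\<omega>\<^esub> (x \<odot>\<^bsub>\<omega>\<^esub> v)" using \<omega>.minus_add_cancel(2)[OF u(1) f\<omega>] v(2) by simp
    then have "u \<ominus>\<^bsub>\<omega>\<^esub> (x \<odot>\<^bsub>\<omega>\<^esub> v) = f" using \<omega>.add_minus_cancel[OF f\<omega> xv] by simp
    then have "A.filt (n + 1) +>\<^bsub>\<omega>\<^esub> u = A.filt (n + 1) +>\<^bsub>\<omega>\<^esub> (x \<odot>\<^bsub>\<omega>\<^esub> v)"
      using \<omega>.coset_eq_iff[OF A.filt_submodule u(1) xv] f(1) by blast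
    then have "w = \<phi> (A.filt n +>\<^bsub>\<omega>\<^esub> v)" unfolding u(2) \<phi>_coset[OF v(1)] .
    then show "w \<in> \<phi> ` carrier W" using v(1) W_surj(1) by blast
  next
    assume "w \<in> \<phi> ` carrier W"
    then obtain Y where "Y \<in> carrier W" "w = \<phi> Y" by (elim imageE)
    then obtain v where v: "v \<in> carrier \<omega>" "w = \<phi> (A.filt n +>\<^bsub>\<omega>\<^esub> v)" unfolding W_surj(1)[symmetric] by blast
    have "p w = F +>\<^bsub>\<omega>S\<^esub> q (x \<odot>\<^bsub>\<omega>\<^esub> v)"
      unfolding v(2) \<phi>_coset[OF v(1)] by (rule p(2)[rule_format]) (use v(1) xR in simp)
    \<comment> \<open>\<open>x\<close> becomes zero in \<open>S\<close> and so annihilates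
      \<open>V\<close>.\<close>
    also have "\<dots> = \<pi> x \<odot>\<^bsub>V\<^esub> (F +>\<^bsub>\<omega>S\<^esub> q v)"
      using v(1) xR by (simp add: q.hom_smult r.hom_smult)
    also have "\<dots> = \<zero>\<^bsub>V\<^esub>" using v(1) by (simp add: \<pi>_zero[OF xX])
    finally show "p w = \<zero>\<^bsub>V\<^esub>" .
  qed
  have "module_length R (hom_module R M W')
    = module_length R (hom_module R M W) + module_length S (hom_module S N V)"
  proof (rule hom_module_length_add[OF noeth M fg \<phi> w.cod.module_axioms inj _ psurj exact _
        qM.surj_semilinear_map_axioms q_surj(2) XR \<pi>_zero])
    show "surj_semilinear_map R S W' V \<pi> p"
      by (intro surj_semilinear_map.intro surj_semilinear_map_axioms.intro p(1) q.scalar_surj)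
    show "h \<in> coboundaries R M W 1" if "h \<in> cocycles R M W 1"
      "compose (carrier (resolution_module R M 1)) \<phi> h \<in> coboundaries R M W' 1" for h
      using ext that unfolding W_def W'_def \<phi>_def by blast
    show "m \<in> ideal_smult R X M" if "m \<in> carrier M" "qM m = \<zero>\<^bsub>N\<^esub>" for m
      using module.reduction_kernel[OF M XR that(1)] that(2) unfolding qM_def N_def by blast
  qed
  then show ?thesis unfolding W_def W'_def V_def S_def N_def J_def \<omega>S_def \<pi>_def X_def .
qed

section \<open>Hilbert polynomials\<close>

text \<open>This is \<open>is_dual_hilbert_coeffs\<close> with the length function replaced by an
  arbitrary sequence \<open>h\<close>, so that the polynomial argument sees neither rings nor
  modules; the shift to \<open>h (n + 1)\<close> is kept.\<close>

definition hilbert_coeffs :: "(nat \<Rightarrow> enat) \<Rightarrow> nat \<Rightarrow> (nat \<Rightarrow> int) \<Rightarrow> bool"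
  where "hilbert_coeffs h d c \<longleftrightarrow> (\<forall>i>d. c i = 0) \<and> (\<exists>n0. \<forall>n\<ge>n0. \<exists>l.
    h (n + 1) = enat l \<and> int l = (\<Sum>i=0..d. (- 1) ^ i * c i * int ((n + d - i) choose (d - i))))"

definition hilbert_value :: "nat \<Rightarrow> (nat \<Rightarrow> int) \<Rightarrow> nat \<Rightarrow> int"
  where "hilbert_value d c n = (\<Sum>i=0..d. (- 1) ^ i * c i * int ((n + d - i) choose (d - i)))"

lemma hilbert_value_split: "hilbert_value (Suc e) c n
    = (\<Sum>i=0..e. (- 1) ^ i * c i * int ((n + Suc e - i) choose (Suc e - i))) + (- 1) ^ Suc e * c (Suc e)"
  by (simp add: hilbert_value_def)

text \<open>Pascal's rule for each binomial coefficient. The constant term, which carries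
  \<open>c (Suc e)\<close>, cancels, and the other coefficients reappear unchanged one degree
  lower.\<close>

lemma hilbert_value_diff: "hilbert_value (Suc e) c (Suc n) - hilbert_value (Suc e) c n = hilbert_value e c (Suc n)"
proof -
  have "int ((Suc n + Suc e - i) choose (Suc e - i)) - int ((n + Suc e - i) choose (Suc e - i))
      = int ((Suc n + e - i) choose (e - i))" if i: "i \<le> e" for i
  proof -
    obtain k where k: "e = i + k" using i le_Suc_ex by blast
    have "(Suc (Suc (n + k)) choose Suc k) = (Suc (n + k) choose k) + (Suc (n + k) choose Suc k)" by simp
    then show ?thesis unfolding k by (simp add: Suc_diff_le)
  qed
  then show ?thesis
    unfolding hilbert_value_split
    by (simp add: hilbert_value_def sum_subtractf[symmetric] right_diff_distrib[symmetric])
qed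

text \<open>The binomial polynomials are linearly independent: differencing lowers the degree and
  settles all coefficients but the last, which up to sign is then the whole value.\<close>

lemma hilbert_value_eq_zero:
  assumes "\<And>n. n \<ge> n0 \<Longrightarrow> hilbert_value d c n = 0" and "i \<le> d"
  shows "c i = 0"
  using assms
proof (induction d arbitrary: n0 i)
  case 0
  then show ?case by (auto simp: hilbert_value_def)
next
  case (Suc e)
  have "hilbert_value e c n = 0" if "Suc n0 \<le> n" for n
  proof -
    obtain m where m: "n = Suc m" "n0 \<le> m" using \<open>Suc n0 \<le> n\<close> by (cases n) auto
    show ?thesis using hilbert_value_diff[of e c m] Suc.prems(1)[of m] Suc.prems(1)[of "Suc m"] m by simp
  qed
  then have c: "c j = 0" if "j \<le> e" for j using Suc.IH that by blast
  have "hilbert_value (Suc e) c n0 = (- 1) ^ Suc e * c (Suc e)"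
    unfolding hilbert_value_split using c by simp
  then have "c (Suc e) = 0" using Suc.prems(1)[of n0] by simp
  then show ?case using c Suc.prems(2) by (cases "i = Suc e") auto
qed

lemma hilbert_value_minus: "hilbert_value d (\<lambda>i. c i - c' i) n = hilbert_value d c n - hilbert_value d c' n"
  by (simp add: hilbert_value_def algebra_simps sum_subtractf)

lemma hilbert_coeffs_unique:
  assumes "hilbert_coeffs h d c" "hilbert_coeffs h d c'"
  shows "c = c'"
proof
  fix i
  obtain n1 n2 where n: "\<And>n. n \<ge> n1 \<Longrightarrow> \<exists>l. h (n + 1) = enat l \<and> int l = hilbert_value d c n"
    "\<And>n. n \<ge> n2 \<Longrightarrow> \<exists>l. h (n + 1) = enat l \<and> int l = hilbert_value d c' n"
    using assms unfolding hilbert_coeffs_def hilbert_value_def by blast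
  have "hilbert_value d (\<lambda>i. c i - c' i) n = 0" if "max n1 n2 \<le> n" for n
    using n(1)[of n] n(2)[of n] that by (auto simp: hilbert_value_minus)
  then have "c i - c' i = 0" if "i \<le> d" using hilbert_value_eq_zero[of "max n1 n2" d _ i] that by blast
  moreover have "c i = 0" "c' i = 0" if "i > d" using assms that unfolding hilbert_coeffs_def by auto
  ultimately show "c i = c' i" by (cases "i \<le> d") auto
qed

text \<open>The two sides have coefficients simultaneously, by taking differences in one direction and
  sums in the other; if they do not exist, both descriptions denote the same junk value.\<close>

lemma hilbert_coeffs_difference:
  assumes fin: "\<And>n. h n < \<infinity>" and rec: "\<And>n. n \<ge> n0 \<Longrightarrow> h (Suc n) = h n + k (Suc n)" and i: "i \<le> e"
  shows "(THE c. hilbert_coeffs k e c) i = (THE c. hilbert_coeffs h (Suc e) c) i"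
proof -
  have "\<exists>l. h n = enat l" for n using fin[of n] by auto
  then obtain a where a: "\<And>n. h n = enat (a n)" by metis
  \<comment> \<open>As \<open>h (Suc n)\<close> is finite, so is its summand
    \<open>k (Suc n)\<close>, and the recursion becomes a difference of natural numbers.\<close>
  have "\<exists>l. k (Suc n) = enat l \<and> a (Suc n) = a n + l" if "n \<ge> n0" for n
    using rec[OF that] unfolding a by (cases "k (Suc n)") auto
  then obtain b where b: "\<And>n. n \<ge> n0 \<Longrightarrow> k (Suc n) = enat (b n)" "\<And>n. n \<ge> n0 \<Longrightarrow> a (Suc n) = a n + b n" by metis
  \<comment> \<open>The truncation is forced by the convention that coefficients beyond the degree
    are zero, as \<open>c (Suc e)\<close> may be nonzero.\<close>
  have down: "hilbert_coeffs k e (\<lambda>i. if i \<le> e then c i else 0)" if "hilbert_coeffs h (Suc e) c" for c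
  proof -
    obtain n1 where n1: "\<And>n. n \<ge> n1 \<Longrightarrow> int (a (n + 1)) = hilbert_value (Suc e) c n"
      using \<open>hilbert_coeffs h (Suc e) c\<close> unfolding hilbert_coeffs_def hilbert_value_def a by auto
    have "int (b n) = hilbert_value e c n" if n: "n \<ge> Suc (max n0 n1)" for n
    proof -
      obtain m where m: "n = Suc m" "m \<ge> n0" "m \<ge> n1" using n by (cases n) auto
      have "int (b n) = int (a (Suc n)) - int (a n)" using b(2)[of n] m by simp
      also have "\<dots> = hilbert_value (Suc e) c (Suc m) - hilbert_value (Suc e) c m"
        using n1[of m] n1[of "Suc m"] m by simp
      finally show ?thesis using hilbert_value_diff m by simp
    qed
    moreover have "hilbert_value e (\<lambda>i. if i \<le> e then c i else 0) = hilbert_value e c"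
      by (auto simp: hilbert_value_def fun_eq_iff intro!: sum.cong)
    ultimately have "\<exists>l. k (n + 1) = enat l \<and> int l = hilbert_value e (\<lambda>i. if i \<le> e then c i else 0) n"
      if "n \<ge> Suc (max n0 n1)" for n
      using that b(1)[of n] by (intro exI[of _ "b n"]) simp
    then show ?thesis unfolding hilbert_coeffs_def hilbert_value_def[symmetric] by auto
  qed
  show ?thesis
  proof (cases "\<exists>c. hilbert_coeffs h (Suc e) c")
    case True
    then obtain c where c: "hilbert_coeffs h (Suc e) c" by blast
    have "(THE c. hilbert_coeffs h (Suc e) c) = c" using c hilbert_coeffs_unique by (blast intro: the_equality)
    moreover have "(THE c. hilbert_coeffs k e c) = (\<lambda>i. if i \<le> e then c i else 0)"
      using down[OF c] hilbert_coeffs_unique by (blast intro: the_equality)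
    ultimately show ?thesis using i by simp
  next
    case False
    have "\<not> hilbert_coeffs k e c" for c
    proof
      assume c: "hilbert_coeffs k e c"
      then have c0: "\<forall>i>e. c i = 0" by (simp add: hilbert_coeffs_def)
      obtain n1 where n1: "\<And>n. n \<ge> n1 \<Longrightarrow> \<exists>l. k (n + 1) = enat l \<and> int l = hilbert_value e c n"
        using c unfolding hilbert_coeffs_def hilbert_value_def by blast
      define n2 where "n2 = max n0 n1"
      have n2: "int (b n) = hilbert_value e c n" if "n \<ge> n2" for n
        using n1[of n] b(1)[of n] that by (auto simp: n2_def)
      \<comment> \<open>The constant of summation, fixed by the value at \<open>n2\<close>; the sign
        in \<open>c'\<close> undoes the sign in front of the last coefficient.\<close>
      define K where "K = int (a (n2 + 1)) - hilbert_value (Suc e) c n2"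
      define c' where "c' = c(Suc e := (- 1) ^ Suc e * K)"
      have c': "hilbert_value (Suc e) c' n = hilbert_value (Suc e) c n + K" for n
      proof -
        have "(- 1) ^ Suc e * ((- 1) ^ Suc e * K) = K"
          by (simp add: mult.assoc[symmetric] power_add[symmetric])
        moreover have "(\<Sum>i=0..e. (- 1) ^ i * c' i * int ((n + Suc e - i) choose (Suc e - i)))
          = (\<Sum>i=0..e. (- 1) ^ i * c i * int ((n + Suc e - i) choose (Suc e - i)))"
          by (rule sum.cong) (auto simp: c'_def)
        moreover have "c (Suc e) = 0" using c0 by simp
        ultimately show ?thesis unfolding hilbert_value_split by (simp add: c'_def)
      qed
      have "int (a (n + 1)) = hilbert_value (Suc e) c' n" if "n \<ge> n2" for n
        using that
      proof (induction rule: dec_induct)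
        case base
        show ?case by (simp add: c' K_def)
      next
        case (step n)
        have "hilbert_value (Suc e) c' (Suc n) - hilbert_value (Suc e) c' n = hilbert_value e c (Suc n)"
          unfolding c' using hilbert_value_diff[of e c n] by simp
        also have "\<dots> = int (b (Suc n))" using n2[of "Suc n"] step by simp
        also have "\<dots> = int (a (Suc (Suc n))) - int (a (Suc n))" using b(2)[of "Suc n"] step by (simp add: n2_def)
        finally show ?case using step.IH by simp
      qed
      then have "\<forall>n\<ge>n2. \<exists>l. h (n + 1) = enat l \<and> int l = hilbert_value (Suc e) c' n"
        unfolding a by blast
      moreover have "\<forall>i>Suc e. c' i = 0" using c0 by (simp add: c'_def)
      ultimately have "hilbert_coeffs h (Suc e) c'"
        unfolding hilbert_coeffs_def hilbert_value_def[symmetric] by blast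
      then show False using False by blast
    qed
    \<comment> \<open>Neither side has coefficients, so both predicates are identically false and
      the two definite descriptions coincide.\<close>
    then have "hilbert_coeffs k e = hilbert_coeffs h (Suc e)" using False by (auto simp: fun_eq_iff)
    then show ?thesis by simp
  qed
qed

section \<open>Finiteness of the Hilbert function and the conclusion\<close>

lemma dual_hilbert_coeff_hilbert_coeffs:
  "dual_hilbert_coeff R d \<omega> I M
    = (THE c. hilbert_coeffs (\<lambda>n. module_length R (hom_module R M (adic_quotient R I \<omega> n))) d c)"
  unfolding dual_hilbert_coeff_def is_dual_hilbert_coeffs_def hilbert_coeffs_def by (rule refl)

text \<open>Each element of the maximal ideal has a power in \<open>I\<close>, hence one in
  \<open>I^n\<close>, and so acts nilpotently on the finitely generated module
  \<open>\<omega>/I^n \<omega>\<close>. That module has finite length, and so has \<open>Hom\<close>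
  into it from a finitely generated module.\<close>

lemma hom_adic_finite_length:
  assumes loc: "noetherian_local_ring R \<mm>" and M: "module R M" "finitely_generated R M"
    and \<omega>: "module R \<omega>" "finitely_generated R \<omega>" and I: "ideal I R" and rad: "\<mm> \<subseteq> ideal_radical R I"
  shows "module_length R (hom_module R M (adic_quotient R I \<omega> n)) < \<infinity>"
proof -
  interpret A: adic R \<omega> I by (intro adic.intro adic_axioms.intro \<omega> I)
  have noeth: "noetherian_ring R" using loc by (simp add: noetherian_local_ring_def)
  interpret q: surj_semilinear_map R R \<omega> "adic_quotient R I \<omega> n" id "\<lambda>w. A.filt n +>\<^bsub>\<omega>\<^esub> w"
    by (rule A.adic_quotient_map)
  have fg: "finitely_generated R (adic_quotient R I \<omega> n)"
    by (rule q.image_finitely_generated[OF \<omega>(2)]) (simp add: A.carrier_adic_quotient)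
  have "module_length R (adic_quotient R I \<omega> n) < \<infinity>"
  proof (rule q.cod.finite_length[OF loc q.cod.finitely_generated_noetherian[OF noeth fg]])
    fix a assume "a \<in> \<mm>"
    then have a: "a \<in> ideal_radical R I" using rad by blast
    then have aR: "a \<in> carrier R" by (simp add: ideal_radical_def)
    obtain k :: nat where k: "a [^]\<^bsub>R\<^esub> k \<in> ideal_power R I n" using A.R.pow_radical_ideal_power[OF I a] by blast
    have akR: "a [^]\<^bsub>R\<^esub> k \<in> carrier R" using k A.power_subset by blast
    have "a [^]\<^bsub>R\<^esub> k \<odot>\<^bsub>adic_quotient R I \<omega> n\<^esub> X = \<zero>\<^bsub>adic_quotient R I \<omega> n\<^esub>"
      if X: "X \<in> carrier (adic_quotient R I \<omega> n)" for X
    proof -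
      obtain v where v: "v \<in> carrier \<omega>" "X = A.filt n +>\<^bsub>\<omega>\<^esub> v"
        using X unfolding A.carrier_adic_quotient by (elim imageE)
      have "a [^]\<^bsub>R\<^esub> k \<odot>\<^bsub>adic_quotient R I \<omega> n\<^esub> X = A.filt n +>\<^bsub>\<omega>\<^esub> (a [^]\<^bsub>R\<^esub> k \<odot>\<^bsub>\<omega>\<^esub> v)"
        unfolding v(2) using q.hom_smult[OF akR v(1)] by simp
      also have "\<dots> = \<zero>\<^bsub>adic_quotient R I \<omega> n\<^esub>"
        using A.adic_quotient_kernel[of "a [^]\<^bsub>R\<^esub> k \<odot>\<^bsub>\<omega>\<^esub> v" n] ideal_smult_incl[OF k v(1)] akR v(1) by simp
      finally show ?thesis .
    qed
    then show "\<exists>k :: nat. \<forall>X\<in>carrier (adic_quotient R I \<omega> n).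
        a [^]\<^bsub>R\<^esub> k \<odot>\<^bsub>adic_quotient R I \<omega> n\<^esub> X = \<zero>\<^bsub>adic_quotient R I \<omega> n\<^esub>" by blast
  qed
  then show ?thesis by (rule hom_module_finite_length[OF M(1) q.cod.module_axioms M(2)])
qed

theorem corollary3p4:
  fixes R :: "('a, 'r) ring_scheme"
    and \<omega> :: "('a, 'b, 'w) module_scheme"
    and M :: "('a, 'c, 'm) module_scheme"
    and \<mm> I :: "'a set" and x :: 'a and d :: nat
  defines "S \<equiv> R Quot (cgenideal R x)"
    and "J \<equiv> (\<lambda>a. cgenideal R x +>\<^bsub>R\<^esub> a) ` I"
    and "N \<equiv> reduction R (cgenideal R x) M"
    and "\<omega>\<^sub>S \<equiv> reduction R (cgenideal R x) \<omega>"
  assumes "cohen_macaulay_local_ring R \<mm>"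
    and "krull_dim R = enat d" and "d \<ge> 1"
    and "infinite (carrier (R Quot \<mm>))"
    and "canonical_module R \<mm> \<omega>"
    and "primary_to R \<mm> I"
    and "maximal_cohen_macaulay R \<mm> M"
    and "x \<in> I - ideal_power R I 2"
    and "superficial R I (direct_sum (regular_module R) \<omega>) x"
    and "filter_regular (direct_sum (dual_Ext R I \<omega> M 1) (dual_Ext R I \<omega> M 2))
           (\<lambda>n. dual_Ext_grade R I \<omega> M 1 n \<times> dual_Ext_grade R I \<omega> M 2 n)
           (up_ring.monom (UP R) x 1)"
  shows "\<forall>i\<in>{0..d - 1}. dual_hilbert_coeff S (d - 1) \<omega>\<^sub>S J N i = dual_hilbert_coeff R d \<omega> I M i"
proof
  fix i assume i: "i \<in> {0..d - 1}"
  have loc: "noetherian_local_ring R \<mm>" using assms(5) by (simp add: cohen_macaulay_local_ring_def)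
  then have noeth: "noetherian_ring R" and R: "cring R" by (simp_all add: noetherian_local_ring_def)
  have M: "module R M" "finitely_generated R M"
    using \<open>maximal_cohen_macaulay R \<mm> M\<close> by (simp_all add: maximal_cohen_macaulay_def)
  have "maximal_cohen_macaulay R \<mm> \<omega>" using \<open>canonical_module R \<mm> \<omega>\<close> by (simp add: canonical_module_def)
  then have \<omega>: "module R \<omega>" "finitely_generated R \<omega>" and depth: "depth R \<mm> \<omega> = enat d"
    using \<open>krull_dim R = enat d\<close> by (simp_all add: maximal_cohen_macaulay_def)
  have I: "ideal I R" and rad: "ideal_radical R I = \<mm>"
    using \<open>primary_to R \<mm> I\<close> by (simp_all add: primary_to_def)
  interpret \<omega>: module R \<omega> by (rule \<omega>(1))
  have x: "x \<in> I" "x \<in> carrier R" using \<open>x \<in> I - ideal_power R I 2\<close> ideal.Icarr[OF I] by blast+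
  have "I \<subseteq> \<mm>"
  proof
    fix a assume a: "a \<in> I"
    then have "a [^]\<^bsub>R\<^esub> (1 :: nat) \<in> I" using ideal.Icarr[OF I] by simp
    then show "a \<in> \<mm>" unfolding rad[symmetric] ideal_radical_def using a ideal.Icarr[OF I] by blast
  qed
  have sup: "superficial R I \<omega> x"
    by (rule superficial_direct_sumD[OF regular_module_module[OF R] \<omega>(1) I _ x(2)]) fact
  have noeth_\<omega>: "noetherian_below R \<omega> (carrier \<omega>)"
    by (rule \<omega>.finitely_generated_noetherian[OF noeth \<omega>(2)])
  \<comment> \<open>Since \<open>\<omega>\<close> is maximal Cohen-Macaulay,
    \<open>d \<ge> 1\<close> provides an \<open>\<omega>\<close>-regular element \<open>y\<close> of
    the maximal ideal, from which regularity of \<open>x\<close> is derived.\<close>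
  have "depth R \<mm> \<omega> > 0" using depth \<open>d \<ge> 1\<close> by (simp add: zero_enat_def)
  then obtain y where y: "y \<in> \<mm>" "\<And>v. v \<in> carrier \<omega> \<Longrightarrow> y \<odot>\<^bsub>\<omega>\<^esub> v = \<zero>\<^bsub>\<omega>\<^esub> \<Longrightarrow> v = \<zero>\<^bsub>\<omega>\<^esub>"
    using \<omega>.depth_pos_regular by metis
  have reg: "v = \<zero>\<^bsub>\<omega>\<^esub>" if "v \<in> carrier \<omega>" "x \<odot>\<^bsub>\<omega>\<^esub> v = \<zero>\<^bsub>\<omega>\<^esub>" for v
    by (rule \<omega>.superficial_regular[OF loc noeth_\<omega> I \<open>I \<subseteq> \<mm>\<close> x(2) sup _ y(2) that])
      (use y(1) rad in simp_all)
  obtain n1 where n1: "\<forall>n\<ge>n1. \<forall>v\<in>carrier \<omega>. x \<odot>\<^bsub>\<omega>\<^esub> v \<in> ideal_smult R (ideal_power R I (Suc n)) \<omega> \<longrightarrow>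
      v \<in> ideal_smult R (ideal_power R I n) \<omega>"
    using \<omega>.superficial_colon[OF noeth noeth_\<omega> I x(2) sup reg] by blast
  \<comment> \<open>Injectivity on \<open>Ext^1\<close> in large degrees is read off the first
    summand \<open>D^1\<close> of the filter regularity assumption.\<close>
  obtain n2 where n2: "\<forall>n\<ge>n2. \<forall>h\<in>cocycles R M (adic_quotient R I \<omega> n) 1.
      compose (carrier (resolution_module R M 1)) (adic_mult R I \<omega> n 1 x) h
        \<in> coboundaries R M (adic_quotient R I \<omega> (n + 1)) 1 \<longrightarrow>
      h \<in> coboundaries R M (adic_quotient R I \<omega> n) 1"
    using filter_regular_Ext_injective[OF M noeth \<omega>(1) I x(1) assms(14)] by blast
  define h k where "h n = module_length R (hom_module R M (adic_quotient R I \<omega> n))"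
    and "k n = module_length S (hom_module S N (adic_quotient S J \<omega>\<^sub>S n))" for n
  \<comment> \<open>From \<open>max n1 n2\<close> on, multiplication by \<open>x\<close> is
    injective both between the quotients of \<open>\<omega>\<close> and on
    \<open>Ext^1\<close>.\<close>
  have rec: "h (Suc n) = h n + k (Suc n)" if n: "max n1 n2 \<le> n" for n
    using hom_adic_length_add[OF noeth M \<omega>(1) I x(1), of n] n1 n2 n
    unfolding h_def k_def S_def N_def J_def \<omega>\<^sub>S_def Suc_eq_plus1 by simp
  have fin: "h n < \<infinity>" for n
    unfolding h_def by (rule hom_adic_finite_length[OF loc M \<omega> I]) (simp add: rad)
  obtain e where e: "d = Suc e" using \<open>d \<ge> 1\<close> by (cases d) auto
  have "(THE c. hilbert_coeffs k e c) i = (THE c. hilbert_coeffs h (Suc e) c) i"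
    by (rule hilbert_coeffs_difference[where h = h and k = k, OF fin, of "max n1 n2"])
      (use rec i e in simp_all)
  then show "dual_hilbert_coeff S (d - 1) \<omega>\<^sub>S J N i = dual_hilbert_coeff R d \<omega> I M i"
    unfolding dual_hilbert_coeff_hilbert_coeffs h_def k_def e by simp
qed

end
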